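(* Let $\Omega$ be the Lie ball of dimension $4$, with generic norm $N$, and for an integer $m\ge1$ and a real number $\mu>0$ let $$\widehat{\Omega}_{m}(\mu)=\{(z,Z)\in\Omega\times\mathbb{C}^{m}:\|Z\|^{2}<N(z,z)^{\mu}\}.$$ For $1\le m\le7$, let $\mu_m$ be the smallest positive root of the polynomial $q_m(\mu)=P_{\mu}^{m}\left(\frac12\right)$, where, with $(m+1)_j=(m+1)(m+2)\cdots(m+j)$, $$P_{\mu}^{m}(\eta)=(1-\mu)(2-\mu)^{2}(3-\mu)+(m+1)(1-\mu)(7-5\mu)(4-3\mu)\mu\eta+(m+1)_2(1-\mu)(23-25\mu)\mu^{2}\eta^{2}+2(m+1)_3(4-5\mu)\mu^{3}\eta^{3}+(m+1)_4\mu^{4}\eta^{4}.$$ If $m\ge8$, the domain $\widehat{\Omega}_{m}(\mu)$ is a Lu Qikeng domain for every $\mu\in\,]0,+\infty[$. If $1\le m\le7$, the domain $\widehat{\Omega}_{m}(\mu)$ is a Lu Qikeng domain if and only if $0<\mu\le\mu_m$.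
   Context: A domain $U\subset\mathbb{C}^n$ is called a Lu Qikeng domain if its Bergman kernel $K_U(z,w)$ has no zero on $U\times U$. $\|\cdot\|$ denotes the standard Hermitian norm. The Lie ball of dimension $n$ (domain of type $IV_n$) is $\Omega=\{z\in\mathbb{C}^{n}: \|z\|<1,\ 1-2\|z\|^{2}+|z\cdot z|^{2}>0\}$, where $z\cdot z=\sum_i z_i^2$; its generic norm satisfies $N(z,z)=1-2\|z\|^2+|z\cdot z|^2$. For $1\le m\le 7$ the polynomial $q_m$ has at least one positive root. *)

theory Defs
  imports "HOL-Analysis.Analysis"
begin

text \<open>
  The space \<open>\<complex>\<^sup>n \<times> \<complex>\<^sup>m = \<complex>\<^sup>n\<^sup>+\<^sup>m\<close> is the type \<open>(complex ^ 'n) \<times> (complex ^ 'm)\<close>, whose library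
  norm is the standard Hermitian norm and whose \<open>lborel\<close> is Lebesgue measure on \<open>\<real>\<^sup>2\<^sup>n\<^sup>+\<^sup>2\<^sup>m\<close>.
\<close>

definition cscale :: "complex \<Rightarrow> (complex ^ 'n) \<times> (complex ^ 'm) \<Rightarrow> (complex ^ 'n) \<times> (complex ^ 'm)"
  where "cscale c p = (c *s fst p, c *s snd p)"

text \<open>For an open set, holomorphic means complex (Frechet) differentiable at every point.\<close>

definition holomorphic_sv :: "((complex ^ 'n) \<times> (complex ^ 'm) \<Rightarrow> complex)
    \<Rightarrow> ((complex ^ 'n) \<times> (complex ^ 'm)) set \<Rightarrow> bool"
  where "holomorphic_sv f U \<longleftrightarrow>
    (\<forall>p\<in>U. \<exists>D. (f has_derivative D) (at p) \<and> (\<forall>c v. D (cscale c v) = c * D v))"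

definition bergman_space :: "((complex ^ 'n) \<times> (complex ^ 'm)) set
    \<Rightarrow> ((complex ^ 'n) \<times> (complex ^ 'm) \<Rightarrow> complex) set"
  where "bergman_space U =
    {f. holomorphic_sv f U \<and> set_integrable lborel U (\<lambda>p. (cmod (f p))\<^sup>2)}"

definition is_bergman_kernel :: "((complex ^ 'n) \<times> (complex ^ 'm)) set
    \<Rightarrow> ((complex ^ 'n) \<times> (complex ^ 'm) \<Rightarrow> (complex ^ 'n) \<times> (complex ^ 'm) \<Rightarrow> complex) \<Rightarrow> bool"
  where "is_bergman_kernel U K \<longleftrightarrow>
    (\<forall>w\<in>U. (\<lambda>z. K z w) \<in> bergman_space U) \<and>
    (\<forall>f\<in>bergman_space U. \<forall>w\<in>U. f w = (LINT z:U|lborel. f z * cnj (K z w)))"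

text \<open>
  The reproducing kernel is unique on \<open>U \<times> U\<close>; requiring it to vanish elsewhere makes it
  unique as a total function.
\<close>

definition bergman_kernel :: "((complex ^ 'n) \<times> (complex ^ 'm)) set
    \<Rightarrow> (complex ^ 'n) \<times> (complex ^ 'm) \<Rightarrow> (complex ^ 'n) \<times> (complex ^ 'm) \<Rightarrow> complex"
  where "bergman_kernel U =
    (THE K. is_bergman_kernel U K \<and> (\<forall>z w. (z, w) \<notin> U \<times> U \<longrightarrow> K z w = 0))"

definition lu_qikeng_domain :: "((complex ^ 'n) \<times> (complex ^ 'm)) set \<Rightarrow> bool"
  where "lu_qikeng_domain U \<longleftrightarrow>
    U \<noteq> {} \<and> open U \<and> connected U \<and> (\<forall>z\<in>U. \<forall>w\<in>U. bergman_kernel U z w \<noteq> 0)"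

text \<open>The value \<open>N(z,z)\<close> of the generic norm of the Lie ball on the diagonal.\<close>

definition lie_norm :: "complex ^ 'n \<Rightarrow> real"
  where "lie_norm z = 1 - 2 * (norm z)\<^sup>2 + (cmod (\<Sum>i\<in>UNIV. (z $ i)\<^sup>2))\<^sup>2"

definition lie_ball :: "(complex ^ 'n) set"
  where "lie_ball = {z. norm z < 1 \<and> lie_norm z > 0}"

definition inflated_lie_ball :: "real \<Rightarrow> ((complex ^ 'n) \<times> (complex ^ 'm)) set"
  where "inflated_lie_ball \<mu> =
    {(z, Z). z \<in> lie_ball \<and> (norm Z)\<^sup>2 < lie_norm z powr \<mu>}"

text \<open>\<open>(m+1)\<^sub>j = (m+1)(m+2)\<cdots>(m+j)\<close> is \<open>pochhammer (real m + 1) j\<close>.\<close>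

definition lqk_poly :: "nat \<Rightarrow> real \<Rightarrow> real \<Rightarrow> real"
  where "lqk_poly m \<mu> \<eta> =
      (1 - \<mu>) * (2 - \<mu>)^2 * (3 - \<mu>)
    + (real m + 1) * (1 - \<mu>) * (7 - 5 * \<mu>) * (4 - 3 * \<mu>) * \<mu> * \<eta>
    + pochhammer (real m + 1) 2 * (1 - \<mu>) * (23 - 25 * \<mu>) * \<mu>^2 * \<eta>^2
    + 2 * pochhammer (real m + 1) 3 * (4 - 5 * \<mu>) * \<mu>^3 * \<eta>^3
    + pochhammer (real m + 1) 4 * \<mu>^4 * \<eta>^4"

text \<open>
  Smallest positive root of \<open>q\<^sub>m(\<mu>) = P\<^sub>\<mu>\<^sup>m(1/2)\<close>; meaningful when \<open>q\<^sub>m\<close> has a positive root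
  (\<open>1 \<le> m \<le> 7\<close>).
\<close>

definition smallest_root :: "nat \<Rightarrow> real"
  where "smallest_root m = (LEAST \<mu>. 0 < \<mu> \<and> lqk_poly m \<mu> (1/2) = 0)"

end

theory Submission
  imports Defs "HOL-Complex_Analysis.Cauchy_Integral_Formula" "HOL-Probability.Distributions"
    "HOL-Computational_Algebra.Fundamental_Theorem_Algebra"
begin

text \<open>
  The Bergman kernel of the inflated Lie ball is never written down at a general pair of points.
  A biholomorphic self-map \<open>\<phi>\<close> whose change of variables formula has density \<open>\<bar>J\<bar>\<^sup>2\<close>, with \<open>J\<close>
  holomorphic and without zeros, turns a kernel function \<open>k\<close> at \<open>\<phi> q\<close> into the kernel function
  \<open>p \<mapsto> J p * cnj (J q) * k (\<phi> p)\<close> at \<open>q\<close> (\<open>reproduces_at_automorphism\<close>), and this has a zero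
  exactly when \<open>k\<close> has one. Hence it suffices to know the kernel at one point of every orbit.

  In the coordinates \<open>a, b, c, d\<close> of a \<open>2 \<times> 2\<close> matrix \<open>M\<close> the Lie ball of dimension 4 is the unit
  ball of matrices, and the generic norm is \<open>det (I - M M\<^sup>*)\<close>. Unitary matrices and a Moebius
  transformation of the entry \<open>a\<close>, lifted to the fibre variable \<open>Z\<close> by a scalar factor, move every
  point to some \<open>(0, axis i0 t)\<close> (\<open>inflated_lie_ball_transitive\<close>). There the kernel function
  depends on \<open>Z\<^sub>i\<^sub>0\<close> only: averaging over rotations and Cauchy's formula reduce the reproducing
  property to one complex variable, and the kernel function is the power series
  \<open>G x = (\<Sum>k. x ^ k / M k)\<close> at \<open>x = cnj t * Z\<^sub>i\<^sub>0\<close>, where \<open>M k\<close> is the integral of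
  \<open>\<bar>Z\<^sub>i\<^sub>0\<bar> ^ (2 * k)\<close> over the domain (\<open>reproduces_at_base\<close>). So the domain is Lu Qikeng if and only
  if \<open>G\<close> has no zero in the unit disc.

  Up to a constant, \<open>M k\<close> is \<open>k! / (m + k)!\<close> divided by Hua's polynomial
  \<open>(s + 1) (s + 2)\<^sup>2 (s + 3)\<close> at \<open>s = \<mu> (m + k)\<close> (\<open>inflated_moment\<close>). Expanding this polynomial in
  rising factorials of \<open>m + k + 1\<close> sums the series: up to a factor without zeros, \<open>G t\<close> is
  \<open>P (1 / (1 - t))\<close>, where \<open>P\<close> is the polynomial of the theorem, and \<open>t \<mapsto> 1 / (1 - t)\<close> maps the unit
  disc onto the half-plane \<open>Re \<eta> > 1/2\<close> (\<open>lu_qikeng_iff\<close>).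

  It remains to decide when the quartic \<open>P\<close> has a zero with \<open>Re \<eta> > 1/2\<close>. Let \<open>A\<^sub>0, ..., A\<^sub>4\<close> be its
  Taylor coefficients at \<open>1/2\<close>, so that \<open>A\<^sub>0 = q\<^sub>m(\<mu>)\<close>. The Routh-Hurwitz inequality follows from
  \<open>A\<^sub>0 \<ge> 0\<close> and \<open>A\<^sub>1 > 0\<close> for all \<open>m \<ge> 1\<close>, and excludes such a zero (\<open>lqk_no_root\<close>); conversely
  \<open>A\<^sub>0 < 0\<close> or \<open>A\<^sub>1 < 0\<close> forces one (\<open>lqk_root\<close>). For \<open>m \<ge> 8\<close> both \<open>A\<^sub>0\<close> and \<open>A\<^sub>1\<close> are positive
  polynomials. For \<open>m \<le> 7\<close> the coefficient \<open>A\<^sub>1\<close> is positive up to the first zero of \<open>q\<^sub>m\<close>, and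
  beyond it \<open>A\<^sub>0\<close> stays negative, except that for \<open>m = 1\<close> and \<open>m = 2\<close> it changes sign once more, at a
  place where already \<open>A\<^sub>1 < 0\<close> (\<open>lqk_small\<close>).
\<close>

section \<open>Lebesgue measure under linear and Moebius maps\<close>

lemma nn_integral_lborel_translate:
  fixes h :: "'a::euclidean_space \<Rightarrow> ennreal"
  assumes "h \<in> borel_measurable borel"
  shows "(\<integral>\<^sup>+x. h (x + a) \<partial>lborel) = (\<integral>\<^sup>+x. h x \<partial>lborel)"
proof -
  have "(\<integral>\<^sup>+x. h x \<partial>lborel) = (\<integral>\<^sup>+x. h x \<partial>distr lborel borel ((+) a))"
    by (simp add: lborel_distr_plus)
  also have "\<dots> = (\<integral>\<^sup>+x. h (a + x) \<partial>lborel)"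
    using assms by (subst nn_integral_distr) auto
  finally show ?thesis by (simp add: add.commute)
qed

text \<open>
  Uniqueness of translation invariant measures, proved by Tonelli's theorem: in
  \<open>\<integral>\<integral> h (T x) k y\<close> translate \<open>y\<close> by \<open>- T x\<close>, then \<open>x\<close> by the preimage of \<open>y\<close>, then \<open>y\<close> back by
  \<open>T x\<close>. The value of the constant is irrelevant wherever only ratios of integrals matter.
\<close>
lemma nn_integral_linear_bij:
  fixes T :: "'a::euclidean_space \<Rightarrow> 'b::euclidean_space"
  assumes lin: "linear T" and bij: "bij T"
  obtains c :: real where "c > 0"
    "\<And>h. h \<in> borel_measurable borel \<Longrightarrow> (\<integral>\<^sup>+y. h y \<partial>lborel) = ennreal c * (\<integral>\<^sup>+x. h (T x) \<partial>lborel)"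
proof -
  interpret T: linear T by (rule lin)
  have bl: "bounded_linear T" using lin by (simp add: linear_conv_bounded_linear)
  have Tm [measurable]: "T \<in> borel_measurable borel"
    using bl by (intro borel_measurable_continuous_onI linear_continuous_on)
  have inj: "inj T" using bij by (simp add: bij_def)
  obtain B where B: "B > 0" "\<And>x. norm x * B \<le> norm (T x)"
    using linear_inj_bounded_below_pos[OF lin inj] by (metis mult.commute)
  define k :: "'b \<Rightarrow> ennreal" where "k = indicator (ball 0 1)"
  have km [measurable]: "k \<in> borel_measurable borel" unfolding k_def
    by (intro borel_measurable_indicator) simp
  have ksym: "k (- y) = k y" for y by (simp add: k_def indicator_def)
  define J where "J = (\<integral>\<^sup>+y. k y \<partial>lborel)"
  define I where "I = (\<integral>\<^sup>+x. k (T x) \<partial>lborel)"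
  have J: "J = ennreal (unit_ball_vol (real DIM('b)))"
    by (simp add: J_def k_def emeasure_ball)
  have Iv: "I = emeasure lborel (T -` ball 0 1)"
  proof -
    have "k (T x) = indicator (T -` ball 0 1) x" for x by (simp add: k_def indicator_def)
    moreover have "T -` ball 0 1 \<in> sets lborel"
      using measurable_sets[OF Tm, of "ball 0 1"] by simp
    ultimately show ?thesis by (simp add: I_def)
  qed
  have I_fin: "I < \<infinity>"
  proof -
    have "T -` ball 0 1 \<subseteq> ball 0 (1/B)"
    proof
      fix x assume "x \<in> T -` ball 0 1"
      then have "norm x * B < 1" using B(2)[of x] by simp
      then show "x \<in> ball 0 (1/B)" using B(1) by (simp add: field_simps)
    qed
    then have "I \<le> emeasure lborel (ball (0::'a) (1/B))" unfolding Iv by (intro emeasure_mono) auto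
    also have "\<dots> < \<infinity>" using B(1) by (simp add: emeasure_ball)
    finally show ?thesis .
  qed
  have I_pos: "I > 0"
  proof -
    have "open (T -` ball 0 1)"
      using bl by (intro open_vimage linear_continuous_on) auto
    moreover have "0 \<in> T -` ball 0 1" by (simp add: T.zero)
    ultimately have "\<exists>e>0. ball 0 e \<subseteq> T -` ball 0 1"
      using open_contains_ball by blast
    then obtain e where e: "e > 0" "ball 0 e \<subseteq> T -` ball 0 1" by blast
    have "0 < emeasure lborel (ball (0::'a) e)" using e(1) by (simp add: emeasure_ball)
    also have "\<dots> \<le> I" unfolding Iv using e(2) measurable_sets[OF Tm, of "ball 0 1"]
      by (intro emeasure_mono) auto
    finally show ?thesis .
  qed
  have key: "J * (\<integral>\<^sup>+x. h (T x) \<partial>lborel) = I * (\<integral>\<^sup>+y. h y \<partial>lborel)"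
    if hm [measurable]: "h \<in> borel_measurable borel" for h
  proof -
    have "J * (\<integral>\<^sup>+x. h (T x) \<partial>lborel) = (\<integral>\<^sup>+x. h (T x) * J \<partial>lborel)"
      by (subst nn_integral_multc) (auto simp: mult.commute)
    also have "\<dots> = (\<integral>\<^sup>+x. (\<integral>\<^sup>+y. h (T x) * k (y + - T x) \<partial>lborel) \<partial>lborel)"
    proof (rule nn_integral_cong)
      fix x
      have "J = (\<integral>\<^sup>+y. k (y + - T x) \<partial>lborel)"
        unfolding J_def by (rule nn_integral_lborel_translate[symmetric]) simp
      then show "h (T x) * J = (\<integral>\<^sup>+y. h (T x) * k (y + - T x) \<partial>lborel)"
        by (simp add: nn_integral_cmult)
    qed
    also have "\<dots> = (\<integral>\<^sup>+y. (\<integral>\<^sup>+x. h (T x) * k (y + - T x) \<partial>lborel) \<partial>lborel)"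
      by (rule lborel_pair.Fubini'[symmetric]) measurable
    also have "\<dots> = (\<integral>\<^sup>+y. (\<integral>\<^sup>+x. h (T x + y) * k (T x) \<partial>lborel) \<partial>lborel)"
    proof (rule nn_integral_cong)
      fix y
      have Ti: "T (inv T y) = y" using bij by (simp add: bij_def surj_f_inv_f)
      have "(\<integral>\<^sup>+x. h (T x) * k (y + - T x) \<partial>lborel)
          = (\<integral>\<^sup>+x. h (T (x + inv T y)) * k (y + - T (x + inv T y)) \<partial>lborel)"
        by (rule nn_integral_lborel_translate[symmetric]) simp
      also have "\<dots> = (\<integral>\<^sup>+x. h (T x + y) * k (T x) \<partial>lborel)"
        using ksym by (simp add: T.add Ti)
      finally show "(\<integral>\<^sup>+x. h (T x) * k (y + - T x) \<partial>lborel) = (\<integral>\<^sup>+x. h (T x + y) * k (T x) \<partial>lborel)" .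
    qed
    also have "\<dots> = (\<integral>\<^sup>+x. (\<integral>\<^sup>+y. h (T x + y) * k (T x) \<partial>lborel) \<partial>lborel)"
      by (rule lborel_pair.Fubini') measurable
    also have "\<dots> = (\<integral>\<^sup>+x. (\<integral>\<^sup>+y. h y \<partial>lborel) * k (T x) \<partial>lborel)"
    proof (rule nn_integral_cong)
      fix x
      have "(\<integral>\<^sup>+y. h (T x + y) \<partial>lborel) = (\<integral>\<^sup>+y. h y \<partial>lborel)"
        using nn_integral_lborel_translate[OF hm, of "T x"] by (simp add: add.commute)
      then show "(\<integral>\<^sup>+y. h (T x + y) * k (T x) \<partial>lborel) = (\<integral>\<^sup>+y. h y \<partial>lborel) * k (T x)"
        by (simp add: nn_integral_multc)
    qed
    also have "\<dots> = I * (\<integral>\<^sup>+y. h y \<partial>lborel)"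
      unfolding I_def by (subst nn_integral_cmult) (auto simp: mult.commute)
    finally show ?thesis .
  qed
  obtain i where i: "I = ennreal i" "i > 0"
    using I_pos I_fin by (cases I) (auto simp: ennreal_less_zero_iff)
  define j where "j = unit_ball_vol (real DIM('b))"
  have j: "j > 0" unfolding j_def by simp
  show ?thesis
  proof (rule that[of "j / i"])
    show "j / i > 0" using i j by simp
    fix h :: "'b \<Rightarrow> ennreal" assume h: "h \<in> borel_measurable borel"
    have "ennreal j * (\<integral>\<^sup>+x. h (T x) \<partial>lborel) = ennreal i * (\<integral>\<^sup>+y. h y \<partial>lborel)"
      using key[OF h] by (simp add: J i j_def)
    then have "ennreal (1/i) * (ennreal j * (\<integral>\<^sup>+x. h (T x) \<partial>lborel)) = (ennreal (1/i) * ennreal i) * (\<integral>\<^sup>+y. h y \<partial>lborel)"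
      by (simp add: mult.assoc)
    also have "ennreal (1/i) * ennreal i = 1" using i(2) by (simp flip: ennreal_mult)
    also have "ennreal (1/i) * (ennreal j * (\<integral>\<^sup>+x. h (T x) \<partial>lborel)) = ennreal (j / i) * (\<integral>\<^sup>+x. h (T x) \<partial>lborel)"
      using i(2) j by (simp add: mult.assoc[symmetric] flip: ennreal_mult)
    finally show "(\<integral>\<^sup>+y. h y \<partial>lborel) = ennreal (j / i) * (\<integral>\<^sup>+x. h (T x) \<partial>lborel)" by simp
  qed
qed

text \<open>
The constant is determined by the volume of the unit ball.
\<close>
lemma nn_integral_similarity:
  fixes f :: "'a::euclidean_space \<Rightarrow> 'a"
  assumes lin: "linear f" and r: "r > 0" and nf: "\<And>x. norm (f x) = r * norm x"
    and h: "h \<in> borel_measurable borel"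
  shows "(\<integral>\<^sup>+y. h y \<partial>lborel) = ennreal (r ^ DIM('a)) * (\<integral>\<^sup>+x. h (f x) \<partial>lborel)"
proof -
  have inj: "inj f"
  proof (rule injI)
    fix x y assume "f x = f y"
    then have "norm (f (x - y)) = 0" using lin by (simp add: linear_diff)
    then show "x = y" using r by (simp add: nf)
  qed
  then have "bij f" using lin by (simp add: bij_def linear_injective_imp_surjective)
  then obtain c :: real where c: "c > 0"
    "\<And>h. h \<in> borel_measurable borel \<Longrightarrow> (\<integral>\<^sup>+y. h y \<partial>lborel) = ennreal c * (\<integral>\<^sup>+x. h (f x) \<partial>lborel)"
    using nn_integral_linear_bij[OF lin] by metis
  define v where "v = unit_ball_vol (real DIM('a))"
  have v: "v > 0" by (simp add: v_def)
  have fi: "indicator (ball 0 1) (f x) = (indicator (ball 0 (1/r)) x :: ennreal)" for x :: 'a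
    using r by (auto simp: indicator_def nf field_simps)
  have "ennreal v = (\<integral>\<^sup>+y. indicator (ball (0::'a) 1) y \<partial>lborel)"
    by (simp add: emeasure_ball v_def)
  also have "\<dots> = ennreal c * (\<integral>\<^sup>+x. indicator (ball (0::'a) 1) (f x) \<partial>lborel)"
    by (rule c(2), intro borel_measurable_indicator) simp
  also have "\<dots> = ennreal c * ennreal (v * (1/r) ^ DIM('a))"
    using r by (simp add: fi emeasure_ball v_def)
  also have "\<dots> = ennreal (c * (v * (1/r) ^ DIM('a)))"
    using c(1) v r by (subst ennreal_mult) auto
  finally have "v = c * (v * (1/r) ^ DIM('a))"
    using c(1) v r by (subst (asm) ennreal_inj) auto
  then have "c = r ^ DIM('a)" using v r by (simp add: field_simps power_divide)
  with c(2)[OF h] show ?thesis by simp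
qed

corollary nn_integral_isometry:
  fixes f :: "'a::euclidean_space \<Rightarrow> 'a"
  assumes "linear f" "\<And>x. norm (f x) = norm x" "h \<in> borel_measurable borel"
  shows "(\<integral>\<^sup>+x. h (f x) \<partial>lborel) = (\<integral>\<^sup>+x. h x \<partial>lborel)"
  using nn_integral_similarity[of f 1 h] assms by simp

corollary nn_integral_complex_scale:
  fixes h :: "complex \<Rightarrow> ennreal"
  assumes "\<kappa> \<noteq> 0" "h \<in> borel_measurable borel"
  shows "(\<integral>\<^sup>+x. h (\<kappa> * x) \<partial>lborel) * ennreal ((cmod \<kappa>)\<^sup>2) = (\<integral>\<^sup>+x. h x \<partial>lborel)"
  using nn_integral_similarity[of "(*) \<kappa>" "cmod \<kappa>" h] assms
  by (simp add: norm_mult linear_times mult.commute)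

lemma nn_integral_lborel_prod_iter:
  fixes f :: "'a::euclidean_space \<times> 'b::euclidean_space \<Rightarrow> ennreal"
  assumes "f \<in> borel_measurable borel"
  shows "(\<integral>\<^sup>+p. f p \<partial>lborel) = (\<integral>\<^sup>+x. \<integral>\<^sup>+y. f (x, y) \<partial>lborel \<partial>lborel)"
  using assms by (subst lborel.nn_integral_fst) (simp_all add: lborel_prod)

lemma nn_integral_complex_haar_scale:
  fixes h :: "complex \<Rightarrow> ennreal"
  assumes c: "c \<noteq> 0" and h [measurable]: "h \<in> borel_measurable borel"
  shows "(\<integral>\<^sup>+x. h (c * x) * ennreal (1 / (cmod x)\<^sup>2) \<partial>lborel) = (\<integral>\<^sup>+x. h x * ennreal (1 / (cmod x)\<^sup>2) \<partial>lborel)"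
proof -
  have "(\<integral>\<^sup>+x. h x * ennreal (1 / (cmod x)\<^sup>2) \<partial>lborel)
      = (\<integral>\<^sup>+x. h (c * x) * ennreal (1 / (cmod (c * x))\<^sup>2) \<partial>lborel) * ennreal ((cmod c)\<^sup>2)"
    by (rule nn_integral_complex_scale[OF c, symmetric]) simp
  also have "\<dots> = (\<integral>\<^sup>+x. h (c * x) * ennreal (1 / (cmod (c * x))\<^sup>2) * ennreal ((cmod c)\<^sup>2) \<partial>lborel)"
    by (subst nn_integral_multc) auto
  also have "\<dots> = (\<integral>\<^sup>+x. h (c * x) * ennreal (1 / (cmod x)\<^sup>2) \<partial>lborel)"
  proof (rule nn_integral_cong)
    fix x
    have "ennreal (1 / (cmod (c * x))\<^sup>2) * ennreal ((cmod c)\<^sup>2) = ennreal (1 / (cmod x)\<^sup>2)"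
      using c by (simp add: norm_mult power_mult_distrib flip: ennreal_mult)
    then show "h (c * x) * ennreal (1 / (cmod (c * x))\<^sup>2) * ennreal ((cmod c)\<^sup>2)
        = h (c * x) * ennreal (1 / (cmod x)\<^sup>2)" by (simp add: mult.assoc)
  qed
  finally show ?thesis by simp
qed

text \<open>
  The measure \<open>dx / \<bar>x\<bar>\<^sup>2\<close> is Haar measure on the multiplicative group, which inversion preserves.
  The argument is the one for translation invariant measures, with a test function \<open>k\<close> supported on
  an annulus.
\<close>
lemma nn_integral_complex_haar_inverse:
  fixes h :: "complex \<Rightarrow> ennreal"
  assumes h [measurable]: "h \<in> borel_measurable borel"
  shows "(\<integral>\<^sup>+x. h (inverse x) * ennreal (1 / (cmod x)\<^sup>2) \<partial>lborel) = (\<integral>\<^sup>+x. h x * ennreal (1 / (cmod x)\<^sup>2) \<partial>lborel)"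
proof -
  define w :: "complex \<Rightarrow> ennreal" where "w x = ennreal (1 / (cmod x)\<^sup>2)" for x
  have wm [measurable]: "w \<in> borel_measurable borel" unfolding w_def by simp
  have w0: "w 0 = 0" by (simp add: w_def)
  have sc: "(\<integral>\<^sup>+x. g (c * x) * w x \<partial>lborel) = (\<integral>\<^sup>+x. g x * w x \<partial>lborel)"
    if "c \<noteq> 0" "g \<in> borel_measurable borel" for c and g :: "complex \<Rightarrow> ennreal"
    unfolding w_def using nn_integral_complex_haar_scale[OF that] .
  define k :: "complex \<Rightarrow> ennreal" where "k = indicator (cball 0 2 - ball 0 1)"
  have km [measurable]: "k \<in> borel_measurable borel" unfolding k_def
    by (intro borel_measurable_indicator) simp
  define K where "K = (\<integral>\<^sup>+x. k x * w x \<partial>lborel)"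
  have K_fin: "K < \<infinity>"
  proof -
    have "K \<le> (\<integral>\<^sup>+x. indicator (cball (0::complex) 2) x \<partial>lborel)"
      unfolding K_def
    proof (rule nn_integral_mono)
      fix x :: complex
      have "k x * w x \<le> 1 * 1" if x: "x \<in> cball 0 2 - ball 0 1"
      proof (intro mult_mono)
        have "1 \<le> (cmod x)\<^sup>2" using x by (intro one_le_power) auto
        then show "w x \<le> 1" by (simp add: w_def ennreal_le_1 divide_le_eq)
      qed (auto simp: k_def indicator_def)
      then show "k x * w x \<le> indicator (cball (0::complex) 2) x"
        by (auto simp: k_def indicator_def)
    qed
    also have "\<dots> = emeasure lborel (cball (0::complex) 2)" by simp
    also have "\<dots> < \<infinity>" by (simp add: emeasure_cball)
    finally show ?thesis .
  qed
  have K_pos: "K > 0"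
  proof -
    have "0 < emeasure lborel (ball (3/2 :: complex) (1/2)) * ennreal (1/4)"
      by (simp add: emeasure_ball ennreal_zero_less_mult_iff)
    also have "\<dots> = (\<integral>\<^sup>+x. indicator (ball (3/2::complex) (1/2)) x * ennreal (1/4) \<partial>lborel)"
      by (subst nn_integral_multc, intro borel_measurable_indicator) auto
    also have "\<dots> \<le> K" unfolding K_def
    proof (rule nn_integral_mono)
      fix x :: complex
      have "k x = 1 \<and> ennreal (1/4) \<le> w x" if "x \<in> ball (3/2) (1/2)"
      proof -
        have n: "cmod x \<le> 2" "cmod x \<ge> 1"
        proof -
          have "cmod (x - 3/2) < 1/2" using that by (simp add: dist_norm norm_minus_commute)
          then show "cmod x \<le> 2" "cmod x \<ge> 1"
            using norm_triangle_ineq2[of x "3/2"] norm_triangle_ineq2[of "3/2" x]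
            by (auto simp: norm_minus_commute)
        qed
        then have "(cmod x)\<^sup>2 \<le> 2\<^sup>2" by (intro power_mono) auto
        moreover have "(cmod x)\<^sup>2 > 0" using n by auto
        ultimately have "1/4 \<le> 1 / (cmod x)\<^sup>2" by (simp add: field_simps)
        then show ?thesis using n by (auto simp: k_def w_def intro: ennreal_leI)
      qed
      then show "indicator (ball (3/2) (1/2)) x * ennreal (1/4) \<le> k x * w x"
        by (auto simp: indicator_def)
    qed
    finally show ?thesis .
  qed
  have "K * (\<integral>\<^sup>+x. h (inverse x) * w x \<partial>lborel) = (\<integral>\<^sup>+x. h (inverse x) * w x * K \<partial>lborel)"
    by (subst nn_integral_multc) (auto simp: mult.commute)
  also have "\<dots> = (\<integral>\<^sup>+x. (\<integral>\<^sup>+y. h (inverse x) * w x * (k (x * y) * w y) \<partial>lborel) \<partial>lborel)"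
  proof (rule nn_integral_cong)
    fix x
    have "K = (\<integral>\<^sup>+y. k (x * y) * w y \<partial>lborel)" if "x \<noteq> 0"
      unfolding K_def using sc[OF that km] by simp
    then show "h (inverse x) * w x * K = (\<integral>\<^sup>+y. h (inverse x) * w x * (k (x * y) * w y) \<partial>lborel)"
      by (cases "x = 0") (auto simp: w0 nn_integral_cmult)
  qed
  also have "\<dots> = (\<integral>\<^sup>+y. (\<integral>\<^sup>+x. h (inverse x) * w x * (k (x * y) * w y) \<partial>lborel) \<partial>lborel)"
    by (rule lborel_pair.Fubini'[symmetric]) measurable
  also have "\<dots> = (\<integral>\<^sup>+y. (\<integral>\<^sup>+x. h (y / x) * k x * w x * w y \<partial>lborel) \<partial>lborel)"
  proof (rule nn_integral_cong)
    fix y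
    show "(\<integral>\<^sup>+x. h (inverse x) * w x * (k (x * y) * w y) \<partial>lborel) = (\<integral>\<^sup>+x. h (y / x) * k x * w x * w y \<partial>lborel)"
    proof (cases "y = 0")
      case False
      have "(\<integral>\<^sup>+x. h (inverse x) * w x * (k (x * y) * w y) \<partial>lborel)
          = (\<integral>\<^sup>+x. (\<lambda>z. h (y / z) * k z * w y) (y * x) * w x \<partial>lborel)"
      proof (rule nn_integral_cong)
        fix x
        have "y / (y * x) = inverse x" using False by (simp add: field_simps)
        then show "h (inverse x) * w x * (k (x * y) * w y) = (\<lambda>z. h (y / z) * k z * w y) (y * x) * w x"
          by (simp only: mult_ac)
      qed
      also have "\<dots> = (\<integral>\<^sup>+x. (\<lambda>z. h (y / z) * k z * w y) x * w x \<partial>lborel)"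
        using False by (intro sc) auto
      finally show ?thesis by (simp add: mult_ac)
    qed (simp add: w0)
  qed
  also have "\<dots> = (\<integral>\<^sup>+x. (\<integral>\<^sup>+y. h (y / x) * k x * w x * w y \<partial>lborel) \<partial>lborel)"
    by (rule lborel_pair.Fubini') measurable
  also have "\<dots> = (\<integral>\<^sup>+x. (k x * w x) * (\<integral>\<^sup>+y. h y * w y \<partial>lborel) \<partial>lborel)"
  proof (rule nn_integral_cong)
    fix x
    show "(\<integral>\<^sup>+y. h (y / x) * k x * w x * w y \<partial>lborel) = (k x * w x) * (\<integral>\<^sup>+y. h y * w y \<partial>lborel)"
    proof (cases "x = 0")
      case False
      have "(\<integral>\<^sup>+y. h (y / x) * k x * w x * w y \<partial>lborel) = (\<integral>\<^sup>+y. (k x * w x) * (h (inverse x * y) * w y) \<partial>lborel)"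
        by (intro nn_integral_cong) (simp add: mult_ac divide_inverse)
      also have "\<dots> = (k x * w x) * (\<integral>\<^sup>+y. h (inverse x * y) * w y \<partial>lborel)"
        by (subst nn_integral_cmult) auto
      also have "\<dots> = (k x * w x) * (\<integral>\<^sup>+y. h y * w y \<partial>lborel)"
        using False by (subst sc) auto
      finally show ?thesis .
    qed (simp add: w0)
  qed
  also have "\<dots> = K * (\<integral>\<^sup>+y. h y * w y \<partial>lborel)"
    unfolding K_def by (subst nn_integral_multc) auto
  finally have "K * (\<integral>\<^sup>+x. h (inverse x) * w x \<partial>lborel) = K * (\<integral>\<^sup>+y. h y * w y \<partial>lborel)" .
  then show ?thesis using K_fin K_pos
    by (auto simp add: ennreal_mult_cancel_left w_def)
qed

lemma nn_integral_complex_inverse: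
  fixes h :: "complex \<Rightarrow> ennreal"
  assumes h [measurable]: "h \<in> borel_measurable borel"
  shows "(\<integral>\<^sup>+x. h (inverse x) * ennreal (1 / (cmod x) ^ 4) \<partial>lborel) = (\<integral>\<^sup>+x. h x \<partial>lborel)"
proof -
  have "(\<integral>\<^sup>+x. h x \<partial>lborel) = (\<integral>\<^sup>+x. h x * ennreal ((cmod x)\<^sup>2) * ennreal (1 / (cmod x)\<^sup>2) \<partial>lborel)"
  proof (rule nn_integral_cong_AE)
    have "AE x in lborel. x \<noteq> (0::complex)" by (rule AE_lborel_singleton)
    then show "AE x in lborel. h x = h x * ennreal ((cmod x)\<^sup>2) * ennreal (1 / (cmod x)\<^sup>2)"
      by eventually_elim (simp add: mult.assoc flip: ennreal_mult)
  qed
  also have "\<dots> = (\<integral>\<^sup>+x. h (inverse x) * ennreal ((cmod (inverse x))\<^sup>2) * ennreal (1 / (cmod x)\<^sup>2) \<partial>lborel)"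
    by (rule nn_integral_complex_haar_inverse[symmetric]) simp
  also have "\<dots> = (\<integral>\<^sup>+x. h (inverse x) * ennreal (1 / (cmod x) ^ 4) \<partial>lborel)"
    by (intro nn_integral_cong)
      (simp add: mult.assoc norm_inverse power_inverse divide_inverse flip: ennreal_mult power_add inverse_mult_distrib)
  finally show ?thesis by simp
qed

text \<open>
  A Moebius transformation is an inversion between two affine maps, so no Jacobian determinants are
  needed.
\<close>
lemma nn_integral_complex_moebius:
  fixes h :: "complex \<Rightarrow> ennreal" and a :: real
  assumes a: "\<bar>a\<bar> < 1" and h [measurable]: "h \<in> borel_measurable borel"
  shows "(\<integral>\<^sup>+x. h ((x - of_real a) / (1 - of_real a * x)) * ennreal ((1 - a\<^sup>2)\<^sup>2 / (cmod (1 - of_real a * x)) ^ 4) \<partial>lborel)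
    = (\<integral>\<^sup>+x. h x \<partial>lborel)"
proof (cases "a = 0")
  case False
  have a2: "a\<^sup>2 < 1" using a by (simp add: abs_square_less_1)
  define \<kappa> where "\<kappa> = (1 - a\<^sup>2) / a"
  have k0: "\<kappa> \<noteq> 0" using a2 False by (simp add: \<kappa>_def)
  have "(\<integral>\<^sup>+x. h x \<partial>lborel) = (\<integral>\<^sup>+x. h (x + of_real (- 1 / a)) \<partial>lborel)"
    by (rule nn_integral_lborel_translate[symmetric]) simp
  also have "\<dots> = (\<integral>\<^sup>+x. h (of_real \<kappa> * x + of_real (- 1 / a)) \<partial>lborel) * ennreal ((cmod (of_real \<kappa>))\<^sup>2)"
    using k0 by (intro nn_integral_complex_scale[symmetric]) auto
  also have "(\<integral>\<^sup>+x. h (of_real \<kappa> * x + of_real (- 1 / a)) \<partial>lborel)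
     = (\<integral>\<^sup>+x. h (of_real \<kappa> * inverse x + of_real (- 1 / a)) * ennreal (1 / (cmod x) ^ 4) \<partial>lborel)"
    by (rule nn_integral_complex_inverse[symmetric]) simp
  also have "\<dots> = (\<integral>\<^sup>+x. h (of_real \<kappa> * inverse (x + 1) + of_real (- 1 / a)) * ennreal (1 / (cmod (x + 1)) ^ 4) \<partial>lborel)"
    by (rule nn_integral_lborel_translate[symmetric]) simp
  also have "\<dots> = (\<integral>\<^sup>+x. h (of_real \<kappa> * inverse (of_real (- a) * x + 1) + of_real (- 1 / a)) * ennreal (1 / (cmod (of_real (- a) * x + 1)) ^ 4) \<partial>lborel) * ennreal ((cmod (of_real (- a)))\<^sup>2)"
    using False by (intro nn_integral_complex_scale[symmetric]) auto
  also have "\<dots> * ennreal ((cmod (of_real \<kappa>))\<^sup>2) =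
     (\<integral>\<^sup>+x. h (of_real \<kappa> * inverse (of_real (- a) * x + 1) + of_real (- 1 / a)) * ennreal (1 / (cmod (of_real (- a) * x + 1)) ^ 4) * ennreal ((1 - a\<^sup>2)\<^sup>2) \<partial>lborel)"
  proof -
    have "ennreal ((cmod (of_real (- a)))\<^sup>2) * ennreal ((cmod (of_real \<kappa>))\<^sup>2) = ennreal ((1 - a\<^sup>2)\<^sup>2)"
      using False by (simp add: \<kappa>_def power_divide norm_of_real del: of_real_divide of_real_diff of_real_power flip: ennreal_mult)
    then show ?thesis by (subst nn_integral_multc) (auto simp: mult.assoc)
  qed
  also have "\<dots> = (\<integral>\<^sup>+x. h ((x - of_real a) / (1 - of_real a * x)) * ennreal ((1 - a\<^sup>2)\<^sup>2 / (cmod (1 - of_real a * x)) ^ 4) \<partial>lborel)"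
  proof (rule nn_integral_cong)
    fix x :: complex
    show "h (of_real \<kappa> * inverse (of_real (- a) * x + 1) + of_real (- 1 / a)) * ennreal (1 / (cmod (of_real (- a) * x + 1)) ^ 4) * ennreal ((1 - a\<^sup>2)\<^sup>2)
      = h ((x - of_real a) / (1 - of_real a * x)) * ennreal ((1 - a\<^sup>2)\<^sup>2 / (cmod (1 - of_real a * x)) ^ 4)"
    proof (cases "1 - of_real a * x = 0")
      case True
      then show ?thesis by (simp add: algebra_simps)
    next
      case w: False
      have e: "of_real (- a) * x + 1 = 1 - of_real a * x" by simp
      have "of_real \<kappa> * inverse (1 - of_real a * x) + of_real (- 1 / a) = (x - of_real a) / (1 - of_real a * x)"
        using w False by (simp add: \<kappa>_def field_simps power2_eq_square)
      then show ?thesis unfolding e by (simp add: mult.assoc flip: ennreal_mult)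
    qed
  qed
  finally show ?thesis by simp
qed simp

section \<open>Moments of balls\<close>

text \<open>
Squared modulus maps area to \<open>\<pi>\<close> times length, because discs have area \<open>\<pi> r\<^sup>2\<close>.
\<close>
lemma nn_integral_cmod_square:
  fixes h :: "real \<Rightarrow> ennreal"
  assumes h [measurable]: "h \<in> borel_measurable borel"
  shows "(\<integral>\<^sup>+x. h ((cmod x)\<^sup>2) \<partial>lborel) = ennreal pi * (\<integral>\<^sup>+t. h t * indicator {0..} t \<partial>lborel)"
proof -
  let ?M = "distr lborel borel (\<lambda>x::complex. (cmod x)\<^sup>2)"
  let ?N = "density lborel (\<lambda>t::real. ennreal pi * indicator {0..} t)"
  have eM: "emeasure ?M {..t} = ennreal (pi * max 0 t)" for t
  proof -
    have "emeasure ?M {..t} = emeasure lborel ((\<lambda>x::complex. (cmod x)\<^sup>2) -` {..t})"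
      by (subst emeasure_distr) auto
    also have "\<dots> = ennreal (pi * max 0 t)"
    proof (cases "t \<ge> 0")
      case True
      have "(\<lambda>x::complex. (cmod x)\<^sup>2) -` {..t} = cball 0 (sqrt t)"
        using True by (auto simp: real_le_rsqrt sqrt_ge_absD)
      then show ?thesis using True by (simp add: emeasure_cball unit_ball_vol_2)
    next
      case False
      then have "(\<lambda>x::complex. (cmod x)\<^sup>2) -` {..t} = {}"
        by (auto simp: not_le) (meson less_le_trans not_less zero_le_power2)
      then show ?thesis using False by simp
    qed
    finally show ?thesis .
  qed
  have eN: "emeasure ?N {..t} = ennreal (pi * max 0 t)" for t
  proof -
    have "emeasure ?N {..t} = (\<integral>\<^sup>+x. ennreal pi * indicator {0..t} x \<partial>lborel)"
      by (subst emeasure_density) (auto intro!: nn_integral_cong simp: indicator_def)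
    also have "\<dots> = ennreal (pi * max 0 t)"
      by (subst nn_integral_cmult) (auto simp: max_def simp flip: ennreal_mult)
    finally show ?thesis .
  qed
  have "?M = ?N"
  proof (rule measure_eqI_generator_eq[where E = "range atMost" and \<Omega> = UNIV and A = "\<lambda>n. {..real n}"])
    show "Int_stable (range (atMost :: real \<Rightarrow> _))" by (auto simp: Int_stable_def)
    show "(\<Union>i. {..real i}) = UNIV" by (auto intro: real_arch_simple)
    show "emeasure ?M {..real i} \<noteq> \<infinity>" for i by (simp add: eM del: emeasure_distr)
    show "emeasure ?M X = emeasure ?N X" if "X \<in> range atMost" for X
      using that eM eN by auto
  qed (auto simp: borel_eq_atMost)
  then have "(\<integral>\<^sup>+t. h t \<partial>?M) = (\<integral>\<^sup>+t. h t \<partial>?N)" by simp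
  then have "(\<integral>\<^sup>+x. h ((cmod x)\<^sup>2) \<partial>lborel) = (\<integral>\<^sup>+t. ennreal pi * (indicator {0..} t * h t) \<partial>lborel)"
    by (simp add: nn_integral_distr nn_integral_density mult.assoc)
  then show ?thesis by (simp add: nn_integral_cmult mult.commute)
qed

lemma nn_integral_disc_powr:
  fixes s R :: real
  assumes s: "s \<ge> 0" and R: "R \<ge> 0"
  shows "(\<integral>\<^sup>+(x::complex). ennreal ((R - (cmod x)\<^sup>2) powr s) * indicator {x. (cmod x)\<^sup>2 < R} x \<partial>lborel)
    = ennreal (pi * R powr (s + 1) / (s + 1))"
proof -
  define h :: "real \<Rightarrow> ennreal" where "h t = ennreal ((R - t) powr s) * indicator {..<R} t" for t
  have hm [measurable]: "h \<in> borel_measurable borel" unfolding h_def by measurable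
  have "(\<integral>\<^sup>+(x::complex). ennreal ((R - (cmod x)\<^sup>2) powr s) * indicator {x. (cmod x)\<^sup>2 < R} x \<partial>lborel)
     = (\<integral>\<^sup>+(x::complex). h ((cmod x)\<^sup>2) \<partial>lborel)"
    by (intro nn_integral_cong) (auto simp: h_def indicator_def)
  also have "\<dots> = ennreal pi * (\<integral>\<^sup>+t. h t * indicator {0..} t \<partial>lborel)"
    by (rule nn_integral_cmod_square) simp
  also have "(\<integral>\<^sup>+t. h t * indicator {0..} t \<partial>lborel) = (\<integral>\<^sup>+t. h (- t) * indicator {0..} (- t) \<partial>lborel)"
    by (rule nn_integral_isometry[symmetric]) (auto simp: linear_uminus)
  also have "\<dots> = (\<integral>\<^sup>+t. h (- (t + - R)) * indicator {0..} (- (t + - R)) \<partial>lborel)"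
    by (rule nn_integral_lborel_translate[symmetric]) simp
  also have "\<dots> = (\<integral>\<^sup>+t. indicator {0..R} t * ennreal (t powr s) \<partial>lborel)"
    by (intro nn_integral_cong) (auto simp: h_def indicator_def)
  also have "\<dots> = ennreal (R powr (s + 1) / (s + 1))"
  proof -
    have "((\<lambda>x. x powr s) has_integral (R powr (s + 1) / (s + 1))) {0..R}"
      using has_integral_powr_from_0[of s R] s R by simp
    then have "(\<integral>\<^sup>+t. ennreal (indicator {0..R} t * t powr s) \<partial>lborel) = ennreal (R powr (s + 1) / (s + 1))"
      by (rule nn_integral_has_integral_lebesgue[rotated]) simp
    moreover have "(\<integral>\<^sup>+t. ennreal (indicator {0..R} t * t powr s) \<partial>lborel)
        = (\<integral>\<^sup>+t. indicator {0..R} t * ennreal (t powr s) \<partial>lborel)"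
      by (intro nn_integral_cong) (auto simp: indicator_def)
    ultimately show ?thesis by simp
  qed
  finally show ?thesis using s R by (simp flip: ennreal_mult)
qed

lemma nn_integral_complex_gauss:
  "(\<integral>\<^sup>+x. ennreal ((cmod x) ^ (2 * k) * exp (- (cmod x)\<^sup>2)) \<partial>lborel) = ennreal (pi * fact k)"
proof -
  have "(\<integral>\<^sup>+x. ennreal ((cmod x) ^ (2 * k) * exp (- (cmod x)\<^sup>2)) \<partial>lborel)
    = (\<integral>\<^sup>+x. (\<lambda>t. ennreal (t ^ k * exp (- t))) ((cmod x)\<^sup>2) \<partial>lborel)"
    by (simp add: power_mult)
  also have "\<dots> = ennreal pi * (\<integral>\<^sup>+t. ennreal (t ^ k * exp (- t)) * indicator {0..} t \<partial>lborel)"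
    by (rule nn_integral_cmod_square) simp
  also have "\<dots> = ennreal pi * ennreal (fact k)"
    by (subst nn_intergal_power_times_exp_Ici) simp
  finally show ?thesis by (simp add: ennreal_mult)
qed

lemma lborel_vec_eq_PiM:
  "(lborel :: ('a::euclidean_space ^ 'n::finite) measure)
    = distr (\<Pi>\<^sub>M i\<in>UNIV. lborel) borel (\<lambda>x. \<chi> i. x i)"
proof (rule lborel_eqI)
  have vm [measurable]: "(\<lambda>x. \<chi> i. x i :: 'a ^ 'n) \<in> borel_measurable (\<Pi>\<^sub>M i\<in>UNIV. lborel)"
  proof (subst borel_measurable_euclidean_space, rule ballI)
    fix b :: "'a ^ 'n" assume "b \<in> Basis"
    then obtain i u where b: "b = axis i u" by (auto simp: Basis_vec_def)
    show "(\<lambda>x. (\<chi> i. x i) \<bullet> b) \<in> borel_measurable (\<Pi>\<^sub>M i\<in>UNIV. lborel :: 'a measure)"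
      unfolding b inner_axis by simp
  qed
  fix l u :: "'a ^ 'n" assume lu: "\<And>b. b \<in> Basis \<Longrightarrow> l \<bullet> b \<le> u \<bullet> b"
  have lui: "(l $ i) \<bullet> b \<le> (u $ i) \<bullet> b" if "b \<in> Basis" for i b
    using lu[of "axis i b"] that by (simp add: inner_axis axis_in_Basis_iff)
  interpret product_sigma_finite "\<lambda>_::'n. lborel :: 'a measure" ..
  have eq: "(\<lambda>x. \<chi> i. x i) -` box l u \<inter> space (\<Pi>\<^sub>M i\<in>UNIV. lborel) = (\<Pi>\<^sub>E i\<in>UNIV. box (l $ i) (u $ i))"
    by (auto simp: box_def Basis_vec_def inner_axis space_PiM PiE_def extensional_def)
  have "emeasure (distr (\<Pi>\<^sub>M i\<in>UNIV. lborel) borel (\<lambda>x. \<chi> i. x i)) (box l u)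
    = emeasure (\<Pi>\<^sub>M i\<in>UNIV. lborel) (\<Pi>\<^sub>E i\<in>UNIV. box (l $ i) (u $ i))"
    by (subst emeasure_distr) (auto simp: eq)
  also have "\<dots> = (\<Prod>i\<in>UNIV. emeasure lborel (box (l $ i) (u $ i)))"
    by (rule emeasure_PiM) auto
  also have "\<dots> = (\<Prod>i\<in>UNIV. ennreal (\<Prod>b\<in>Basis. (u $ i - l $ i) \<bullet> b))"
    by (intro prod.cong refl emeasure_lborel_box) (use lui in auto)
  also have "\<dots> = ennreal (\<Prod>i\<in>UNIV. \<Prod>b\<in>Basis. (u $ i - l $ i) \<bullet> b)"
    using lui by (intro prod_ennreal prod_nonneg) (auto simp: inner_diff_left)
  also have "(\<Prod>i\<in>UNIV. \<Prod>b\<in>Basis. (u $ i - l $ i) \<bullet> b) = (\<Prod>b\<in>Basis. (u - l) \<bullet> b)"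
  proof -
    have "(\<Prod>b\<in>(Basis::('a ^ 'n) set). (u - l) \<bullet> b) = (\<Prod>i\<in>UNIV. \<Prod>b\<in>(\<lambda>v. axis i v) ` Basis. (u - l) \<bullet> b)"
    proof -
      have B: "(Basis::('a ^ 'n) set) = (\<Union>i\<in>UNIV. (\<lambda>v. axis i v) ` Basis)"
        by (auto simp: Basis_vec_def)
      show ?thesis unfolding B
        by (rule prod.UNION_disjoint) (auto simp: axis_eq_axis nonzero_Basis)
    qed
    also have "\<dots> = (\<Prod>i\<in>UNIV. \<Prod>b\<in>Basis. (u $ i - l $ i) \<bullet> b)"
      by (intro prod.cong refl, subst prod.reindex) (auto simp: inj_on_def axis_eq_axis inner_axis)
    finally show ?thesis by simp
  qed
  finally show "emeasure (distr (\<Pi>\<^sub>M i\<in>UNIV. lborel) borel (\<lambda>x. \<chi> i. x i)) (box l u)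
    = ennreal (\<Prod>b\<in>Basis. (u - l) \<bullet> b)" .
qed simp

lemma nn_integral_vec_prod:
  fixes f :: "'n::finite \<Rightarrow> 'a::euclidean_space \<Rightarrow> ennreal"
  assumes [measurable]: "\<And>i. f i \<in> borel_measurable borel"
  shows "(\<integral>\<^sup>+Z. (\<Prod>i\<in>UNIV. f i (Z $ i)) \<partial>lborel) = (\<Prod>i\<in>UNIV. \<integral>\<^sup>+x. f i x \<partial>lborel)"
proof -
  interpret product_sigma_finite "\<lambda>_::'n. lborel :: 'a measure" ..
  have vm [measurable]: "(\<lambda>x. \<chi> i. x i :: 'a ^ 'n) \<in> borel_measurable (\<Pi>\<^sub>M i\<in>UNIV. lborel)"
  proof (subst borel_measurable_euclidean_space, rule ballI)
    fix b :: "'a ^ 'n" assume "b \<in> Basis"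
    then obtain i u where b: "b = axis i u" by (auto simp: Basis_vec_def)
    show "(\<lambda>x. (\<chi> i. x i) \<bullet> b) \<in> borel_measurable (\<Pi>\<^sub>M i\<in>UNIV. lborel :: 'a measure)"
      unfolding b inner_axis by simp
  qed
  have cm [measurable]: "(\<lambda>Z::'a ^ 'n. Z $ i) \<in> borel_measurable borel" for i
    by (intro borel_measurable_continuous_onI continuous_intros)
  show ?thesis
    by (subst lborel_vec_eq_PiM, subst nn_integral_distr) (simp_all add: product_nn_integral_prod)
qed

lemma nn_integral_exp_tail:
  "(\<integral>\<^sup>+s. ennreal (exp (- s)) * indicator {c<..} s \<partial>lborel) = ennreal (exp (- c))"
proof -
  have "(\<integral>\<^sup>+s. ennreal (exp (- s)) * indicator {c<..} s \<partial>lborel)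
    = (\<integral>\<^sup>+s. ennreal (exp (- (s + c))) * indicator {c<..} (s + c) \<partial>lborel)"
    by (rule nn_integral_lborel_translate[symmetric]) simp
  also have "\<dots> = (\<integral>\<^sup>+s. ennreal (exp (- c)) * (ennreal (s ^ 0 * exp (- s)) * indicator {0..} s) \<partial>lborel)"
  proof (rule nn_integral_cong_AE)
    have "AE s in lborel. s \<noteq> (0::real)" by (rule AE_lborel_singleton)
    then show "AE s in lborel. ennreal (exp (- (s + c))) * indicator {c<..} (s + c)
        = ennreal (exp (- c)) * (ennreal (s ^ 0 * exp (- s)) * indicator {0..} s)"
      by eventually_elim (auto simp: indicator_def exp_add exp_diff exp_minus field_simps simp flip: ennreal_mult)
  qed
  also have "\<dots> = ennreal (exp (- c)) * (\<integral>\<^sup>+s. ennreal (s ^ 0 * exp (- s)) * indicator {0..} s \<partial>lborel)"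
    by (rule nn_integral_cmult) simp
  also have "\<dots> = ennreal (exp (- c))"
    by (subst nn_intergal_power_times_exp_Ici) simp
  finally show ?thesis .
qed

lemma norm_vec_square: "(norm (Z :: complex ^ 'n))\<^sup>2 = (\<Sum>i\<in>UNIV. (cmod (Z $ i))\<^sup>2)"
  by (simp add: norm_vec_def L2_set_def sum_nonneg)

text \<open>
  Integrating \<open>\<bar>Z\<^sub>i\<^sub>0\<bar> ^ (2 * k)\<close> against the Gaussian weight in two ways: as a product over the
  coordinates it is \<open>\<pi>\<^sup>m k!\<close>, and as an integral over the radius of the moments of balls, which scale
  homogeneously, it is \<open>(m + k)!\<close> times the moment of the unit ball.
\<close>
lemma nn_integral_ball_moment:
  fixes i0 :: "'m::finite"
  assumes R: "R \<ge> 0"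
  shows "(\<integral>\<^sup>+(Z::complex ^ 'm). ennreal ((cmod (Z $ i0)) ^ (2 * k)) * indicator {Z. (norm Z)\<^sup>2 < R} Z \<partial>lborel)
     = ennreal (R ^ (CARD('m) + k) * (pi ^ CARD('m) * fact k / fact (CARD('m) + k)))"
proof -
  let ?m = "CARD('m)"
  have cm [measurable]: "(\<lambda>Z::complex ^ 'm. Z $ i) \<in> borel_measurable borel" for i
    by (intro borel_measurable_continuous_onI continuous_intros)
  define B where "B R = (\<integral>\<^sup>+(Z::complex ^ 'm). ennreal ((cmod (Z $ i0)) ^ (2 * k)) * indicator {Z. (norm Z)\<^sup>2 < R} Z \<partial>lborel)" for R
  have B0: "B R = 0" if "R \<le> 0" for R
  proof -
    have e: "{Z::complex ^ 'm. (norm Z)\<^sup>2 < R} = {}"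
      using that by (auto simp: not_less) (meson order.trans zero_le_power2)
    show ?thesis unfolding B_def e by simp
  qed
  have Bsc: "B R = ennreal (R ^ (?m + k)) * B 1" if R: "R > 0" for R
  proof -
    have "B R = ennreal (sqrt R ^ DIM(complex ^ 'm)) * (\<integral>\<^sup>+(Z::complex ^ 'm). ennreal ((cmod ((sqrt R *\<^sub>R Z) $ i0)) ^ (2 * k)) * indicator {Z. (norm Z)\<^sup>2 < R} (sqrt R *\<^sub>R Z) \<partial>lborel)"
      unfolding B_def using R by (intro nn_integral_similarity) (auto simp: linear_iff algebra_simps)
    also have "(\<integral>\<^sup>+(Z::complex ^ 'm). ennreal ((cmod ((sqrt R *\<^sub>R Z) $ i0)) ^ (2 * k)) * indicator {Z. (norm Z)\<^sup>2 < R} (sqrt R *\<^sub>R Z) \<partial>lborel)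
      = (\<integral>\<^sup>+(Z::complex ^ 'm). ennreal (R ^ k) * (ennreal ((cmod (Z $ i0)) ^ (2 * k)) * indicator {Z. (norm Z)\<^sup>2 < 1} Z) \<partial>lborel)"
    proof (rule nn_integral_cong)
      fix Z :: "complex ^ 'm"
      have e: "sqrt R ^ (2 * k) = R ^ k" using R by (simp add: power_mult)
      show "ennreal ((cmod ((sqrt R *\<^sub>R Z) $ i0)) ^ (2 * k)) * indicator {Z. (norm Z)\<^sup>2 < R} (sqrt R *\<^sub>R Z)
        = ennreal (R ^ k) * (ennreal ((cmod (Z $ i0)) ^ (2 * k)) * indicator {Z. (norm Z)\<^sup>2 < 1} Z)"
        using R by (auto simp: indicator_def power_mult_distrib e simp flip: ennreal_mult)
    qed
    also have "\<dots> = ennreal (R ^ k) * B 1" unfolding B_def by (rule nn_integral_cmult) simp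
    also have "ennreal (sqrt R ^ DIM(complex ^ 'm)) * (ennreal (R ^ k) * B 1) = ennreal (R ^ (?m + k)) * B 1"
      using R by (simp add: power_add power_mult mult.commute[of _ 2] mult.assoc[symmetric] flip: ennreal_mult)
    finally show ?thesis .
  qed
  \<comment> \<open>exponent of \<open>\<bar>Z\<^sub>i\<bar>\<^sup>2\<close> in the product form of the integrand\<close>
  define kk where "kk i = (if i = i0 then k else 0)" for i
  have "ennreal (pi ^ ?m * fact k) = (\<Prod>i\<in>UNIV. ennreal (pi * fact (kk i)))"
  proof -
    have "(\<Prod>i\<in>(UNIV::'m set). fact (kk i)) = (\<Prod>i\<in>UNIV. if i = i0 then fact k else (1::real))"
      by (intro prod.cong) (auto simp: kk_def)
    also have "\<dots> = fact k" by (subst prod.delta) auto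
    finally have e: "(\<Prod>i\<in>(UNIV::'m set). fact (kk i)) = (fact k :: real)" .
    show ?thesis by (subst prod_ennreal) (auto simp: prod.distrib e)
  qed
  also have "\<dots> = (\<Prod>i\<in>UNIV. \<integral>\<^sup>+x. ennreal ((cmod x) ^ (2 * kk i) * exp (- (cmod x)\<^sup>2)) \<partial>lborel)"
    by (simp add: nn_integral_complex_gauss)
  also have "\<dots> = (\<integral>\<^sup>+(Z::complex ^ 'm). (\<Prod>i\<in>UNIV. ennreal ((cmod (Z $ i)) ^ (2 * kk i) * exp (- (cmod (Z $ i))\<^sup>2))) \<partial>lborel)"
    by (rule nn_integral_vec_prod[symmetric]) simp
  also have "\<dots> = (\<integral>\<^sup>+(Z::complex ^ 'm). ennreal ((cmod (Z $ i0)) ^ (2 * k)) * ennreal (exp (- (norm Z)\<^sup>2)) \<partial>lborel)"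
  proof (rule nn_integral_cong)
    fix Z :: "complex ^ 'm"
    have "(\<Prod>i\<in>UNIV. (cmod (Z $ i)) ^ (2 * kk i)) = (\<Prod>i\<in>UNIV. if i = i0 then (cmod (Z $ i)) ^ (2 * k) else 1)"
      by (intro prod.cong) (auto simp: kk_def)
    also have "\<dots> = (cmod (Z $ i0)) ^ (2 * k)" by (subst prod.delta) auto
    finally have e: "(\<Prod>i\<in>UNIV. (cmod (Z $ i)) ^ (2 * kk i)) = (cmod (Z $ i0)) ^ (2 * k)" .
    have e2: "(\<Prod>i\<in>UNIV. exp (- (cmod (Z $ i))\<^sup>2)) = exp (- (norm Z)\<^sup>2)"
      by (simp add: norm_vec_square exp_sum[symmetric] sum_negf)
    show "(\<Prod>i\<in>UNIV. ennreal ((cmod (Z $ i)) ^ (2 * kk i) * exp (- (cmod (Z $ i))\<^sup>2)))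
       = ennreal ((cmod (Z $ i0)) ^ (2 * k)) * ennreal (exp (- (norm Z)\<^sup>2))"
      by (subst prod_ennreal) (auto simp: prod.distrib e e2 ennreal_mult)
  qed
  also have "\<dots> = (\<integral>\<^sup>+(Z::complex ^ 'm). \<integral>\<^sup>+s. ennreal ((cmod (Z $ i0)) ^ (2 * k)) * (ennreal (exp (- s)) * indicator {(norm Z)\<^sup>2<..} s) \<partial>lborel \<partial>lborel)"
    by (intro nn_integral_cong) (subst nn_integral_cmult, auto simp: nn_integral_exp_tail)
  also have "\<dots> = (\<integral>\<^sup>+(Z::complex ^ 'm). \<integral>\<^sup>+s. ennreal ((cmod (Z $ i0)) ^ (2 * k)) * (ennreal (exp (- s)) * (if (norm Z)\<^sup>2 < s then 1 else 0)) \<partial>lborel \<partial>lborel)"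
    by (intro nn_integral_cong) (auto simp: indicator_def)
  also have "\<dots> = (\<integral>\<^sup>+s. \<integral>\<^sup>+(Z::complex ^ 'm). ennreal ((cmod (Z $ i0)) ^ (2 * k)) * (ennreal (exp (- s)) * (if (norm Z)\<^sup>2 < s then 1 else 0)) \<partial>lborel \<partial>lborel)"
    by (rule lborel_pair.Fubini'[symmetric]) measurable
  also have "\<dots> = (\<integral>\<^sup>+s. ennreal (s ^ (?m + k) * exp (- s)) * indicator {0..} s * B 1 \<partial>lborel)"
  proof (rule nn_integral_cong)
    fix s :: real
    have "(\<integral>\<^sup>+(Z::complex ^ 'm). ennreal ((cmod (Z $ i0)) ^ (2 * k)) * (ennreal (exp (- s)) * (if (norm Z)\<^sup>2 < s then 1 else 0)) \<partial>lborel)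
       = (\<integral>\<^sup>+(Z::complex ^ 'm). ennreal (exp (- s)) * (ennreal ((cmod (Z $ i0)) ^ (2 * k)) * indicator {Z. (norm Z)\<^sup>2 < s} Z) \<partial>lborel)"
      by (intro nn_integral_cong) (auto simp: indicator_def mult_ac)
    also have "\<dots> = ennreal (exp (- s)) * B s" unfolding B_def by (rule nn_integral_cmult) simp
    also have "\<dots> = ennreal (s ^ (?m + k) * exp (- s)) * indicator {0..} s * B 1"
    proof (cases "s > 0")
      case True
      then show ?thesis by (simp add: Bsc[OF True] ennreal_mult mult_ac)
    next
      case False
      then show ?thesis by (cases "s = 0") (auto simp: B0)
    qed
    finally show "(\<integral>\<^sup>+(Z::complex ^ 'm). ennreal ((cmod (Z $ i0)) ^ (2 * k)) * (ennreal (exp (- s)) * (if (norm Z)\<^sup>2 < s then 1 else 0)) \<partial>lborel)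
       = ennreal (s ^ (?m + k) * exp (- s)) * indicator {0..} s * B 1" .
  qed
  also have "\<dots> = ennreal (fact (?m + k)) * B 1"
    by (subst nn_integral_multc, measurable, subst nn_intergal_power_times_exp_Ici) simp
  finally have "ennreal (1 / fact (?m + k)) * ennreal (pi ^ ?m * fact k) = ennreal (1 / fact (?m + k)) * ennreal (fact (?m + k)) * B 1"
    by (simp add: mult.assoc)
  also have "ennreal (1 / fact (?m + k)) * ennreal (fact (?m + k)) = 1"
    by (simp flip: ennreal_mult)
  finally have B1: "B 1 = ennreal (pi ^ ?m * fact k / fact (?m + k))"
    by (simp flip: ennreal_mult)
  have "B R = ennreal (R ^ (?m + k) * (pi ^ ?m * fact k / fact (?m + k)))"
  proof (cases "R = 0")
    case False
    then have "R > 0" using R by simp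
    then show ?thesis by (simp add: Bsc[of R] B1 flip: ennreal_mult)
  qed (simp add: B0)
  then show ?thesis by (simp add: B_def)
qed

section \<open>The Lie ball as a matrix ball, and Hua's integral\<close>

text \<open>
  The entries of the matrix \<open>((a, b), (c, d))\<close> that corresponds to \<open>z\<close>, chosen such that
  \<open>a d - b c = z \<cdot> z\<close> and \<open>\<bar>a\<bar>\<^sup>2 + \<bar>b\<bar>\<^sup>2 + \<bar>c\<bar>\<^sup>2 + \<bar>d\<bar>\<^sup>2 = 2 \<parallel>z\<parallel>\<^sup>2\<close>.
\<close>
definition mat_a :: "complex ^ 4 \<Rightarrow> complex" where "mat_a z = z $ 1 + \<i> * z $ 2"
definition mat_b :: "complex ^ 4 \<Rightarrow> complex" where "mat_b z = z $ 3 + \<i> * z $ 4"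
definition mat_c :: "complex ^ 4 \<Rightarrow> complex" where "mat_c z = - z $ 3 + \<i> * z $ 4"
definition mat_d :: "complex ^ 4 \<Rightarrow> complex" where "mat_d z = z $ 1 - \<i> * z $ 2"

definition of_mat :: "complex \<Rightarrow> complex \<Rightarrow> complex \<Rightarrow> complex \<Rightarrow> complex ^ 4"
  where "of_mat a b c d = vector [(a + d) / 2, (a - d) / (2 * \<i>), (b - c) / 2, (b + c) / (2 * \<i>)]"

lemmas mat_defs = mat_a_def mat_b_def mat_c_def mat_d_def

lemma of_mat_nth:
  "of_mat a b c d $ 1 = (a + d) / 2" "of_mat a b c d $ 2 = (a - d) / (2 * \<i>)"
  "of_mat a b c d $ 3 = (b - c) / 2" "of_mat a b c d $ 4 = (b + c) / (2 * \<i>)"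
  by (simp_all add: of_mat_def vector_def)

lemma mat_of_mat [simp]:
  "mat_a (of_mat a b c d) = a" "mat_b (of_mat a b c d) = b"
  "mat_c (of_mat a b c d) = c" "mat_d (of_mat a b c d) = d"
  by (simp_all add: mat_defs of_mat_nth field_simps)

lemma of_mat_mat [simp]: "of_mat (mat_a z) (mat_b z) (mat_c z) (mat_d z) = z"
  by (simp add: vec_eq_iff forall_4 of_mat_nth mat_defs field_simps)

text \<open>
This is \<open>det (I - M M\<^sup>*)\<close>.
\<close>
definition mat_norm :: "complex \<Rightarrow> complex \<Rightarrow> complex \<Rightarrow> complex \<Rightarrow> real" where
  "mat_norm a b c d = 1 - (cmod a)\<^sup>2 - (cmod b)\<^sup>2 - (cmod c)\<^sup>2 - (cmod d)\<^sup>2 + (cmod (a * d - b * c))\<^sup>2"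

lemma norm_of_mat: "2 * (norm (of_mat a b c d))\<^sup>2 = (cmod a)\<^sup>2 + (cmod b)\<^sup>2 + (cmod c)\<^sup>2 + (cmod d)\<^sup>2"
proof -
  have par: "(cmod (x + y))\<^sup>2 + (cmod (x - y))\<^sup>2 = 2 * ((cmod x)\<^sup>2 + (cmod y)\<^sup>2)" for x y
    unfolding cmod_power2 by (simp add: power2_eq_square algebra_simps)
  have p: "2 * ((cmod ((x + y) / 2))\<^sup>2 + (cmod ((x - y) / (2 * \<i>)))\<^sup>2) = (cmod x)\<^sup>2 + (cmod y)\<^sup>2"
       and p': "2 * ((cmod ((x - y) / 2))\<^sup>2 + (cmod ((x + y) / (2 * \<i>)))\<^sup>2) = (cmod x)\<^sup>2 + (cmod y)\<^sup>2" for x y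
    using par[of x y] by (simp_all add: norm_divide norm_mult power_divide)
  show ?thesis using p[of a d] p'[of b c] by (simp add: norm_vec_square sum_4 of_mat_nth algebra_simps)
qed

lemma square_of_mat: "(\<Sum>i\<in>UNIV. (of_mat a b c d $ i)\<^sup>2) = a * d - b * c"
  by (simp add: sum_4 of_mat_nth power_divide field_simps power2_eq_square)

lemma lie_norm_of_mat: "lie_norm (of_mat a b c d) = mat_norm a b c d"
  unfolding lie_norm_def square_of_mat mat_norm_def norm_of_mat by simp

lemma mat_norm_rows:
  "mat_norm a b c d = (1 - ((cmod a)\<^sup>2 + (cmod b)\<^sup>2)) * (1 - ((cmod c)\<^sup>2 + (cmod d)\<^sup>2)) - (cmod (a * cnj c + b * cnj d))\<^sup>2"
  unfolding mat_norm_def by (simp add: cmod_power2, algebra)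

text \<open>
  With \<open>p\<close> and \<open>q\<close> the squared norms of the rows, positivity of the norm forces \<open>1 - p\<close> and
  \<open>1 - q\<close> to have the same sign, so that \<open>p + q < 2\<close> and \<open>p < 1\<close> say the same. The second form is
  the one that automorphisms preserve visibly.
\<close>
lemma of_mat_in_lie_ball:
  "of_mat a b c d \<in> lie_ball \<longleftrightarrow> (cmod a)\<^sup>2 + (cmod b)\<^sup>2 < 1 \<and> 0 < mat_norm a b c d"
proof -
  define p where "p = (cmod a)\<^sup>2 + (cmod b)\<^sup>2"
  define q where "q = (cmod c)\<^sup>2 + (cmod d)\<^sup>2"
  have n: "norm (of_mat a b c d) < 1 \<longleftrightarrow> p + q < 2"
  proof -
    have "norm (of_mat a b c d) < 1 \<longleftrightarrow> (norm (of_mat a b c d))\<^sup>2 < 1"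
      by (simp add: abs_square_less_1)
    then show ?thesis using norm_of_mat[of a b c d] by (auto simp: p_def q_def)
  qed
  have N: "mat_norm a b c d \<le> (1 - p) * (1 - q)" by (simp add: mat_norm_rows p_def q_def)
  have "p + q < 2 \<longleftrightarrow> p < 1" if "0 < mat_norm a b c d"
  proof -
    have "0 < (1 - p) * (1 - q)" using N that by linarith
    then have "(p < 1 \<and> q < 1) \<or> (p > 1 \<and> q > 1)" by (auto simp: zero_less_mult_iff)
    then show ?thesis by auto
  qed
  then show ?thesis by (auto simp: lie_ball_def lie_norm_of_mat n p_def)
qed

lemma of_mat_in_inflated:
  "(of_mat a b c d, Z) \<in> inflated_lie_ball \<mu> \<longleftrightarrow>
    (cmod a)\<^sup>2 + (cmod b)\<^sup>2 < 1 \<and> 0 < mat_norm a b c d \<and> (norm Z)\<^sup>2 < mat_norm a b c d powr \<mu>"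
  by (auto simp: inflated_lie_ball_def of_mat_in_lie_ball lie_norm_of_mat)

text \<open>
  Schur complement with respect to the entry \<open>a\<close>: for fixed \<open>a, b, c\<close> the norm is a radial function
  of a translate of \<open>d\<close>.
\<close>
lemma mat_norm_schur:
  assumes r: "r = 1 - (cmod a)\<^sup>2" "r > 0"
  shows "mat_norm a b c d = r * ((r - (cmod b)\<^sup>2) * (r - (cmod c)\<^sup>2) / r\<^sup>2 - (cmod (d + cnj a * b * c / of_real r))\<^sup>2)"
proof -
  have e: "(cmod (d + cnj a * b * c / of_real r))\<^sup>2 = (cmod (of_real r * d + cnj a * b * c))\<^sup>2 / r\<^sup>2"
  proof -
    have "d + cnj a * b * c / of_real r = (of_real r * d + cnj a * b * c) / of_real r"
      using r(2) by (simp add: field_simps)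
    then show ?thesis by (simp add: norm_divide power_divide)
  qed
  have "r * mat_norm a b c d = (r - (cmod b)\<^sup>2) * (r - (cmod c)\<^sup>2) - (cmod (of_real r * d + cnj a * b * c))\<^sup>2"
    unfolding mat_norm_def r(1) by (simp add: cmod_power2, algebra)
  then have "mat_norm a b c d = ((r - (cmod b)\<^sup>2) * (r - (cmod c)\<^sup>2) - (cmod (of_real r * d + cnj a * b * c))\<^sup>2) / r"
    using r(2) by (simp add: field_simps)
  also have "\<dots> = r * ((r - (cmod b)\<^sup>2) * (r - (cmod c)\<^sup>2) / r\<^sup>2 - (cmod (d + cnj a * b * c / of_real r))\<^sup>2)"
    unfolding e using r(2) by (simp add: field_simps power2_eq_square)
  finally show ?thesis .
qed

text \<open>
  The Schur complement separates the variables. Integrating over \<open>d\<close>, \<open>c\<close>, \<open>b\<close>, \<open>a\<close> in this order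
  produces the factors \<open>s + 1\<close>, \<open>s + 2\<close>, \<open>s + 2\<close>, \<open>s + 3\<close>, each from a disc.
\<close>
lemma hua_integral:
  fixes s :: real
  assumes s: "s \<ge> 0"
  shows "(\<integral>\<^sup>+a. \<integral>\<^sup>+b. \<integral>\<^sup>+c. \<integral>\<^sup>+d. (if (cmod a)\<^sup>2 + (cmod b)\<^sup>2 < 1 \<and> 0 < mat_norm a b c d
      then ennreal (mat_norm a b c d powr s) else 0) \<partial>lborel \<partial>lborel \<partial>lborel \<partial>lborel)
    = ennreal (pi ^ 4 / ((s + 1) * (s + 2)\<^sup>2 * (s + 3)))"
proof -
  define F where "F a b c d = (if (cmod a)\<^sup>2 + (cmod b)\<^sup>2 < 1 \<and> 0 < mat_norm a b c d
      then ennreal (mat_norm a b c d powr s) else 0)" for a b c d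
  have Fd: "(\<integral>\<^sup>+d. F a b c d \<partial>lborel) =
      ennreal (r powr s * (pi / (s + 1)) * ((r - (cmod b)\<^sup>2) / r\<^sup>2) powr (s + 1))
       * (ennreal ((r - (cmod c)\<^sup>2) powr (s + 1)) * indicator {x. (cmod x)\<^sup>2 < r} c)"
    if r: "r = 1 - (cmod a)\<^sup>2" and b: "(cmod b)\<^sup>2 < r" for a b c r
  proof -
    have r0: "r > 0" using b by (smt (verit) zero_le_power2)
    define Q where "Q = (r - (cmod b)\<^sup>2) * (r - (cmod c)\<^sup>2) / r\<^sup>2"
    define e where "e = cnj a * b * c / of_real r"
    have N: "mat_norm a b c d = r * (Q - (cmod (d + e))\<^sup>2)" for d
      unfolding Q_def e_def by (rule mat_norm_schur[OF r r0])
    have "F a b c d = ennreal (r powr s) * (ennreal ((Q - (cmod (d + e))\<^sup>2) powr s) * indicator {x. (cmod x)\<^sup>2 < Q} (d + e))" for d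
      using b r0 r unfolding F_def N
      by (auto simp: indicator_def zero_less_mult_iff powr_mult simp flip: ennreal_mult)
    then have "(\<integral>\<^sup>+d. F a b c d \<partial>lborel)
      = ennreal (r powr s) * (\<integral>\<^sup>+d. ennreal ((Q - (cmod (d + e))\<^sup>2) powr s) * indicator {x. (cmod x)\<^sup>2 < Q} (d + e) \<partial>lborel)"
      by (simp add: nn_integral_cmult)
    also have "(\<integral>\<^sup>+d. ennreal ((Q - (cmod (d + e))\<^sup>2) powr s) * indicator {x. (cmod x)\<^sup>2 < Q} (d + e) \<partial>lborel)
      = (\<integral>\<^sup>+d. ennreal ((Q - (cmod d)\<^sup>2) powr s) * indicator {x. (cmod x)\<^sup>2 < Q} d \<partial>lborel)"
      by (rule nn_integral_lborel_translate) simp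
    also have "\<dots> = (if Q \<ge> 0 then ennreal (pi * Q powr (s + 1) / (s + 1)) else 0)"
    proof (cases "Q \<ge> 0")
      case False
      then have "{x::complex. (cmod x)\<^sup>2 < Q} = {}"
        by (auto simp: not_less not_le) (smt (verit) zero_le_power2)
      then show ?thesis using False by simp
    qed (simp add: nn_integral_disc_powr[OF s])
    finally have I: "(\<integral>\<^sup>+d. F a b c d \<partial>lborel) = ennreal (r powr s) * (if Q \<ge> 0 then ennreal (pi * Q powr (s + 1) / (s + 1)) else 0)" .
    show ?thesis
    proof (cases "(cmod c)\<^sup>2 < r")
      case True
      then have "Q > 0" using b r0 by (simp add: Q_def)
      moreover have "Q powr (s + 1) = ((r - (cmod b)\<^sup>2) / r\<^sup>2) powr (s + 1) * (r - (cmod c)\<^sup>2) powr (s + 1)"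
        unfolding Q_def using b True r0 by (subst powr_mult[symmetric]) auto
      ultimately show ?thesis unfolding I using True s by (simp add: flip: ennreal_mult)
    next
      case False
      then have "Q \<le> 0" using b r0 unfolding Q_def by (simp add: divide_le_0_iff mult_le_0_iff)
      then show ?thesis unfolding I using False s by auto
    qed
  qed
  have Fc: "(\<integral>\<^sup>+c. \<integral>\<^sup>+d. F a b c d \<partial>lborel \<partial>lborel) = ennreal (pi\<^sup>2 / ((s + 1) * (s + 2)))
       * (ennreal ((r - (cmod b)\<^sup>2) powr (s + 1)) * indicator {x. (cmod x)\<^sup>2 < r} b)"
    if r: "r = 1 - (cmod a)\<^sup>2" for a b r
  proof (cases "(cmod b)\<^sup>2 < r")
    case True
    have r0: "r > 0" using True by (smt (verit) zero_le_power2)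
    have "(\<integral>\<^sup>+c. \<integral>\<^sup>+d. F a b c d \<partial>lborel \<partial>lborel)
      = ennreal (r powr s * (pi / (s + 1)) * ((r - (cmod b)\<^sup>2) / r\<^sup>2) powr (s + 1))
       * (\<integral>\<^sup>+c. (ennreal ((r - (cmod c)\<^sup>2) powr (s + 1)) * indicator {x. (cmod x)\<^sup>2 < r} c) \<partial>lborel)"
      unfolding Fd[OF r True] by (rule nn_integral_cmult) simp
    also have "\<dots> = ennreal (r powr s * (pi / (s + 1)) * ((r - (cmod b)\<^sup>2) / r\<^sup>2) powr (s + 1)) * ennreal (pi * r powr (s + 1 + 1) / (s + 1 + 1))"
      using s r0 by (subst nn_integral_disc_powr) auto
    also have "\<dots> = ennreal (pi\<^sup>2 / ((s + 1) * (s + 2)) * (r - (cmod b)\<^sup>2) powr (s + 1))"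
    proof -
      have "((r - (cmod b)\<^sup>2) / r\<^sup>2) powr (s + 1) = (r - (cmod b)\<^sup>2) powr (s + 1) / (r powr (s + 1) * r powr (s + 1))"
        using True r0 by (simp add: powr_divide power2_eq_square powr_mult)
      moreover have "r powr (s + 1 + 1) * r powr s = r powr (s + 1) * r powr (s + 1)"
        by (simp flip: powr_add add: algebra_simps)
      moreover have "r powr (s + 1) > 0" using r0 by simp
      moreover have "r powr s * (pi / (s + 1)) * (A / (X * X)) * (pi * Y / (s + 1 + 1))
          = pi\<^sup>2 / ((s + 1) * (s + 2)) * A * ((Y * r powr s) / (X * X))" for A X Y
        by (simp add: power2_eq_square mult_ac add.commute)
      ultimately have "r powr s * (pi / (s + 1)) * ((r - (cmod b)\<^sup>2) / r\<^sup>2) powr (s + 1) * (pi * r powr (s + 1 + 1) / (s + 1 + 1))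
        = pi\<^sup>2 / ((s + 1) * (s + 2)) * (r - (cmod b)\<^sup>2) powr (s + 1)"
        by (simp only:) simp
      then show ?thesis using s by (simp flip: ennreal_mult)
    qed
    finally show ?thesis using True s by (simp flip: ennreal_mult)
  next
    case False
    then have "F a b c d = 0" for c d by (auto simp: F_def r)
    then show ?thesis using False by simp
  qed
  have Fb: "(\<integral>\<^sup>+b. \<integral>\<^sup>+c. \<integral>\<^sup>+d. F a b c d \<partial>lborel \<partial>lborel \<partial>lborel) = ennreal (pi ^ 3 / ((s + 1) * (s + 2)\<^sup>2))
       * (ennreal ((1 - (cmod a)\<^sup>2) powr (s + 2)) * indicator {x. (cmod x)\<^sup>2 < 1} a)" for a
  proof -
    define r where "r = 1 - (cmod a)\<^sup>2"
    show ?thesis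
    proof (cases "r > 0")
      case True
      have "(\<integral>\<^sup>+b. \<integral>\<^sup>+c. \<integral>\<^sup>+d. F a b c d \<partial>lborel \<partial>lborel \<partial>lborel)
         = ennreal (pi\<^sup>2 / ((s + 1) * (s + 2))) * (\<integral>\<^sup>+b. (ennreal ((r - (cmod b)\<^sup>2) powr (s + 1)) * indicator {x. (cmod x)\<^sup>2 < r} b) \<partial>lborel)"
        unfolding Fc[OF r_def] by (rule nn_integral_cmult) simp
      also have "\<dots> = ennreal (pi\<^sup>2 / ((s + 1) * (s + 2))) * ennreal (pi * r powr (s + 1 + 1) / (s + 1 + 1))"
        using s True by (subst nn_integral_disc_powr) auto
      also have "\<dots> = ennreal (pi ^ 3 / ((s + 1) * (s + 2)\<^sup>2)) * ennreal (r powr (s + 2))"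
        using s by (simp add: power2_eq_square power3_eq_cube algebra_simps flip: ennreal_mult)
      finally show ?thesis using True by (simp add: r_def)
    next
      case False
      have e: "\<not> (cmod b)\<^sup>2 < r" for b using False by (smt (verit) zero_le_power2)
      show ?thesis unfolding Fc[OF r_def] using e False by (simp add: r_def)
    qed
  qed
  have "(\<integral>\<^sup>+a. \<integral>\<^sup>+b. \<integral>\<^sup>+c. \<integral>\<^sup>+d. F a b c d \<partial>lborel \<partial>lborel \<partial>lborel \<partial>lborel) = ennreal (pi ^ 3 / ((s + 1) * (s + 2)\<^sup>2))
       * (\<integral>\<^sup>+a. (ennreal ((1 - (cmod a)\<^sup>2) powr (s + 2)) * indicator {x. (cmod x)\<^sup>2 < 1} a) \<partial>lborel)"
    unfolding Fb by (rule nn_integral_cmult) simp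
  also have "\<dots> = ennreal (pi ^ 3 / ((s + 1) * (s + 2)\<^sup>2)) * ennreal (pi * 1 powr (s + 2 + 1) / (s + 2 + 1))"
    using s by (subst nn_integral_disc_powr) auto
  also have "\<dots> = ennreal (pi ^ 4 / ((s + 1) * (s + 2)\<^sup>2 * (s + 3)))"
    using s by (simp add: power_numeral_reduce algebra_simps flip: ennreal_mult)
  finally show ?thesis by (simp add: F_def)
qed

type_synonym 'm mat_coords = "complex \<times> complex \<times> complex \<times> complex \<times> (complex ^ 'm)"

definition of_coords :: "'m::finite mat_coords \<Rightarrow> (complex ^ 4) \<times> (complex ^ 'm)"
  where "of_coords = (\<lambda>(a, b, c, d, Z). (of_mat a b c d, Z))"

lemma linear_of_coords: "linear of_coords"
  by (auto simp: linear_iff of_coords_def vec_eq_iff forall_4 of_mat_nth field_simps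
      scaleR_conv_of_real[where 'a = complex])

lemma bij_of_coords: "bij of_coords"
proof (rule bij_betw_byWitness[where f' = "\<lambda>(z, Z). (mat_a z, mat_b z, mat_c z, mat_d z, Z)"])
qed (auto simp: of_coords_def)

lemma measurable_slice:
  fixes f :: "'a::euclidean_space \<times> 'b::euclidean_space \<Rightarrow> ennreal"
  assumes "f \<in> borel_measurable borel"
  shows "(\<lambda>y. f (x, y)) \<in> borel_measurable borel"
  by (rule measurable_compose[OF _ assms]) (intro borel_measurable_continuous_onI continuous_intros)

lemma nn_integral_prod5:
  fixes f :: "'a::euclidean_space \<times> 'b::euclidean_space \<times> 'c::euclidean_space \<times> 'd::euclidean_space \<times> 'e::euclidean_space \<Rightarrow> ennreal"
  assumes f: "f \<in> borel_measurable borel"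
  shows "(\<integral>\<^sup>+p. f p \<partial>lborel) = (\<integral>\<^sup>+a. \<integral>\<^sup>+b. \<integral>\<^sup>+c. \<integral>\<^sup>+d. \<integral>\<^sup>+e. f (a, b, c, d, e) \<partial>lborel \<partial>lborel \<partial>lborel \<partial>lborel \<partial>lborel)"
  by (subst nn_integral_lborel_prod_iter[OF f], rule nn_integral_cong,
      subst nn_integral_lborel_prod_iter[OF measurable_slice[OF f]], rule nn_integral_cong,
      subst nn_integral_lborel_prod_iter[OF measurable_slice[OF measurable_slice[OF f]]], rule nn_integral_cong,
      subst nn_integral_lborel_prod_iter[OF measurable_slice[OF measurable_slice[OF measurable_slice[OF f]]]], rule refl)

text \<open>
  Iterated integration in matrix coordinates. The constant stays unspecified: scaling all moments
  by the same factor does not move the zeros of the kernel.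
\<close>
lemma nn_integral_coords:
  obtains C :: real where "C > 0"
    "\<And>h :: (complex ^ 4) \<times> (complex ^ 'm::finite) \<Rightarrow> ennreal. h \<in> borel_measurable borel \<Longrightarrow>
      (\<integral>\<^sup>+p. h p \<partial>lborel) = ennreal C * (\<integral>\<^sup>+a. \<integral>\<^sup>+b. \<integral>\<^sup>+c. \<integral>\<^sup>+d. \<integral>\<^sup>+Z. h (of_mat a b c d, Z)
        \<partial>lborel \<partial>lborel \<partial>lborel \<partial>lborel \<partial>lborel)"
proof -
  obtain C :: real where C: "C > 0" "\<And>h. h \<in> borel_measurable borel \<Longrightarrow>
      (\<integral>\<^sup>+p. h p \<partial>lborel) = ennreal C * (\<integral>\<^sup>+x. h (of_coords x :: (complex ^ 4) \<times> (complex ^ 'm)) \<partial>lborel)"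
    using nn_integral_linear_bij[OF linear_of_coords bij_of_coords] by metis
  show ?thesis
  proof (rule that[OF C(1)])
    fix h :: "(complex ^ 4) \<times> (complex ^ 'm) \<Rightarrow> ennreal" assume h [measurable]: "h \<in> borel_measurable borel"
    have [measurable]: "of_coords \<in> borel_measurable (borel :: 'm mat_coords measure)"
      using linear_of_coords by (intro borel_measurable_continuous_onI linear_continuous_on)
        (simp add: linear_conv_bounded_linear)
    have "(\<integral>\<^sup>+x. h (of_coords x) \<partial>lborel) = (\<integral>\<^sup>+a. \<integral>\<^sup>+b. \<integral>\<^sup>+c. \<integral>\<^sup>+d. \<integral>\<^sup>+Z. h (of_coords (a, b, c, d, Z))
        \<partial>lborel \<partial>lborel \<partial>lborel \<partial>lborel \<partial>lborel)"
      by (rule nn_integral_prod5) simp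
    then show "(\<integral>\<^sup>+p. h p \<partial>lborel) = ennreal C * (\<integral>\<^sup>+a. \<integral>\<^sup>+b. \<integral>\<^sup>+c. \<integral>\<^sup>+d. \<integral>\<^sup>+Z. h (of_mat a b c d, Z)
        \<partial>lborel \<partial>lborel \<partial>lborel \<partial>lborel \<partial>lborel)"
      using C(2)[OF h] by (simp add: of_coords_def)
  qed
qed

lemma continuous_on_lie_norm [continuous_intros]: "continuous_on S lie_norm"
  unfolding lie_norm_def by (intro continuous_intros)

lemma open_inflated_lie_ball: "open (inflated_lie_ball \<mu>)"
proof -
  have o: "open {p::(complex ^ 'n) \<times> (complex ^ 'm). norm (fst p) < 1 \<and> 0 < lie_norm (fst p)}"
    by (intro open_Collect_conj open_Collect_less continuous_intros
          continuous_on_compose2[OF continuous_on_lie_norm[of UNIV]]) auto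
  have c: "continuous_on {p::(complex ^ 'n) \<times> (complex ^ 'm). norm (fst p) < 1 \<and> 0 < lie_norm (fst p)}
      (\<lambda>p. (norm (snd p))\<^sup>2 - lie_norm (fst p) powr \<mu>)"
    by (intro continuous_intros continuous_on_compose2[OF continuous_on_lie_norm[of UNIV]]) auto
  have "inflated_lie_ball \<mu> = {p::(complex ^ 'n) \<times> (complex ^ 'm). norm (fst p) < 1 \<and> 0 < lie_norm (fst p)}
      \<inter> (\<lambda>p. (norm (snd p))\<^sup>2 - lie_norm (fst p) powr \<mu>) -` {..<0}"
    by (auto simp: inflated_lie_ball_def lie_ball_def)
  also have "open \<dots>" by (rule continuous_open_preimage[OF c o]) simp
  finally show ?thesis .
qed

text \<open>
The fibre integral is a ball moment of radius \<open>N ^ \<mu>\<close>, which leaves Hua's integral.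
\<close>
lemma inflated_moment:
  fixes i0 :: "'m::finite"
  assumes mu: "\<mu> > 0"
  obtains C :: real where "C > 0"
    "\<And>k. (\<integral>\<^sup>+p. ennreal ((cmod (snd p $ i0)) ^ (2 * k)) * indicator (inflated_lie_ball \<mu> :: ((complex ^ 4) \<times> (complex ^ 'm)) set) p \<partial>lborel)
      = (let s = \<mu> * real (CARD('m) + k) in
         ennreal (C * (fact k / fact (CARD('m) + k)) / ((s + 1) * (s + 2)\<^sup>2 * (s + 3))))"
proof -
  let ?U = "inflated_lie_ball \<mu> :: ((complex ^ 4) \<times> (complex ^ 'm)) set"
  obtain C :: real where C: "C > 0"
    "\<And>h :: (complex ^ 4) \<times> (complex ^ 'm::finite) \<Rightarrow> ennreal. h \<in> borel_measurable borel \<Longrightarrow>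
      (\<integral>\<^sup>+p. h p \<partial>lborel) = ennreal C * (\<integral>\<^sup>+a. \<integral>\<^sup>+b. \<integral>\<^sup>+c. \<integral>\<^sup>+d. \<integral>\<^sup>+Z. h (of_mat a b c d, Z)
        \<partial>lborel \<partial>lborel \<partial>lborel \<partial>lborel \<partial>lborel)"
    by (rule nn_integral_coords) blast
  show ?thesis
  proof (rule that[of "C * pi ^ CARD('m) * pi ^ 4"])
    show "C * pi ^ CARD('m) * pi ^ 4 > 0" using C(1) by simp
    fix k
    define s where "s = \<mu> * real (CARD('m) + k)"
    have s: "s \<ge> 0" using mu by (simp add: s_def)
    define \<beta> :: real where "\<beta> = pi ^ CARD('m) * fact k / fact (CARD('m) + k)"
    have b: "\<beta> \<ge> 0" by (simp add: \<beta>_def)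
    have Um: "?U \<in> sets borel" by (simp add: open_inflated_lie_ball)
    have sm: "(\<lambda>p::(complex ^ 4) \<times> (complex ^ 'm). snd p $ i0) \<in> borel_measurable borel"
      by (intro borel_measurable_continuous_onI continuous_intros)
    have "(\<integral>\<^sup>+p. ennreal ((cmod (snd p $ i0)) ^ (2 * k)) * indicator ?U p \<partial>lborel)
      = ennreal C * (\<integral>\<^sup>+a. \<integral>\<^sup>+b. \<integral>\<^sup>+c. \<integral>\<^sup>+d. \<integral>\<^sup>+Z. ennreal ((cmod (Z $ i0)) ^ (2 * k)) * indicator ?U (of_mat a b c d, Z)
        \<partial>lborel \<partial>lborel \<partial>lborel \<partial>lborel \<partial>lborel)"
      using C(2)[of "\<lambda>p. ennreal ((cmod (snd p $ i0)) ^ (2 * k)) * indicator ?U p"] Um sm by simp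
    also have "(\<integral>\<^sup>+a. \<integral>\<^sup>+b. \<integral>\<^sup>+c. \<integral>\<^sup>+d. \<integral>\<^sup>+Z. ennreal ((cmod (Z $ i0)) ^ (2 * k)) * indicator ?U (of_mat a b c d, Z)
        \<partial>lborel \<partial>lborel \<partial>lborel \<partial>lborel \<partial>lborel)
      = (\<integral>\<^sup>+a. \<integral>\<^sup>+b. \<integral>\<^sup>+c. \<integral>\<^sup>+d. ennreal \<beta> * (if (cmod a)\<^sup>2 + (cmod b)\<^sup>2 < 1 \<and> 0 < mat_norm a b c d
      then ennreal (mat_norm a b c d powr s) else 0) \<partial>lborel \<partial>lborel \<partial>lborel \<partial>lborel)"
    proof (intro nn_integral_cong)
      fix a b c d
      show "(\<integral>\<^sup>+Z. ennreal ((cmod (Z $ i0)) ^ (2 * k)) * indicator ?U (of_mat a b c d, Z) \<partial>lborel)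
         = ennreal \<beta> * (if (cmod a)\<^sup>2 + (cmod b)\<^sup>2 < 1 \<and> 0 < mat_norm a b c d
      then ennreal (mat_norm a b c d powr s) else 0)"
      proof (cases "(cmod a)\<^sup>2 + (cmod b)\<^sup>2 < 1 \<and> 0 < mat_norm a b c d")
        case True
        have "(\<integral>\<^sup>+Z. ennreal ((cmod (Z $ i0)) ^ (2 * k)) * indicator ?U (of_mat a b c d, Z) \<partial>lborel)
          = (\<integral>\<^sup>+(Z::complex ^ 'm). ennreal ((cmod (Z $ i0)) ^ (2 * k)) * indicator {Z. (norm Z)\<^sup>2 < mat_norm a b c d powr \<mu>} Z \<partial>lborel)"
          using True by (intro nn_integral_cong) (auto simp: indicator_def of_mat_in_inflated)
        also have "\<dots> = ennreal ((mat_norm a b c d powr \<mu>) ^ (CARD('m) + k) * \<beta>)"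
          unfolding \<beta>_def by (rule nn_integral_ball_moment) simp
        also have "(mat_norm a b c d powr \<mu>) ^ (CARD('m) + k) = mat_norm a b c d powr s"
          using True unfolding s_def by (simp add: powr_power mult.commute)
        finally show ?thesis using True b by (simp add: ennreal_mult mult.commute)
      next
        case False
        then have "(of_mat a b c d, Z) \<notin> ?U" for Z by (auto simp: of_mat_in_inflated)
        then show ?thesis using False by auto
      qed
    qed
    also have "\<dots> = ennreal \<beta> * (\<integral>\<^sup>+a. \<integral>\<^sup>+b. \<integral>\<^sup>+c. \<integral>\<^sup>+d. (if (cmod a)\<^sup>2 + (cmod b)\<^sup>2 < 1 \<and> 0 < mat_norm a b c d
      then ennreal (mat_norm a b c d powr s) else 0) \<partial>lborel \<partial>lborel \<partial>lborel \<partial>lborel)"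
    proof -
      have [measurable]: "(\<lambda>x. mat_norm (f1 x) (f2 x) (f3 x) (f4 x)) \<in> borel_measurable M"
        if "f1 \<in> borel_measurable M" "f2 \<in> borel_measurable M" "f3 \<in> borel_measurable M" "f4 \<in> borel_measurable M"
        for M :: "'z measure" and f1 f2 f3 f4
        unfolding mat_norm_def using that by measurable
      show ?thesis
        by (simp add: nn_integral_cmult)
    qed
    also have "\<dots> = ennreal \<beta> * ennreal (pi ^ 4 / ((s + 1) * (s + 2)\<^sup>2 * (s + 3)))"
      by (simp only: hua_integral[OF s])
    finally show "(\<integral>\<^sup>+p. ennreal ((cmod (snd p $ i0)) ^ (2 * k)) * indicator ?U p \<partial>lborel) = (let s = \<mu> * real (CARD('m) + k) in
         ennreal (C * pi ^ CARD('m) * pi ^ 4 * (fact k / fact (CARD('m) + k)) / ((s + 1) * (s + 2)\<^sup>2 * (s + 3))))"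
      using b s C(1) unfolding Let_def s_def[symmetric]
      by (simp add: \<beta>_def mult_ac flip: ennreal_mult)
  qed
qed

section \<open>Holomorphic functions, reproducing kernels and automorphisms\<close>

lemma cscale_nth [simp]: "fst (cscale c v) $ i = c * fst v $ i" "snd (cscale c v) $ j = c * snd v $ j"
  by (simp_all add: cscale_def vector_scalar_mult_def)

lemma holomorphic_sv_continuous_on:
  "holomorphic_sv f U \<Longrightarrow> continuous_on U f"
  unfolding holomorphic_sv_def
  by (meson continuous_at_imp_continuous_on has_derivative_continuous)

lemma holomorphic_sv_cong:
  assumes "open U" "\<And>p. p \<in> U \<Longrightarrow> f p = g p" "holomorphic_sv f U"
  shows "holomorphic_sv g U"
  unfolding holomorphic_sv_def
proof
  fix p assume p: "p \<in> U"
  then obtain D where D: "(f has_derivative D) (at p)" "\<forall>c v. D (cscale c v) = c * D v"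
    using assms(3) by (auto simp: holomorphic_sv_def)
  have "(g has_derivative D) (at p)"
    by (rule has_derivative_transform_within_open[OF D(1) assms(1) p]) (use assms(2) in auto)
  then show "\<exists>D. (g has_derivative D) (at p) \<and> (\<forall>c v. D (cscale c v) = c * D v)" using D(2) by blast
qed

lemma holomorphic_sv_const: "holomorphic_sv (\<lambda>p. c) U"
  unfolding holomorphic_sv_def by (intro ballI exI[of _ "\<lambda>_. 0"]) auto

lemma holomorphic_sv_fst: "holomorphic_sv (\<lambda>p. fst p $ i) U"
proof -
  have "bounded_linear (\<lambda>p::(complex ^ 'a) \<times> (complex ^ 'b). fst p $ i)"
    by (intro bounded_linear_compose[OF bounded_linear_vec_nth] bounded_linear_fst)
  then show ?thesis unfolding holomorphic_sv_def
    by (intro ballI exI[of _ "\<lambda>p. fst p $ i"]) (auto intro: bounded_linear_imp_has_derivative)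
qed

lemma holomorphic_sv_snd: "holomorphic_sv (\<lambda>p. snd p $ i) U"
proof -
  have "bounded_linear (\<lambda>p::(complex ^ 'a) \<times> (complex ^ 'b). snd p $ i)"
    by (intro bounded_linear_compose[OF bounded_linear_vec_nth] bounded_linear_snd)
  then show ?thesis unfolding holomorphic_sv_def
    by (intro ballI exI[of _ "\<lambda>p. snd p $ i"]) (auto intro: bounded_linear_imp_has_derivative)
qed

lemma holomorphic_sv_add:
  assumes "holomorphic_sv f U" "holomorphic_sv g U"
  shows "holomorphic_sv (\<lambda>p. f p + g p) U"
  unfolding holomorphic_sv_def
proof
  fix p assume "p \<in> U"
  then obtain D E where "(f has_derivative D) (at p)" "\<forall>c v. D (cscale c v) = c * D v"
     "(g has_derivative E) (at p)" "\<forall>c v. E (cscale c v) = c * E v"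
    using assms unfolding holomorphic_sv_def by meson
  then show "\<exists>D. ((\<lambda>p. f p + g p) has_derivative D) (at p) \<and> (\<forall>c v. D (cscale c v) = c * D v)"
    by (intro exI[of _ "\<lambda>v. D v + E v"]) (auto intro: has_derivative_add simp: algebra_simps)
qed

lemma holomorphic_sv_mult:
  assumes "holomorphic_sv f U" "holomorphic_sv g U"
  shows "holomorphic_sv (\<lambda>p. f p * g p) U"
  unfolding holomorphic_sv_def
proof
  fix p assume "p \<in> U"
  then obtain D E where "(f has_derivative D) (at p)" "\<forall>c v. D (cscale c v) = c * D v"
     "(g has_derivative E) (at p)" "\<forall>c v. E (cscale c v) = c * E v"
    using assms unfolding holomorphic_sv_def by meson
  then show "\<exists>D. ((\<lambda>p. f p * g p) has_derivative D) (at p) \<and> (\<forall>c v. D (cscale c v) = c * D v)"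
    using has_derivative_mult[of f D p UNIV g E]
    by (intro exI[of _ "\<lambda>v. f p * E v + D v * g p"]) (simp add: distrib_left mult.assoc mult.left_commute)
qed

lemma holomorphic_sv_compose:
  assumes "holomorphic_sv f U" "\<And>p. p \<in> U \<Longrightarrow> g field_differentiable (at (f p))"
  shows "holomorphic_sv (\<lambda>p. g (f p)) U"
  unfolding holomorphic_sv_def
proof
  fix p assume p: "p \<in> U"
  then obtain D where D: "(f has_derivative D) (at p)" "\<forall>c v. D (cscale c v) = c * D v"
    using assms(1) unfolding holomorphic_sv_def by meson
  obtain g' where "(g has_field_derivative g') (at (f p))"
    using assms(2)[OF p] by (auto simp: field_differentiable_def)
  then have "(g has_derivative (*) g') (at (f p))" by (simp add: has_field_derivative_def)
  from has_derivative_compose[OF D(1) this]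
  show "\<exists>D. ((\<lambda>p. g (f p)) has_derivative D) (at p) \<and> (\<forall>c v. D (cscale c v) = c * D v)"
    using D(2) by (intro exI[of _ "\<lambda>v. g' * D v"]) (auto simp: algebra_simps)
qed

lemma holomorphic_sv_cmult: "holomorphic_sv f U \<Longrightarrow> holomorphic_sv (\<lambda>p. c * f p) U"
  by (intro holomorphic_sv_mult holomorphic_sv_const)

lemma holomorphic_sv_diff:
  assumes "holomorphic_sv f U" "holomorphic_sv g U"
  shows "holomorphic_sv (\<lambda>p. f p - g p) U"
  using holomorphic_sv_add[OF assms(1) holomorphic_sv_cmult[OF assms(2), of "-1"]] by simp

lemma holomorphic_sv_inverse:
  assumes "holomorphic_sv f U" "\<And>p. p \<in> U \<Longrightarrow> f p \<noteq> 0"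
  shows "holomorphic_sv (\<lambda>p. inverse (f p)) U"
  by (rule holomorphic_sv_compose[OF assms(1)]) (use assms(2) in \<open>auto intro!: derivative_intros field_differentiable_inverse field_differentiable_ident\<close>)

lemma holomorphic_sv_divide:
  assumes "holomorphic_sv f U" "holomorphic_sv g U" "\<And>p. p \<in> U \<Longrightarrow> g p \<noteq> 0"
  shows "holomorphic_sv (\<lambda>p. f p / g p) U"
  unfolding divide_inverse using assms by (intro holomorphic_sv_mult holomorphic_sv_inverse) auto

lemma holomorphic_sv_power: "holomorphic_sv f U \<Longrightarrow> holomorphic_sv (\<lambda>p. f p ^ n) U"
  by (rule holomorphic_sv_compose) (auto intro!: field_differentiable_power field_differentiable_ident)

definition holomorphic_map :: "((complex ^ 'n) \<times> (complex ^ 'm) \<Rightarrow> (complex ^ 'n) \<times> (complex ^ 'm))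
    \<Rightarrow> ((complex ^ 'n) \<times> (complex ^ 'm)) set \<Rightarrow> bool"
  where "holomorphic_map \<phi> U \<longleftrightarrow>
    (\<forall>p\<in>U. \<exists>D. (\<phi> has_derivative D) (at p) \<and> (\<forall>c v. D (cscale c v) = cscale c (D v)))"

lemma holomorphic_map_continuous_on: "holomorphic_map f U \<Longrightarrow> continuous_on U f"
  unfolding holomorphic_map_def
  by (meson continuous_at_imp_continuous_on has_derivative_continuous)

lemma holomorphic_sv_o_map:
  assumes "holomorphic_sv f V" "holomorphic_map \<phi> U" "\<And>p. p \<in> U \<Longrightarrow> \<phi> p \<in> V"
  shows "holomorphic_sv (\<lambda>p. f (\<phi> p)) U"
  unfolding holomorphic_sv_def
proof
  fix p assume p: "p \<in> U"
  obtain D where D: "(\<phi> has_derivative D) (at p)" "\<forall>c v. D (cscale c v) = cscale c (D v)"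
    using assms(2) p unfolding holomorphic_map_def by meson
  obtain E where E: "(f has_derivative E) (at (\<phi> p))" "\<forall>c v. E (cscale c v) = c * E v"
    using assms(1) assms(3)[OF p] unfolding holomorphic_sv_def by meson
  from has_derivative_compose[OF D(1) E(1)] D(2) E(2)
  show "\<exists>D. ((\<lambda>p. f (\<phi> p)) has_derivative D) (at p) \<and> (\<forall>c v. D (cscale c v) = c * D v)"
    by (intro exI[of _ "\<lambda>v. E (D v)"]) (simp del: split_paired_All)
qed

lemma vec_lambda_sum_axis: "(\<chi> i. x i) = (\<Sum>i\<in>UNIV. axis i (x i :: 'a::comm_monoid_add))"
  by (simp add: vec_eq_iff axis_def if_distrib sum.delta cong: if_cong)

lemma has_derivative_vec_lambda:
  fixes f :: "'n::finite \<Rightarrow> 'a::real_normed_vector \<Rightarrow> complex"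
  assumes "\<And>i. (f i has_derivative D i) (at p)"
  shows "((\<lambda>p. \<chi> i. f i p) has_derivative (\<lambda>v. \<chi> i. D i v)) (at p)"
proof -
  have bl: "bounded_linear (axis i :: complex \<Rightarrow> complex ^ 'n)" for i
    unfolding linear_conv_bounded_linear[symmetric]
    by (auto simp: linear_iff vec_eq_iff axis_def)
  show ?thesis unfolding vec_lambda_sum_axis
    by (intro has_derivative_sum bounded_linear.has_derivative[OF bl] assms)
qed

lemma holomorphic_mapI:
  assumes "\<And>i. holomorphic_sv (\<lambda>p. fst (\<phi> p) $ i) U" "\<And>j. holomorphic_sv (\<lambda>p. snd (\<phi> p) $ j) U"
  shows "holomorphic_map \<phi> U"
  unfolding holomorphic_map_def
proof
  fix p assume p: "p \<in> U"
  have "\<forall>i. \<exists>D. ((\<lambda>p. fst (\<phi> p) $ i) has_derivative D) (at p) \<and> (\<forall>c v. D (cscale c v) = c * D v)"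
    using assms(1) p unfolding holomorphic_sv_def by blast
  then obtain D where D: "\<And>i. ((\<lambda>p. fst (\<phi> p) $ i) has_derivative D i) (at p)" "\<And>i c v. D i (cscale c v) = c * D i v"
    by metis
  have "\<forall>i. \<exists>D. ((\<lambda>p. snd (\<phi> p) $ i) has_derivative D) (at p) \<and> (\<forall>c v. D (cscale c v) = c * D v)"
    using assms(2) p unfolding holomorphic_sv_def by blast
  then obtain E where E: "\<And>i. ((\<lambda>p. snd (\<phi> p) $ i) has_derivative E i) (at p)" "\<And>i c v. E i (cscale c v) = c * E i v"
    by metis
  have "(\<phi> has_derivative (\<lambda>v. (\<chi> i. D i v, \<chi> j. E j v))) (at p)"
    using has_derivative_Pair[OF has_derivative_vec_lambda[of "\<lambda>i p. fst (\<phi> p) $ i", OF D(1)] has_derivative_vec_lambda[of "\<lambda>i p. snd (\<phi> p) $ i", OF E(1)]]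
    by simp
  then show "\<exists>D. (\<phi> has_derivative D) (at p) \<and> (\<forall>c v. D (cscale c v) = cscale c (D v))"
    by (intro exI[of _ "\<lambda>v. (\<chi> i. D i v, \<chi> j. E j v)"])
       (simp del: split_paired_All add: D(2) E(2) vec_eq_iff prod_eq_iff)
qed

lemma bergman_mult_integrable:
  assumes "open U" "f \<in> bergman_space U" "k \<in> bergman_space U"
  shows "set_integrable lborel U (\<lambda>p. f p * cnj (k p))"
proof -
  have m: "(\<lambda>p. indicator U p *\<^sub>R (f p * cnj (k p))) \<in> borel_measurable borel"
    using assms by (intro borel_measurable_continuous_on_indicator continuous_intros)
      (auto simp: bergman_space_def intro: holomorphic_sv_continuous_on)
  have "integrable lborel (\<lambda>p. indicator U p *\<^sub>R ((cmod (f p))\<^sup>2) + indicator U p *\<^sub>R ((cmod (k p))\<^sup>2))"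
    using assms unfolding bergman_space_def set_integrable_def by (intro Bochner_Integration.integrable_add) auto
  then show ?thesis unfolding set_integrable_def
  proof (rule Bochner_Integration.integrable_bound)
    have "x * y \<le> x\<^sup>2 + y\<^sup>2" if "x \<ge> 0" "y \<ge> 0" for x y :: real
      using sum_squares_bound[of x y] mult_nonneg_nonneg[OF that] by linarith
    then show "AE p in lborel. norm (indicator U p *\<^sub>R (f p * cnj (k p)))
        \<le> norm (indicator U p *\<^sub>R ((cmod (f p))\<^sup>2) + indicator U p *\<^sub>R ((cmod (k p))\<^sup>2))"
      by (auto simp: indicator_def norm_mult)
  qed (use m in simp)
qed

lemma bergman_space_cong:
  assumes "open U" "\<And>p. p \<in> U \<Longrightarrow> f p = g p" "f \<in> bergman_space U"
  shows "g \<in> bergman_space U"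
proof -
  have "holomorphic_sv g U" using assms(3) by (intro holomorphic_sv_cong[OF assms(1,2)]) (simp_all add: bergman_space_def)
  moreover have "set_integrable lborel U (\<lambda>p. (cmod (g p))\<^sup>2) = set_integrable lborel U (\<lambda>p. (cmod (f p))\<^sup>2)"
    unfolding set_integrable_def by (intro Bochner_Integration.integrable_cong refl) (auto simp: indicator_def assms(2))
  ultimately show ?thesis using assms(3) by (simp add: bergman_space_def)
qed

text \<open>
  Kernel functions at a single point, because automorphisms transport them point by point.
\<close>
definition reproduces_at :: "((complex ^ 'n) \<times> (complex ^ 'm)) set \<Rightarrow> (complex ^ 'n) \<times> (complex ^ 'm)
    \<Rightarrow> ((complex ^ 'n) \<times> (complex ^ 'm) \<Rightarrow> complex) \<Rightarrow> bool"
  where "reproduces_at U q k \<longleftrightarrow> k \<in> bergman_space U \<and>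
    (\<forall>f\<in>bergman_space U. f q = (LINT z:U|lborel. f z * cnj (k z)))"

text \<open>
Apply each reproducing property to the other kernel function.
\<close>
lemma reproduces_at_sym:
  assumes "reproduces_at U q k" "reproduces_at U p k'" "p \<in> U" "q \<in> U"
  shows "k p = cnj (k' q)"
proof -
  have "k' q = (LINT z:U|lborel. k' z * cnj (k z))" using assms by (simp add: reproduces_at_def)
  then have "cnj (k' q) = cnj (LINT z:U|lborel. k' z * cnj (k z))" by simp
  also have "\<dots> = (LINT z:U|lborel. k z * cnj (k' z))"
    unfolding set_lebesgue_integral_def
    by (subst Bochner_Integration.integral_cnj[symmetric]) (simp add: mult.commute)
  also have "\<dots> = k p" using assms by (simp add: reproduces_at_def)
  finally show ?thesis by simp
qed

text \<open>
  Any kernel functions, chosen separately at each point, assemble to the Bergman kernel, which is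
  unique by \<open>reproduces_at_sym\<close>.
\<close>
lemma bergman_kernel_eq:
  assumes U: "open U" and ex: "\<And>q. q \<in> U \<Longrightarrow> \<exists>k. reproduces_at U q k"
    and k: "reproduces_at U q k" and p: "p \<in> U" and q: "q \<in> U"
  shows "bergman_kernel U p q = k p"
proof -
  have rep: "reproduces_at U w (\<lambda>z. K z w)" if "is_bergman_kernel U K" "w \<in> U" for K w
    using that by (auto simp: is_bergman_kernel_def reproduces_at_def)
  obtain \<kappa> where \<kappa>: "\<And>q. q \<in> U \<Longrightarrow> reproduces_at U q (\<kappa> q)" using ex by metis
  define K where "K z w = (if z \<in> U \<and> w \<in> U then \<kappa> w z else 0)" for z w
  have K1: "is_bergman_kernel U K"
    unfolding is_bergman_kernel_def
  proof (intro conjI ballI)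
    fix w assume w: "w \<in> U"
    show "(\<lambda>z. K z w) \<in> bergman_space U"
      by (rule bergman_space_cong[OF U, of "\<kappa> w"]) (use \<kappa>[OF w] w in \<open>auto simp: K_def reproduces_at_def\<close>)
    fix f assume f: "f \<in> bergman_space U"
    have "f w = (LINT z:U|lborel. f z * cnj (\<kappa> w z))" using f \<kappa>[OF w] by (simp add: reproduces_at_def)
    also have "\<dots> = (LINT z:U|lborel. f z * cnj (K z w))"
      unfolding set_lebesgue_integral_def by (rule Bochner_Integration.integral_cong) (auto simp: K_def w indicator_def)
    finally show "f w = (LINT z:U|lborel. f z * cnj (K z w))" .
  qed
  have "bergman_kernel U = K"
    unfolding bergman_kernel_def
  proof (rule the_equality)
    show "is_bergman_kernel U K \<and> (\<forall>z w. (z, w) \<notin> U \<times> U \<longrightarrow> K z w = 0)" using K1 by (auto simp: K_def)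
    fix K' assume K': "is_bergman_kernel U K' \<and> (\<forall>z w. (z, w) \<notin> U \<times> U \<longrightarrow> K' z w = 0)"
    have "K' z w = K z w" if zw: "z \<in> U" "w \<in> U" for z w
      using reproduces_at_sym[OF rep[of K' w] \<kappa>[OF zw(1)] zw] reproduces_at_sym[OF rep[OF K1 zw(2)] \<kappa>[OF zw(1)] zw] K' zw
      by simp
    then show "K' = K" using K' by (intro ext) (auto simp: K_def)
  qed
  moreover have "K p q = k p"
    using reproduces_at_sym[OF rep[OF K1 q] \<kappa>[OF p] p q] reproduces_at_sym[OF k \<kappa>[OF p] p q] by simp
  ultimately show ?thesis by simp
qed

text \<open>
  The function \<open>J\<close> plays the role of the complex Jacobian determinant; only the resulting change of
  variables formula is required.
\<close>
definition bergman_automorphism :: "((complex ^ 'n) \<times> (complex ^ 'm)) set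
    \<Rightarrow> ((complex ^ 'n) \<times> (complex ^ 'm) \<Rightarrow> (complex ^ 'n) \<times> (complex ^ 'm))
    \<Rightarrow> ((complex ^ 'n) \<times> (complex ^ 'm) \<Rightarrow> (complex ^ 'n) \<times> (complex ^ 'm))
    \<Rightarrow> ((complex ^ 'n) \<times> (complex ^ 'm) \<Rightarrow> complex) \<Rightarrow> bool"
  where "bergman_automorphism U \<phi> \<phi>' J \<longleftrightarrow>
    (\<forall>p\<in>U. \<phi> p \<in> U \<and> \<phi>' p \<in> U \<and> \<phi> (\<phi>' p) = p \<and> \<phi>' (\<phi> p) = p \<and> J p \<noteq> 0) \<and>
    holomorphic_map \<phi> U \<and> holomorphic_map \<phi>' U \<and> holomorphic_sv J U \<and>
    (\<forall>h \<in> borel_measurable borel.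
      (\<integral>\<^sup>+p. h (\<phi> p) * ennreal ((cmod (J p))\<^sup>2) * indicator U p \<partial>lborel) = (\<integral>\<^sup>+p. h p * indicator U p \<partial>lborel))"

text \<open>
  The formula for nonnegative functions identifies an image measure, hence it extends to integrable
  functions.
\<close>
lemma bergman_automorphism_integral:
  fixes F :: "(complex ^ 'n::finite) \<times> (complex ^ 'm::finite) \<Rightarrow> 'b::{banach, second_countable_topology}"
  assumes U: "open U" and aut: "bergman_automorphism U \<phi> \<phi>' J"
    and F: "continuous_on U F"
  shows "set_integrable lborel U (\<lambda>p. (cmod (J p))\<^sup>2 *\<^sub>R F (\<phi> p)) \<longleftrightarrow> set_integrable lborel U F" (is ?A)
    and "(LINT p:U|lborel. (cmod (J p))\<^sup>2 *\<^sub>R F (\<phi> p)) = (LINT p:U|lborel. F p)" (is ?B)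
proof -
  define G where "G p = indicator U p *\<^sub>R F p" for p
  have Um [measurable]: "U \<in> sets borel" using U by simp
  have Gm [measurable]: "G \<in> borel_measurable borel" unfolding G_def
    using F Um by (rule borel_measurable_continuous_on_indicator[rotated])
  define \<psi> where "\<psi> p = indicator U p *\<^sub>R \<phi> p" for p
  have Pm [measurable]: "\<psi> \<in> borel_measurable borel" unfolding \<psi>_def
    using aut Um by (intro borel_measurable_continuous_on_indicator holomorphic_map_continuous_on)
      (auto simp: bergman_automorphism_def)
  define w where "w p = indicator U p * (cmod (J p))\<^sup>2" for p
  have wm [measurable]: "w \<in> borel_measurable borel"
  proof -
    have "(\<lambda>p. indicator U p *\<^sub>R (cmod (J p))\<^sup>2) \<in> borel_measurable borel"
      using aut Um by (intro borel_measurable_continuous_on_indicator continuous_intros holomorphic_sv_continuous_on)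
      (auto simp: bergman_automorphism_def)
    then show ?thesis by (simp add: w_def[abs_def])
  qed
  have w0: "w p \<ge> 0" for p by (simp add: w_def)
  have eq: "distr (density lborel (\<lambda>p. ennreal (w p))) borel \<psi> = density lborel (\<lambda>p. ennreal (indicator U p))"
  proof (rule measure_eqI)
    fix A assume "A \<in> sets (distr (density lborel (\<lambda>p. ennreal (w p))) borel \<psi>)"
    then have A [measurable]: "A \<in> sets borel" by simp
    have Am: "indicator A \<in> borel_measurable borel" by (rule borel_measurable_indicator[OF A])
    have "emeasure (distr (density lborel (\<lambda>p. ennreal (w p))) borel \<psi>) A
       = (\<integral>\<^sup>+p. indicator A p \<partial>distr (density lborel (\<lambda>p. ennreal (w p))) borel \<psi>)" by simp
    also have "\<dots> = (\<integral>\<^sup>+p. indicator A (\<psi> p) \<partial>density lborel (\<lambda>p. ennreal (w p)))"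
      by (rule nn_integral_distr) (auto simp: A)
    also have "\<dots> = (\<integral>\<^sup>+p. ennreal (w p) * indicator A (\<psi> p) \<partial>lborel)"
      by (rule nn_integral_density) auto
    also have "\<dots> = (\<integral>\<^sup>+p. indicator A (\<phi> p) * ennreal ((cmod (J p))\<^sup>2) * indicator U p \<partial>lborel)"
      by (intro nn_integral_cong) (auto simp: w_def \<psi>_def indicator_def)
    also have "\<dots> = (\<integral>\<^sup>+p. indicator A p * indicator U p \<partial>lborel)"
      using aut Am by (auto simp: bergman_automorphism_def)
    also have "\<dots> = (\<integral>\<^sup>+p. ennreal (indicator U p) * indicator A p \<partial>lborel)"
      by (intro nn_integral_cong) (auto simp: indicator_def)
    also have "\<dots> = emeasure (density lborel (\<lambda>p. ennreal (indicator U p))) A"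
      by (rule emeasure_density[symmetric]) auto
    finally show "emeasure (distr (density lborel (\<lambda>p. ennreal (w p))) borel \<psi>) A
      = emeasure (density lborel (\<lambda>p. ennreal (indicator U p))) A" .
  qed simp
  have G\<psi>: "w p *\<^sub>R G (\<psi> p) = indicator U p *\<^sub>R ((cmod (J p))\<^sup>2 *\<^sub>R F (\<phi> p))" for p
    using aut by (auto simp: w_def \<psi>_def G_def indicator_def bergman_automorphism_def)
  have GU: "indicator U p *\<^sub>R G p = indicator U p *\<^sub>R F p" for p by (simp add: G_def indicator_def)
  have "set_integrable lborel U F \<longleftrightarrow> integrable (density lborel (\<lambda>p. ennreal (indicator U p))) G"
    by (subst integrable_density) (auto simp: GU set_integrable_def)
  also have "\<dots> \<longleftrightarrow> integrable (density lborel (\<lambda>p. ennreal (w p))) (\<lambda>p. G (\<psi> p))"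
    unfolding eq[symmetric] by (rule integrable_distr_eq) auto
  also have "\<dots> \<longleftrightarrow> set_integrable lborel U (\<lambda>p. (cmod (J p))\<^sup>2 *\<^sub>R F (\<phi> p))"
    by (subst integrable_density) (auto simp: G\<psi> set_integrable_def w0)
  finally show ?A by simp
  have "(LINT p:U|lborel. F p) = integral\<^sup>L (density lborel (\<lambda>p. ennreal (indicator U p))) G"
    by (subst integral_density) (auto simp: GU set_lebesgue_integral_def)
  also have "\<dots> = integral\<^sup>L (density lborel (\<lambda>p. ennreal (w p))) (\<lambda>p. G (\<psi> p))"
    unfolding eq[symmetric] by (rule integral_distr) auto
  also have "\<dots> = (LINT p:U|lborel. (cmod (J p))\<^sup>2 *\<^sub>R F (\<phi> p))"
    by (subst integral_density) (auto simp: G\<psi> set_lebesgue_integral_def w0)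
  finally show ?B by simp
qed

text \<open>
  The map \<open>F \<mapsto> J * (F \<circ> \<phi>)\<close> is unitary on the Bergman space. Its inverse is applied to a given \<open>f\<close>
  to obtain \<open>F\<close>, for which the kernel function at \<open>\<phi> q\<close> is known.
\<close>
lemma reproduces_at_automorphism:
  assumes U: "open U" and aut: "bergman_automorphism U \<phi> \<phi>' J"
    and k: "reproduces_at U (\<phi> q) k" and q: "q \<in> U"
  shows "reproduces_at U q (\<lambda>p. J p * cnj (J q) * k (\<phi> p))"
proof -
  have a: "\<And>p. p \<in> U \<Longrightarrow> \<phi> p \<in> U \<and> \<phi>' p \<in> U \<and> \<phi> (\<phi>' p) = p \<and> \<phi>' (\<phi> p) = p \<and> J p \<noteq> 0"
    "holomorphic_map \<phi> U" "holomorphic_map \<phi>' U" "holomorphic_sv J U"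
    using aut unfolding bergman_automorphism_def by blast+
  have kb: "k \<in> bergman_space U" using k by (simp add: reproduces_at_def)
  have kh: "holomorphic_sv k U" using kb by (simp add: bergman_space_def)
  have "(\<lambda>p. J p * cnj (J q) * k (\<phi> p)) \<in> bergman_space U"
    unfolding bergman_space_def
  proof (intro CollectI conjI)
    show "holomorphic_sv (\<lambda>p. J p * cnj (J q) * k (\<phi> p)) U"
      by (rule holomorphic_sv_mult[OF holomorphic_sv_mult[OF a(4) holomorphic_sv_const]
            holomorphic_sv_o_map[OF kh a(2)]]) (use a(1) in blast)
    have "set_integrable lborel U (\<lambda>p. (cmod (J p))\<^sup>2 *\<^sub>R ((cmod (k (\<phi> p)))\<^sup>2))"
      using kb kh by (subst bergman_automorphism_integral(1)[OF U aut])
        (auto simp: bergman_space_def intro!: continuous_intros holomorphic_sv_continuous_on)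
    then have "set_integrable lborel U (\<lambda>p. (cmod (J q))\<^sup>2 * ((cmod (J p))\<^sup>2 *\<^sub>R ((cmod (k (\<phi> p)))\<^sup>2)))"
      by (rule set_integrable_mult_right)
    then show "set_integrable lborel U (\<lambda>p. (cmod (J p * cnj (J q) * k (\<phi> p)))\<^sup>2)"
      by (simp add: norm_mult power_mult_distrib mult_ac)
  qed
  moreover have "f q = (LINT p:U|lborel. f p * cnj (J p * cnj (J q) * k (\<phi> p)))"
    if f: "f \<in> bergman_space U" for f
  proof -
    have fh: "holomorphic_sv f U" using f by (simp add: bergman_space_def)
    define F where "F p = f (\<phi>' p) / J (\<phi>' p)" for p
    have Fh: "holomorphic_sv F U" unfolding F_def
      by (rule holomorphic_sv_divide[OF holomorphic_sv_o_map[OF fh a(3)] holomorphic_sv_o_map[OF a(4) a(3)]])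
        (use a(1) in blast)+
    have FJ: "F (\<phi> p) = f p / J p" if "p \<in> U" for p using a(1)[OF that] by (simp add: F_def)
    have "set_integrable lborel U (\<lambda>p. (cmod (J p))\<^sup>2 *\<^sub>R ((cmod (F (\<phi> p)))\<^sup>2)) \<longleftrightarrow> set_integrable lborel U (\<lambda>p. (cmod (F p))\<^sup>2)"
      using Fh by (intro bergman_automorphism_integral(1)[OF U aut])
        (auto intro!: continuous_intros holomorphic_sv_continuous_on)
    moreover have "set_integrable lborel U (\<lambda>p. (cmod (J p))\<^sup>2 *\<^sub>R ((cmod (F (\<phi> p)))\<^sup>2)) \<longleftrightarrow> set_integrable lborel U (\<lambda>p. (cmod (f p))\<^sup>2)"
      unfolding set_integrable_def using a(1)
      by (intro Bochner_Integration.integrable_cong refl)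
        (auto simp: FJ indicator_def norm_divide power_divide)
    ultimately have "F \<in> bergman_space U" using f Fh by (simp add: bergman_space_def)
    then have "F (\<phi> q) = (LINT z:U|lborel. F z * cnj (k z))" using k by (simp add: reproduces_at_def)
    also have "\<dots> = (LINT p:U|lborel. (cmod (J p))\<^sup>2 *\<^sub>R (F (\<phi> p) * cnj (k (\<phi> p))))"
      by (intro bergman_automorphism_integral(2)[OF U aut, symmetric] continuous_intros
          holomorphic_sv_continuous_on[OF Fh] holomorphic_sv_continuous_on[OF kh])
    also have "\<dots> = (LINT p:U|lborel. f p * cnj (J p * k (\<phi> p)))"
      unfolding set_lebesgue_integral_def
    proof (rule Bochner_Integration.integral_cong[OF refl])
      fix p
      have "(cmod (J p))\<^sup>2 *\<^sub>R (F (\<phi> p) * cnj (k (\<phi> p))) = f p * cnj (J p * k (\<phi> p))" if p: "p \<in> U"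
        using a(1)[OF p]
        by (simp add: FJ[OF p] scaleR_conv_of_real complex_norm_square of_real_power[symmetric] field_simps
            del: of_real_power)
      then show "indicator U p *\<^sub>R ((cmod (J p))\<^sup>2 *\<^sub>R (F (\<phi> p) * cnj (k (\<phi> p)))) = indicator U p *\<^sub>R (f p * cnj (J p * k (\<phi> p)))"
        by (simp add: indicator_def)
    qed
    finally have "f q / J q = (LINT p:U|lborel. f p * cnj (J p * k (\<phi> p)))" using FJ[OF q] by simp
    then have "f q = J q * (LINT p:U|lborel. f p * cnj (J p * k (\<phi> p)))"
      using a(1)[OF q] by (simp add: field_simps)
    also have "\<dots> = (LINT p:U|lborel. J q * (f p * cnj (J p * k (\<phi> p))))"
      by (simp add: set_integral_mult_right)
    finally show ?thesis by (simp add: mult_ac)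
  qed
  ultimately show ?thesis by (simp add: reproduces_at_def)
qed

section \<open>Automorphisms of the inflated Lie ball\<close>

definition complex_isometry :: "(complex ^ 'n \<Rightarrow> complex ^ 'n) \<Rightarrow> bool" where
  "complex_isometry A \<longleftrightarrow> (\<forall>x y. A (x + y) = A x + A y) \<and> (\<forall>c x. A (c *s x) = c *s A x) \<and> (\<forall>x. norm (A x) = norm x)"

lemma scaleR_eq_cscale: "r *\<^sub>R (x :: complex ^ 'n) = of_real r *s x"
  by (simp add: vec_eq_iff scaleR_conv_of_real[where 'a = complex])

lemma complex_isometry_linear: "complex_isometry A \<Longrightarrow> linear A"
  by (simp add: complex_isometry_def linear_iff scaleR_eq_cscale)

lemma complex_isometry_bij:
  assumes "complex_isometry A"
  shows "bij A"
proof -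
  have lin: "linear A" by (rule complex_isometry_linear[OF assms])
  have "inj A"
  proof (rule injI)
    fix x y assume "A x = A y"
    then have "norm (A (x - y)) = 0" using lin by (simp add: linear_diff)
    then have "norm (x - y) = 0" using assms unfolding complex_isometry_def by metis
    then show "x = y" by simp
  qed
  then show ?thesis using lin by (simp add: bij_def linear_injective_imp_surjective)
qed

lemma complex_isometry_inv:
  assumes "complex_isometry A"
  shows "complex_isometry (inv A)"
proof -
  have b: "bij A" by (rule complex_isometry_bij[OF assms])
  have AI: "A (inv A x) = x" for x using b by (simp add: bij_def surj_f_inv_f)
  have IA: "inv A (A x) = x" for x using b by (simp add: bij_def)
  show ?thesis unfolding complex_isometry_def
  proof (intro conjI allI)
    fix x y c
    have "A (inv A x + inv A y) = x + y" using assms by (simp add: complex_isometry_def AI)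
    then show "inv A (x + y) = inv A x + inv A y" using IA[of "inv A x + inv A y"] by simp
    have "A (c *s inv A x) = c *s x" using assms by (simp add: complex_isometry_def AI)
    then show "inv A (c *s x) = c *s inv A x" using IA[of "c *s inv A x"] by simp
    have "norm (A (inv A x)) = norm (inv A x)" using assms unfolding complex_isometry_def by blast
    then show "norm (inv A x) = norm x" by (simp add: AI)
  qed
qed

lemma complex_isometry_id: "complex_isometry (\<lambda>x. x)"
  by (simp add: complex_isometry_def)

lemma holomorphic_map_isometry:
  assumes "complex_isometry A" "complex_isometry B"
  shows "holomorphic_map (\<lambda>p. (A (fst p), B (snd p))) U"
  unfolding holomorphic_map_def
proof
  fix p
  have "bounded_linear A" "bounded_linear B"
    using assms complex_isometry_linear linear_conv_bounded_linear by auto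
  then have "bounded_linear (\<lambda>p. (A (fst p), B (snd p)))"
    by (intro bounded_linear_Pair bounded_linear_compose[OF _ bounded_linear_fst]
        bounded_linear_compose[OF _ bounded_linear_snd])
  then have "((\<lambda>p. (A (fst p), B (snd p))) has_derivative (\<lambda>p. (A (fst p), B (snd p)))) (at p)"
    by (rule bounded_linear_imp_has_derivative)
  then show "\<exists>D. ((\<lambda>p. (A (fst p), B (snd p))) has_derivative D) (at p) \<and> (\<forall>c v. D (cscale c v) = cscale c (D v))"
    using assms by (intro exI[of _ "\<lambda>p. (A (fst p), B (snd p))"])
      (simp del: split_paired_All add: cscale_def complex_isometry_def)
qed

lemma bergman_automorphism_isometry:
  assumes A: "complex_isometry A" "\<And>z. lie_norm (A z) = lie_norm z" and B: "complex_isometry B"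
  shows "bergman_automorphism (inflated_lie_ball \<mu>) (\<lambda>p. (A (fst p), B (snd p))) (\<lambda>p. (inv A (fst p), inv B (snd p))) (\<lambda>_. 1)"
proof -
  let ?U = "inflated_lie_ball \<mu>"
  let ?f = "\<lambda>p. (A (fst p), B (snd p))"
  have bA: "bij A" "bij B" using complex_isometry_bij A B by auto
  have AI: "A (inv A x) = x" "inv A (A x) = x" for x using bA by (simp_all add: bij_def surj_f_inv_f)
  have BI: "B (inv B x) = x" "inv B (B x) = x" for x using bA by (simp_all add: bij_def surj_f_inv_f)
  have nA: "norm (A z) = norm z" for z using A by (simp add: complex_isometry_def)
  have nB: "norm (B z) = norm z" for z using B by (simp add: complex_isometry_def)
  have inU: "?f p \<in> ?U \<longleftrightarrow> p \<in> ?U" for p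
    by (auto simp: inflated_lie_ball_def lie_ball_def nA nB A(2) case_prod_beta)
  have inU': "(inv A (fst p), inv B (snd p)) \<in> ?U \<longleftrightarrow> p \<in> ?U" for p
    using inU[of "(inv A (fst p), inv B (snd p))"] by (simp add: AI BI)
  have lin: "linear ?f"
    using A B by (auto simp: linear_iff scaleR_eq_cscale complex_isometry_def)
  have "(\<integral>\<^sup>+p. h (?f p) * ennreal ((cmod 1)\<^sup>2) * indicator ?U p \<partial>lborel) = (\<integral>\<^sup>+p. h p * indicator ?U p \<partial>lborel)"
    if h [measurable]: "h \<in> borel_measurable borel" for h
  proof -
    have [measurable]: "?U \<in> sets borel" by (simp add: open_inflated_lie_ball)
    have "(\<integral>\<^sup>+p. h (?f p) * indicator ?U (?f p) \<partial>lborel) = (\<integral>\<^sup>+p. h p * indicator ?U p \<partial>lborel)"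
      by (rule nn_integral_isometry[OF lin, of "\<lambda>p. h p * indicator ?U p"]) (auto simp: norm_Pair nA nB norm_prod_def)
    then show ?thesis by (simp add: indicator_def inU)
  qed
  then show ?thesis unfolding bergman_automorphism_def
    using inU inU' holomorphic_map_isometry[OF A(1) B]
      holomorphic_map_isometry[OF complex_isometry_inv[OF A(1)] complex_isometry_inv[OF B]]
    by (simp add: AI BI holomorphic_sv_const del: split_paired_All)
qed

definition herm :: "complex ^ 'n \<Rightarrow> complex ^ 'n \<Rightarrow> complex" where
  "herm x y = (\<Sum>i\<in>UNIV. x $ i * cnj (y $ i))"

lemma herm_add: "herm (x + y) z = herm x z + herm y z" "herm z (x + y) = herm z x + herm z y"
  and herm_diff: "herm (x - y) z = herm x z - herm y z" "herm z (x - y) = herm z x - herm z y"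
  and herm_scale: "herm (c *s x) z = c * herm x z" "herm z (c *s x) = cnj c * herm z x"
  and herm_cnj: "cnj (herm x y) = herm y x"
  by (simp_all add: herm_def algebra_simps sum.distrib sum_subtractf sum_distrib_left)

lemma herm_norm: "herm x x = of_real ((norm x)\<^sup>2)"
  by (simp add: herm_def norm_vec_square complex_norm_square[symmetric])

text \<open>
  A complex Householder reflection. It exchanges two vectors of equal norm if their Hermitian product is
  real, which a suitable phase of \<open>t\<close> achieves.
\<close>
lemma ex_complex_isometry_axis:
  fixes W :: "complex ^ 'm::finite"
  obtains B t where "complex_isometry B" "B W = axis i0 t"
proof -
  define t where "t = of_real (norm W) * (if W $ i0 = 0 then 1 else sgn (W $ i0))"
  define e where "e = (axis i0 t :: complex ^ 'm)"
  define v where "v = W - e"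
  define \<rho> where "\<rho> = norm W * cmod (W $ i0)"
  have ct: "cmod t = norm W" by (auto simp: t_def norm_mult norm_sgn)
  have ne: "norm e = norm W" 
    by (simp add: e_def norm_eq_sqrt_inner[of "axis _ _"] inner_axis_axis ct flip: norm_eq_sqrt_inner)
  have hWe: "herm W e = of_real \<rho>"
  proof -
    have "herm W e = W $ i0 * cnj t"
    proof -
      have "herm W e = (\<Sum>i\<in>UNIV. if i = i0 then W $ i0 * cnj t else 0)"
        unfolding herm_def e_def by (intro sum.cong) (auto simp: axis_def)
      then show ?thesis by simp
    qed
    also have "\<dots> = of_real \<rho>"
    proof (cases "W $ i0 = 0")
      case False
      have "W $ i0 * cnj (sgn (W $ i0)) = of_real (cmod (W $ i0))"
        using False by (simp add: sgn_eq complex_norm_square[symmetric] power2_eq_square)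
      then show ?thesis using False by (simp add: t_def \<rho>_def mult_ac)
    qed (simp add: \<rho>_def)
    finally show ?thesis .
  qed
  have heW: "herm e W = of_real \<rho>" using hWe herm_cnj[of W e] by simp
  have hvv: "herm v v = of_real (2 * ((norm W)\<^sup>2 - \<rho>))"
    unfolding v_def herm_diff unfolding hWe heW herm_norm ne by simp
  have hWv: "herm W v = of_real ((norm W)\<^sup>2 - \<rho>)"
    unfolding v_def herm_diff hWe herm_norm by simp
  show ?thesis
  proof (cases "v = 0")
    case True
    then have "W = axis i0 t" by (simp add: v_def e_def)
    then show ?thesis using that[OF complex_isometry_id] by blast
  next
    case False
    define n where "n = herm v v"
    have n: "n = of_real ((norm v)\<^sup>2)" "n \<noteq> 0" using False by (simp_all add: n_def herm_norm)
    have cn: "cnj n = n" by (simp add: n(1))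
    define B where "B x = x - (2 * herm x v / n) *s v" for x
    have "B W = axis i0 t"
    proof -
      have "2 * herm W v / n = 1" using n(2) unfolding n_def hvv hWv by simp
      then show ?thesis by (simp add: B_def v_def e_def)
    qed
    moreover have "complex_isometry B"
      unfolding complex_isometry_def
    proof (intro conjI allI)
      fix x y c
      show "B (x + y) = B x + B y"
        by (simp add: B_def herm_add vec_eq_iff field_simps n(2))
      show "B (c *s x) = c *s B x"
        by (simp add: B_def herm_scale vec_eq_iff field_simps n(2))
      have "herm (B x) (B x) = herm x x"
        unfolding B_def herm_diff herm_scale n_def[symmetric]
        using n(2) cn by (simp add: herm_cnj[of x v] field_simps)
      then have "(norm (B x))\<^sup>2 = (norm x)\<^sup>2" unfolding herm_norm by (simp only: of_real_eq_iff)
      then show "norm (B x) = norm x" by simp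
    qed
    ultimately show ?thesis using that by blast
  qed
qed

lemma mat_add:
  "mat_a (x + y) = mat_a x + mat_a y" "mat_b (x + y) = mat_b x + mat_b y"
  "mat_c (x + y) = mat_c x + mat_c y" "mat_d (x + y) = mat_d x + mat_d y"
  and mat_scale:
  "mat_a (k *s x) = k * mat_a x" "mat_b (k *s x) = k * mat_b x"
  "mat_c (k *s x) = k * mat_c x" "mat_d (k *s x) = k * mat_d x"
  by (simp_all add: mat_defs algebra_simps)

lemma of_mat_add: "of_mat a b c d + of_mat a' b' c' d' = of_mat (a + a') (b + b') (c + c') (d + d')"
  by (simp add: vec_eq_iff forall_4 of_mat_nth field_simps)

lemma of_mat_scale: "k *s of_mat a b c d = of_mat (k * a) (k * b) (k * c) (k * d)"
  by (simp add: vec_eq_iff forall_4 of_mat_nth field_simps)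

lemma of_mat_0: "of_mat 0 0 0 0 = 0"
  by (simp add: vec_eq_iff forall_4 of_mat_nth)

lemma of_mat_norm_eqI:
  assumes "(cmod a)\<^sup>2 + (cmod b)\<^sup>2 + (cmod c)\<^sup>2 + (cmod d)\<^sup>2 = (cmod a')\<^sup>2 + (cmod b')\<^sup>2 + (cmod c')\<^sup>2 + (cmod d')\<^sup>2"
    and "cmod (a * d - b * c) = cmod (a' * d' - b' * c')"
  shows "norm (of_mat a b c d) = norm (of_mat a' b' c' d')" "lie_norm (of_mat a b c d) = lie_norm (of_mat a' b' c' d')"
proof -
  have "(norm (of_mat a b c d))\<^sup>2 = (norm (of_mat a' b' c' d'))\<^sup>2"
    using norm_of_mat[of a b c d] norm_of_mat[of a' b' c' d'] assms(1) by linarith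
  then show "norm (of_mat a b c d) = norm (of_mat a' b' c' d')" by (rule power2_eq_imp_eq) simp_all
  show "lie_norm (of_mat a b c d) = lie_norm (of_mat a' b' c' d')"
    using assms by (simp add: lie_norm_of_mat mat_norm_def)
qed

text \<open>
Left multiplication by the special unitary matrix with first row \<open>x, y\<close>.
\<close>
definition left_rotation :: "complex \<Rightarrow> complex \<Rightarrow> complex ^ 4 \<Rightarrow> complex ^ 4" where
  "left_rotation x y z = of_mat (x * mat_a z + y * mat_c z) (x * mat_b z + y * mat_d z)
     (- cnj y * mat_a z + cnj x * mat_c z) (- cnj y * mat_b z + cnj x * mat_d z)"

lemma left_rotation:
  assumes xy: "(cmod x)\<^sup>2 + (cmod y)\<^sup>2 = 1"
  shows "complex_isometry (left_rotation x y)" "lie_norm (left_rotation x y z) = lie_norm z"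
proof -
  have xy': "x * cnj x + y * cnj y = 1"
    using arg_cong[OF xy, of complex_of_real] by (simp only: of_real_add complex_norm_square of_real_1)
  have row: "(cmod (x * p + y * q))\<^sup>2 + (cmod (- cnj y * p + cnj x * q))\<^sup>2 = (cmod p)\<^sup>2 + (cmod q)\<^sup>2" for p q
  proof -
    have "complex_of_real ((cmod (x * p + y * q))\<^sup>2 + (cmod (- cnj y * p + cnj x * q))\<^sup>2)
      = (x * cnj x + y * cnj y) * (p * cnj p + q * cnj q)"
      by (simp only: of_real_add complex_norm_square) (simp add: algebra_simps)
    also have "\<dots> = complex_of_real ((cmod p)\<^sup>2 + (cmod q)\<^sup>2)"
      by (simp only: xy' of_real_add complex_norm_square) simp
    finally show ?thesis by (simp only: of_real_eq_iff)
  qed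
  have sum: "(cmod (x * a + y * c))\<^sup>2 + (cmod (x * b + y * d))\<^sup>2 + (cmod (- cnj y * a + cnj x * c))\<^sup>2 + (cmod (- cnj y * b + cnj x * d))\<^sup>2
    = (cmod a)\<^sup>2 + (cmod b)\<^sup>2 + (cmod c)\<^sup>2 + (cmod d)\<^sup>2" for a b c d
    using row[of a c] row[of b d] by linarith
  have det: "(x * a + y * c) * (- cnj y * b + cnj x * d) - (x * b + y * d) * (- cnj y * a + cnj x * c) = a * d - b * c" for a b c d
  proof -
    have "(x * a + y * c) * (- cnj y * b + cnj x * d) - (x * b + y * d) * (- cnj y * a + cnj x * c) = (x * cnj x + y * cnj y) * (a * d - b * c)"
      by (simp add: algebra_simps)
    then show ?thesis by (simp add: xy')
  qed
  have n: "norm (left_rotation x y z) = norm z" "lie_norm (left_rotation x y z) = lie_norm z" for z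
    using of_mat_norm_eqI[OF sum[of "mat_a z" "mat_c z" "mat_b z" "mat_d z"] arg_cong[OF det[of "mat_a z" "mat_c z" "mat_b z" "mat_d z"], of cmod]]
    by (simp_all add: left_rotation_def)
  then show "lie_norm (left_rotation x y z) = lie_norm z" by simp
  show "complex_isometry (left_rotation x y)"
    unfolding complex_isometry_def using n(1)
    by (simp add: left_rotation_def mat_add mat_scale of_mat_add of_mat_scale algebra_simps)
qed

definition column_swap :: "complex ^ 4 \<Rightarrow> complex ^ 4" where
  "column_swap z = of_mat (mat_b z) (mat_a z) (mat_d z) (mat_c z)"

lemma column_swap: "complex_isometry column_swap" "lie_norm (column_swap z) = lie_norm z"
proof -
  have n: "norm (column_swap z) = norm z" "lie_norm (column_swap z) = lie_norm z" for z
    using of_mat_norm_eqI[of "mat_b z" "mat_a z" "mat_d z" "mat_c z" "mat_a z" "mat_b z" "mat_c z" "mat_d z"]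
    by (simp_all add: column_swap_def norm_minus_commute mult.commute)
  then show "lie_norm (column_swap z) = lie_norm z" by simp
  show "complex_isometry column_swap"
    unfolding complex_isometry_def using n(1)
    by (simp add: column_swap_def mat_add mat_scale of_mat_add of_mat_scale)
qed

text \<open>
  A holomorphic function of \<open>a\<close> whose squared modulus is the \<open>\<mu>\<close>-th power of the factor by which the
  Moebius map multiplies the norm. The logarithm is holomorphic since its argument has positive real
  part.
\<close>
definition moebius_factor :: "real \<Rightarrow> real \<Rightarrow> complex \<Rightarrow> complex" where
  "moebius_factor \<mu> \<alpha> a = exp (of_real \<mu> * (of_real (ln (1 - \<alpha>\<^sup>2) / 2) - Ln (1 - of_real \<alpha> * a)))"

text \<open>
  On matrices, this is the automorphism of the matrix ball that moves the matrix with the single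
  nonzero entry \<open>a = \<alpha>\<close> to \<open>0\<close>.
\<close>
definition moebius_map :: "real \<Rightarrow> real \<Rightarrow> (complex ^ 4) \<times> (complex ^ 'm) \<Rightarrow> (complex ^ 4) \<times> (complex ^ 'm)" where
  "moebius_map \<mu> \<alpha> p = (let a = mat_a (fst p); b = mat_b (fst p); c = mat_c (fst p); d = mat_d (fst p);
      w = 1 - of_real \<alpha> * a; \<kappa> = of_real (sqrt (1 - \<alpha>\<^sup>2)) in
    (of_mat ((a - of_real \<alpha>) / w) (\<kappa> / w * b) (\<kappa> / w * c) (d + of_real \<alpha> * b * c / w),
     moebius_factor \<mu> \<alpha> a *s snd p))"

definition moebius_jacobian :: "real \<Rightarrow> real \<Rightarrow> (complex ^ 4) \<times> (complex ^ 'm) \<Rightarrow> complex" where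
  "moebius_jacobian \<mu> \<alpha> p = (of_real (1 - \<alpha>\<^sup>2) / (1 - of_real \<alpha> * mat_a (fst p))\<^sup>2)\<^sup>2
     * moebius_factor \<mu> \<alpha> (mat_a (fst p)) ^ CARD('m)"

lemma moebius_denominator:
  assumes "\<bar>\<alpha>\<bar> < 1" "cmod a < 1"
  shows "Re (1 - of_real \<alpha> * a) > 0"
proof -
  have "\<bar>\<alpha> * Re a\<bar> \<le> 1 * cmod a"
    unfolding abs_mult using assms by (intro mult_mono abs_Re_le_cmod) auto
  then show ?thesis using assms(2) by simp
qed

text \<open>
  The two quantities whose positivity describes the matrix ball are multiplied by the same factor.
\<close>
lemma moebius_cmod_identities:
  fixes a b c d :: complex and \<alpha> :: real
  defines "w \<equiv> 1 - of_real \<alpha> * a"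
  defines "\<kappa> \<equiv> complex_of_real (sqrt (1 - \<alpha>\<^sup>2))"
  assumes \<alpha>: "\<bar>\<alpha>\<bar> < 1" and w: "w \<noteq> 0"
  shows "1 - (cmod ((a - of_real \<alpha>) / w))\<^sup>2 - (cmod (\<kappa> / w * b))\<^sup>2 = (1 - \<alpha>\<^sup>2) / (cmod w)\<^sup>2 * (1 - (cmod a)\<^sup>2 - (cmod b)\<^sup>2)"
    and "mat_norm ((a - of_real \<alpha>) / w) (\<kappa> / w * b) (\<kappa> / w * c) (d + of_real \<alpha> * b * c / w)
      = (1 - \<alpha>\<^sup>2) / (cmod w)\<^sup>2 * mat_norm a b c d"
proof -
  have a1: "1 - \<alpha>\<^sup>2 > 0" using \<alpha> by (simp add: abs_square_less_1)
  have w2: "(cmod w)\<^sup>2 > 0" using w by simp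
  have k2: "(cmod \<kappa>)\<^sup>2 = 1 - \<alpha>\<^sup>2" using a1 by (simp add: \<kappa>_def)
  have kk: "\<kappa> * \<kappa> = of_real (1 - \<alpha>\<^sup>2)" using a1 by (simp add: \<kappa>_def flip: of_real_mult)
  have A: "(cmod w)\<^sup>2 - (cmod (a - of_real \<alpha>))\<^sup>2 = (1 - \<alpha>\<^sup>2) * (1 - (cmod a)\<^sup>2)"
    unfolding w_def by (simp add: cmod_power2, algebra)
  have sc: "(cmod (x / w))\<^sup>2 = (cmod x)\<^sup>2 / (cmod w)\<^sup>2" "(cmod (\<kappa> / w * x))\<^sup>2 = (1 - \<alpha>\<^sup>2) * (cmod x)\<^sup>2 / (cmod w)\<^sup>2" for x
    by (simp_all add: norm_divide norm_mult power_divide power_mult_distrib k2)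
  show "1 - (cmod ((a - of_real \<alpha>) / w))\<^sup>2 - (cmod (\<kappa> / w * b))\<^sup>2 = (1 - \<alpha>\<^sup>2) / (cmod w)\<^sup>2 * (1 - (cmod a)\<^sup>2 - (cmod b)\<^sup>2)"
  proof -
    have "1 - (cmod ((a - of_real \<alpha>) / w))\<^sup>2 - (cmod (\<kappa> / w * b))\<^sup>2
      = (((cmod w)\<^sup>2 - (cmod (a - of_real \<alpha>))\<^sup>2) - (1 - \<alpha>\<^sup>2) * (cmod b)\<^sup>2) / (cmod w)\<^sup>2"
      using w unfolding sc by (simp add: diff_divide_distrib)
    also have "\<dots> = (1 - \<alpha>\<^sup>2) / (cmod w)\<^sup>2 * (1 - (cmod a)\<^sup>2 - (cmod b)\<^sup>2)"
      unfolding A times_divide_eq_left by (simp only: right_diff_distrib)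
    finally show ?thesis .
  qed
  have d': "d + of_real \<alpha> * b * c / w = (w * d + of_real \<alpha> * b * c) / w" using w by (simp add: field_simps)
  have det: "(a - of_real \<alpha>) / w * (d + of_real \<alpha> * b * c / w) - \<kappa> / w * b * (\<kappa> / w * c) = ((a - of_real \<alpha>) * d - b * c) / w"
  proof -
    have "(a - of_real \<alpha>) / w * (d + of_real \<alpha> * b * c / w) - \<kappa> / w * b * (\<kappa> / w * c)
      = ((a - of_real \<alpha>) * (w * d + of_real \<alpha> * b * c) - (\<kappa> * \<kappa>) * b * c) / (w * w)"
    proof -
      have "\<kappa> / w * b * (\<kappa> / w * c) = (\<kappa> * \<kappa>) * b * c / (w * w)" by (simp add: mult_ac)
      then show ?thesis unfolding d' times_divide_times_eq by (simp only: diff_divide_distrib)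
    qed
    also have "(a - of_real \<alpha>) * (w * d + of_real \<alpha> * b * c) - (\<kappa> * \<kappa>) * b * c = w * ((a - of_real \<alpha>) * d - b * c)"
      unfolding kk w_def by (simp add: algebra_simps power2_eq_square)
    finally show ?thesis using w by simp
  qed
  have B: "- (cmod (w * d + of_real \<alpha> * b * c))\<^sup>2 + (cmod ((a - of_real \<alpha>) * d - b * c))\<^sup>2
     = (1 - \<alpha>\<^sup>2) * ((cmod (a * d - b * c))\<^sup>2 - (cmod d)\<^sup>2)"
    unfolding w_def by (simp add: cmod_power2, algebra)
  have "mat_norm ((a - of_real \<alpha>) / w) (\<kappa> / w * b) (\<kappa> / w * c) (d + of_real \<alpha> * b * c / w)
    = 1 - (cmod (a - of_real \<alpha>))\<^sup>2 / (cmod w)\<^sup>2 - (1 - \<alpha>\<^sup>2) * (cmod b)\<^sup>2 / (cmod w)\<^sup>2 - (1 - \<alpha>\<^sup>2) * (cmod c)\<^sup>2 / (cmod w)\<^sup>2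
      - (cmod (w * d + of_real \<alpha> * b * c))\<^sup>2 / (cmod w)\<^sup>2 + (cmod ((a - of_real \<alpha>) * d - b * c))\<^sup>2 / (cmod w)\<^sup>2"
    unfolding mat_norm_def det unfolding d' sc ..
  also have "\<dots> = (((cmod w)\<^sup>2 - (cmod (a - of_real \<alpha>))\<^sup>2) - (1 - \<alpha>\<^sup>2) * (cmod b)\<^sup>2 - (1 - \<alpha>\<^sup>2) * (cmod c)\<^sup>2
      + (- (cmod (w * d + of_real \<alpha> * b * c))\<^sup>2 + (cmod ((a - of_real \<alpha>) * d - b * c))\<^sup>2)) / (cmod w)\<^sup>2"
    using w by (simp add: diff_divide_distrib add_divide_distrib)
  also have "\<dots> = (1 - \<alpha>\<^sup>2) / (cmod w)\<^sup>2 * mat_norm a b c d"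
    unfolding A B mat_norm_def times_divide_eq_left
    by (rule arg_cong[where f = "\<lambda>x. x / _"]) (simp add: algebra_simps)
  finally show "mat_norm ((a - of_real \<alpha>) / w) (\<kappa> / w * b) (\<kappa> / w * c) (d + of_real \<alpha> * b * c / w)
      = (1 - \<alpha>\<^sup>2) / (cmod w)\<^sup>2 * mat_norm a b c d" .
qed

lemma cmod_moebius_factor:
  assumes \<alpha>: "\<bar>\<alpha>\<bar> < 1" and w: "1 - of_real \<alpha> * a \<noteq> 0"
  shows "(cmod (moebius_factor \<mu> \<alpha> a))\<^sup>2 = ((1 - \<alpha>\<^sup>2) / (cmod (1 - of_real \<alpha> * a))\<^sup>2) powr \<mu>"
proof -
  have a1: "1 - \<alpha>\<^sup>2 > 0" using \<alpha> by (simp add: abs_square_less_1)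
  have "(cmod (moebius_factor \<mu> \<alpha> a))\<^sup>2 = exp (2 * (\<mu> * (ln (1 - \<alpha>\<^sup>2) / 2 - ln (cmod (1 - of_real \<alpha> * a)))))"
    using w by (simp add: moebius_factor_def norm_exp_eq_Re exp_double[symmetric])
  also have "\<dots> = exp (\<mu> * ln ((1 - \<alpha>\<^sup>2) / (cmod (1 - of_real \<alpha> * a))\<^sup>2))"
    using a1 w by (simp add: ln_div ln_realpow algebra_simps)
  also have "\<dots> = ((1 - \<alpha>\<^sup>2) / (cmod (1 - of_real \<alpha> * a))\<^sup>2) powr \<mu>"
    using a1 w by (simp add: powr_def)
  finally show ?thesis .
qed

lemma inflated_cmod_mat_a:
  assumes "p \<in> inflated_lie_ball \<mu>"
  shows "cmod (mat_a (fst p)) < 1"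
proof -
  have "(of_mat (mat_a (fst p)) (mat_b (fst p)) (mat_c (fst p)) (mat_d (fst p)), snd p) \<in> inflated_lie_ball \<mu>"
    using assms by simp
  then have "(cmod (mat_a (fst p)))\<^sup>2 + (cmod (mat_b (fst p)))\<^sup>2 < 1" unfolding of_mat_in_inflated by blast
  then have "(cmod (mat_a (fst p)))\<^sup>2 < 1" by (smt (verit) zero_le_power2)
  then show ?thesis by (simp add: abs_square_less_1)
qed

lemma moebius_map_of_mat:
  "moebius_map \<mu> \<alpha> (of_mat a b c d, Z) =
    (of_mat ((a - of_real \<alpha>) / (1 - of_real \<alpha> * a)) (of_real (sqrt (1 - \<alpha>\<^sup>2)) / (1 - of_real \<alpha> * a) * b)
      (of_real (sqrt (1 - \<alpha>\<^sup>2)) / (1 - of_real \<alpha> * a) * c) (d + of_real \<alpha> * b * c / (1 - of_real \<alpha> * a)),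
     moebius_factor \<mu> \<alpha> a *s Z)"
  by (simp add: moebius_map_def Let_def)

lemma norm_cvec_scale: "norm (c *s (x :: complex ^ 'n)) = cmod c * norm x"
proof -
  have "(norm (c *s x))\<^sup>2 = (cmod c * norm x)\<^sup>2"
    by (simp add: norm_vec_square norm_mult power_mult_distrib sum_distrib_left)
  then show ?thesis by (simp only: power2_eq_iff_nonneg norm_ge_zero mult_nonneg_nonneg)
qed

lemma moebius_map_in_iff:
  assumes \<alpha>: "\<bar>\<alpha>\<bar> < 1" and w: "1 - of_real \<alpha> * a \<noteq> 0"
  shows "moebius_map \<mu> \<alpha> (of_mat a b c d, Z) \<in> inflated_lie_ball \<mu> \<longleftrightarrow> (of_mat a b c d, Z) \<in> inflated_lie_ball \<mu>"
proof -
  define g where "g = (1 - \<alpha>\<^sup>2) / (cmod (1 - of_real \<alpha> * a))\<^sup>2"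
  have a1: "1 - \<alpha>\<^sup>2 > 0" using \<alpha> by (simp add: abs_square_less_1)
  have g: "g > 0" using a1 w by (simp add: g_def)
  let ?a = "(a - of_real \<alpha>) / (1 - of_real \<alpha> * a)" and ?b = "of_real (sqrt (1 - \<alpha>\<^sup>2)) / (1 - of_real \<alpha> * a) * b"
  have 1: "1 - (cmod ?a)\<^sup>2 - (cmod ?b)\<^sup>2 = g * (1 - (cmod a)\<^sup>2 - (cmod b)\<^sup>2)"
    unfolding g_def by (rule moebius_cmod_identities(1)[OF \<alpha> w])
  have "(cmod ?a)\<^sup>2 + (cmod ?b)\<^sup>2 < 1 \<longleftrightarrow> 0 < 1 - (cmod ?a)\<^sup>2 - (cmod ?b)\<^sup>2" by linarith
  also have "\<dots> \<longleftrightarrow> 0 < 1 - (cmod a)\<^sup>2 - (cmod b)\<^sup>2" unfolding 1 using g by (simp add: zero_less_mult_iff)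
  also have "\<dots> \<longleftrightarrow> (cmod a)\<^sup>2 + (cmod b)\<^sup>2 < 1" by linarith
  finally have ab: "(cmod ?a)\<^sup>2 + (cmod ?b)\<^sup>2 < 1 \<longleftrightarrow> (cmod a)\<^sup>2 + (cmod b)\<^sup>2 < 1" .
  have N: "mat_norm ?a ?b (of_real (sqrt (1 - \<alpha>\<^sup>2)) / (1 - of_real \<alpha> * a) * c) (d + of_real \<alpha> * b * c / (1 - of_real \<alpha> * a)) = g * mat_norm a b c d"
    unfolding g_def by (rule moebius_cmod_identities(2)[OF \<alpha> w])
  have Z: "(norm (moebius_factor \<mu> \<alpha> a *s Z))\<^sup>2 = g powr \<mu> * (norm Z)\<^sup>2"
    unfolding norm_cvec_scale power_mult_distrib cmod_moebius_factor[OF \<alpha> w] g_def ..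
  have "(norm (moebius_factor \<mu> \<alpha> a *s Z))\<^sup>2 < (g * mat_norm a b c d) powr \<mu> \<longleftrightarrow> (norm Z)\<^sup>2 < mat_norm a b c d powr \<mu>"
    if "0 < mat_norm a b c d"
    using that g by (simp add: Z powr_mult)
  then show ?thesis unfolding moebius_map_of_mat of_mat_in_inflated ab N
    using g by (auto simp: zero_less_mult_iff)
qed

lemma moebius_map_inverse:
  assumes \<alpha>: "\<bar>\<alpha>\<bar> < 1" and a: "cmod a < 1"
  shows "moebius_map \<mu> (- \<alpha>) (moebius_map \<mu> \<alpha> (of_mat a b c d, Z)) = (of_mat a b c d, Z)"
proof -
  define w where "w = 1 - of_real \<alpha> * a"
  define \<kappa> where "\<kappa> = complex_of_real (sqrt (1 - \<alpha>\<^sup>2))"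
  have a1: "1 - \<alpha>\<^sup>2 > 0" using \<alpha> by (simp add: abs_square_less_1)
  have rw: "Re w > 0" unfolding w_def by (rule moebius_denominator[OF \<alpha> a])
  then have w: "w \<noteq> 0" by auto
  have kk: "\<kappa> * \<kappa> = of_real (1 - \<alpha>\<^sup>2)" using a1 by (simp add: \<kappa>_def flip: of_real_mult)
  have k0: "\<kappa> \<noteq> 0" using a1 by (simp add: \<kappa>_def)
  define w' where "w' = 1 - of_real (- \<alpha>) * ((a - of_real \<alpha>) / w)"
  have w': "w' = of_real (1 - \<alpha>\<^sup>2) / w"
  proof -
    have "w' = (w + of_real \<alpha> * (a - of_real \<alpha>)) / w" using w by (simp add: w'_def field_simps)
    also have "w + of_real \<alpha> * (a - of_real \<alpha>) = of_real (1 - \<alpha>\<^sup>2)"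
      by (simp add: w_def algebra_simps power2_eq_square)
    finally show ?thesis .
  qed
  have w'k: "w' = \<kappa> * \<kappa> / w" by (simp only: w' kk)
  have w'0: "w' \<noteq> 0" using w'k k0 w by simp
  have A: "((a - of_real \<alpha>) / w - of_real (- \<alpha>)) / w' = a"
  proof -
    have "(a - of_real \<alpha>) / w - of_real (- \<alpha>) = (a * of_real (1 - \<alpha>\<^sup>2)) / w"
      using w by (simp add: field_simps) (simp add: w_def algebra_simps power2_eq_square)
    also have "\<dots> = a * w'" by (simp add: w')
    finally show ?thesis using w'0 by simp
  qed
  have B: "\<kappa> / w' * (\<kappa> / w * x) = x" for x
    unfolding w'k using k0 w by simp
  have D: "d + of_real \<alpha> * b * c / w + of_real (- \<alpha>) * (\<kappa> / w * b) * (\<kappa> / w * c) / w' = d"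
    unfolding w'k using k0 w by simp
  have F: "moebius_factor \<mu> (- \<alpha>) ((a - of_real \<alpha>) / w) * moebius_factor \<mu> \<alpha> a = 1"
  proof -
    have nn: "w \<notin> \<real>\<^sub>\<le>\<^sub>0" using rw by (auto simp: complex_nonpos_Reals_iff)
    have "Ln w' = Ln (of_real (1 - \<alpha>\<^sup>2) * inverse w)" by (simp only: w' divide_inverse)
    also have "\<dots> = of_real (ln (1 - \<alpha>\<^sup>2)) + Ln (inverse w)"
      using a1 w by (subst Ln_times_of_real) (simp_all add: Ln_of_real del: of_real_diff of_real_power)
    also have "\<dots> = of_real (ln (1 - \<alpha>\<^sup>2)) - Ln w" using Ln_inverse[OF nn] by simp
    finally have L: "Ln w' = of_real (ln (1 - \<alpha>\<^sup>2)) - Ln w" .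
    show ?thesis unfolding moebius_factor_def exp_add[symmetric] w_def[symmetric] w'_def[symmetric] L
      by (simp add: algebra_simps flip: of_real_mult)
  qed
  show ?thesis
    unfolding moebius_map_of_mat w_def[symmetric] \<kappa>_def[symmetric] power2_minus w'_def[symmetric]
    by (simp only: A B D F vector_smult_assoc vector_smult_lid)
qed

text \<open>
  For fixed \<open>a\<close> the Moebius map scales \<open>b\<close>, \<open>c\<close> and \<open>Z\<close>, and translates \<open>d\<close> by an amount that
  depends on \<open>b\<close> and \<open>c\<close>; integrating over \<open>d\<close> before \<open>c\<close> and \<open>b\<close> removes the translation.
\<close>
lemma nn_integral_moebius_fibre:
  fixes f :: "complex \<times> complex \<times> complex \<times> (complex ^ 'm::finite) \<Rightarrow> ennreal"
  assumes f: "f \<in> borel_measurable borel" and \<sigma>: "\<sigma> \<noteq> 0" and \<psi>: "\<psi> \<noteq> 0"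
  shows "(\<integral>\<^sup>+b. \<integral>\<^sup>+c. \<integral>\<^sup>+d. \<integral>\<^sup>+Z. f (\<sigma> * b, \<sigma> * c, d + \<beta> * b * c, \<psi> *s Z)
        * ennreal ((cmod \<sigma>)\<^sup>2 * (cmod \<sigma>)\<^sup>2 * cmod \<psi> ^ (2 * CARD('m))) \<partial>lborel \<partial>lborel \<partial>lborel \<partial>lborel)
    = (\<integral>\<^sup>+b. \<integral>\<^sup>+c. \<integral>\<^sup>+d. \<integral>\<^sup>+Z. f (b, c, d, Z) \<partial>lborel \<partial>lborel \<partial>lborel \<partial>lborel)"
proof -
  have fm [measurable]: "f \<in> borel_measurable (borel \<Otimes>\<^sub>M (borel \<Otimes>\<^sub>M (borel \<Otimes>\<^sub>M borel)))"
    using f by (simp add: borel_prod)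
  have [measurable]: "(\<lambda>Z::complex ^ 'm. \<psi> *s Z) \<in> borel_measurable borel"
    by (intro borel_measurable_continuous_onI)
       (auto simp: vector_scalar_mult_def intro!: continuous_intros)
  define x where "x = ennreal ((cmod \<sigma>)\<^sup>2)"
  define y where "y = ennreal (cmod \<psi> ^ (2 * CARD('m)))"
  have xy: "ennreal ((cmod \<sigma>)\<^sup>2 * (cmod \<sigma>)\<^sup>2 * cmod \<psi> ^ (2 * CARD('m))) = y * x * x"
    by (simp add: x_def y_def mult_ac flip: ennreal_mult)
  have Z: "(\<integral>\<^sup>+Z. f (b, c, d, \<psi> *s Z) \<partial>lborel) * y = (\<integral>\<^sup>+Z. f (b, c, d, Z) \<partial>lborel)" for b c d
  proof -
    have "linear (\<lambda>Z::complex ^ 'm. \<psi> *s Z)"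
      by (auto simp: linear_iff vec_eq_iff scaleR_conv_of_real[where 'a = complex] algebra_simps)
    from nn_integral_similarity[OF this, of "cmod \<psi>" "\<lambda>Z. f (b, c, d, Z)"]
    show ?thesis using \<psi> by (simp add: norm_cvec_scale y_def mult.commute)
  qed
  have d: "(\<integral>\<^sup>+d. (\<integral>\<^sup>+Z. f (b, c, d + e, Z) \<partial>lborel) \<partial>lborel) = (\<integral>\<^sup>+d. (\<integral>\<^sup>+Z. f (b, c, d, Z) \<partial>lborel) \<partial>lborel)" for b c e
    by (rule nn_integral_lborel_translate[of "\<lambda>d. \<integral>\<^sup>+Z. f (b, c, d, Z) \<partial>lborel"]) simp
  have c: "(\<integral>\<^sup>+c. (\<integral>\<^sup>+d. \<integral>\<^sup>+Z. f (b, \<sigma> * c, d, Z) \<partial>lborel \<partial>lborel) \<partial>lborel) * x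
      = (\<integral>\<^sup>+c. (\<integral>\<^sup>+d. \<integral>\<^sup>+Z. f (b, c, d, Z) \<partial>lborel \<partial>lborel) \<partial>lborel)" for b
    unfolding x_def using \<sigma> by (rule nn_integral_complex_scale) simp
  have b: "(\<integral>\<^sup>+b. (\<integral>\<^sup>+c. \<integral>\<^sup>+d. \<integral>\<^sup>+Z. f (\<sigma> * b, c, d, Z) \<partial>lborel \<partial>lborel \<partial>lborel) \<partial>lborel) * x
      = (\<integral>\<^sup>+b. (\<integral>\<^sup>+c. \<integral>\<^sup>+d. \<integral>\<^sup>+Z. f (b, c, d, Z) \<partial>lborel \<partial>lborel \<partial>lborel) \<partial>lborel)"
    unfolding x_def using \<sigma> by (rule nn_integral_complex_scale) simp
  have "(\<integral>\<^sup>+b. \<integral>\<^sup>+c. \<integral>\<^sup>+d. \<integral>\<^sup>+Z. f (\<sigma> * b, \<sigma> * c, d + \<beta> * b * c, \<psi> *s Z) * (y * x * x) \<partial>lborel \<partial>lborel \<partial>lborel \<partial>lborel)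
    = (\<integral>\<^sup>+b. \<integral>\<^sup>+c. (\<integral>\<^sup>+d. (\<integral>\<^sup>+Z. f (\<sigma> * b, \<sigma> * c, d + \<beta> * b * c, Z) \<partial>lborel) \<partial>lborel) * (x * x) \<partial>lborel \<partial>lborel)"
  proof (intro nn_integral_cong)
    fix b c
    have "(\<integral>\<^sup>+Z. f (\<sigma> * b, \<sigma> * c, d + \<beta> * b * c, \<psi> *s Z) * (y * x * x) \<partial>lborel)
      = (\<integral>\<^sup>+Z. f (\<sigma> * b, \<sigma> * c, d + \<beta> * b * c, Z) \<partial>lborel) * (x * x)" for d
      unfolding Z[symmetric] by (subst nn_integral_multc) (simp_all add: mult.assoc)
    then show "(\<integral>\<^sup>+d. \<integral>\<^sup>+Z. f (\<sigma> * b, \<sigma> * c, d + \<beta> * b * c, \<psi> *s Z) * (y * x * x) \<partial>lborel \<partial>lborel)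
      = (\<integral>\<^sup>+d. (\<integral>\<^sup>+Z. f (\<sigma> * b, \<sigma> * c, d + \<beta> * b * c, Z) \<partial>lborel) \<partial>lborel) * (x * x)"
      by (simp add: nn_integral_multc)
  qed
  also have "\<dots> = (\<integral>\<^sup>+b. (\<integral>\<^sup>+c. \<integral>\<^sup>+d. (\<integral>\<^sup>+Z. f (\<sigma> * b, \<sigma> * c, d, Z) \<partial>lborel) \<partial>lborel \<partial>lborel) * (x * x) \<partial>lborel)"
    unfolding d by (intro nn_integral_cong nn_integral_multc) simp
  also have "\<dots> = (\<integral>\<^sup>+b. (\<integral>\<^sup>+c. \<integral>\<^sup>+d. (\<integral>\<^sup>+Z. f (\<sigma> * b, c, d, Z) \<partial>lborel) \<partial>lborel \<partial>lborel) * x \<partial>lborel)"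
    unfolding mult.assoc[symmetric] c ..
  also have "\<dots> = (\<integral>\<^sup>+b. \<integral>\<^sup>+c. \<integral>\<^sup>+d. \<integral>\<^sup>+Z. f (b, c, d, Z) \<partial>lborel \<partial>lborel \<partial>lborel \<partial>lborel)"
    unfolding b[symmetric] by (rule nn_integral_multc) simp
  finally show ?thesis unfolding xy .
qed

text \<open>
  Integrating over \<open>a\<close> last, what remains is the change of variables by a planar Moebius map.
\<close>
lemma nn_integral_moebius_map:
  fixes h :: "(complex ^ 4) \<times> (complex ^ 'm::finite) \<Rightarrow> ennreal"
  assumes \<alpha>: "\<bar>\<alpha>\<bar> < 1" and h [measurable]: "h \<in> borel_measurable borel"
    and hol: "holomorphic_map (moebius_map \<mu> \<alpha>) (inflated_lie_ball \<mu> :: ((complex ^ 4) \<times> (complex ^ 'm)) set)"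
      "holomorphic_sv (moebius_jacobian \<mu> \<alpha>) (inflated_lie_ball \<mu> :: ((complex ^ 4) \<times> (complex ^ 'm)) set)"
  shows "(\<integral>\<^sup>+p. h (moebius_map \<mu> \<alpha> p) * ennreal ((cmod (moebius_jacobian \<mu> \<alpha> p))\<^sup>2) * indicator (inflated_lie_ball \<mu>) p \<partial>lborel)
    = (\<integral>\<^sup>+p. h p * indicator (inflated_lie_ball \<mu>) p \<partial>lborel)"
proof -
  let ?U = "inflated_lie_ball \<mu> :: ((complex ^ 4) \<times> (complex ^ 'm)) set"
  have Um [measurable]: "?U \<in> sets borel" by (simp add: open_inflated_lie_ball)
  have a1: "1 - \<alpha>\<^sup>2 > 0" using \<alpha> by (simp add: abs_square_less_1)
  obtain C :: real where C: "C > 0"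
    "\<And>h :: (complex ^ 4) \<times> (complex ^ 'm) \<Rightarrow> ennreal. h \<in> borel_measurable borel \<Longrightarrow>
      (\<integral>\<^sup>+p. h p \<partial>lborel) = ennreal C * (\<integral>\<^sup>+a. \<integral>\<^sup>+b. \<integral>\<^sup>+c. \<integral>\<^sup>+d. \<integral>\<^sup>+Z. h (of_mat a b c d, Z)
        \<partial>lborel \<partial>lborel \<partial>lborel \<partial>lborel \<partial>lborel)"
    by (rule nn_integral_coords) blast
  let ?L = "\<lambda>p. h (moebius_map \<mu> \<alpha> p) * ennreal ((cmod (moebius_jacobian \<mu> \<alpha> p))\<^sup>2) * indicator ?U p"
  have Lm: "?L \<in> borel_measurable borel"
  proof -
    define \<psi> where "\<psi> p = indicator ?U p *\<^sub>R moebius_map \<mu> \<alpha> p" for p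
    have [measurable]: "\<psi> \<in> borel_measurable borel" unfolding \<psi>_def
      by (intro borel_measurable_continuous_on_indicator holomorphic_map_continuous_on hol Um)
    define w where "w p = indicator ?U p *\<^sub>R (cmod (moebius_jacobian \<mu> \<alpha> p))\<^sup>2" for p
    have [measurable]: "w \<in> borel_measurable borel" unfolding w_def
      by (intro borel_measurable_continuous_on_indicator continuous_intros holomorphic_sv_continuous_on hol Um)
    have "?L = (\<lambda>p. h (\<psi> p) * ennreal (w p) * indicator ?U p)"
      by (auto simp: \<psi>_def w_def indicator_def)
    then show ?thesis by simp
  qed
  define H :: "complex \<times> complex \<times> complex \<times> complex \<times> (complex ^ 'm) \<Rightarrow> ennreal"
    where "H = (\<lambda>x. h (of_coords x) * indicator ?U (of_coords x))"
  have om [measurable]: "of_coords \<in> borel_measurable (borel :: (complex \<times> complex \<times> complex \<times> complex \<times> (complex ^ 'm)) measure)"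
    using linear_of_coords by (intro borel_measurable_continuous_onI linear_continuous_on)
      (simp add: linear_conv_bounded_linear)
  have Hb [measurable]: "H \<in> borel_measurable borel" unfolding H_def by measurable
  have Hm [measurable]: "H \<in> borel_measurable (borel \<Otimes>\<^sub>M (borel \<Otimes>\<^sub>M (borel \<Otimes>\<^sub>M (borel \<Otimes>\<^sub>M borel))))"
    using Hb by (simp add: borel_prod)
  define G where "G a = (\<integral>\<^sup>+b. \<integral>\<^sup>+c. \<integral>\<^sup>+d. \<integral>\<^sup>+Z. H (a, b, c, d, Z) \<partial>lborel \<partial>lborel \<partial>lborel \<partial>lborel)" for a
  have Gm: "G \<in> borel_measurable borel" unfolding G_def by measurable
  have fibre: "(\<integral>\<^sup>+b. \<integral>\<^sup>+c. \<integral>\<^sup>+d. \<integral>\<^sup>+Z. ?L (of_mat a b c d, Z) \<partial>lborel \<partial>lborel \<partial>lborel \<partial>lborel)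
     = G ((a - of_real \<alpha>) / (1 - of_real \<alpha> * a)) * ennreal ((1 - \<alpha>\<^sup>2)\<^sup>2 / (cmod (1 - of_real \<alpha> * a)) ^ 4)" for a
  proof -
    define w where "w = 1 - of_real \<alpha> * a"
    define a' where "a' = (a - of_real \<alpha>) / w"
    define \<kappa> where "\<kappa> = complex_of_real (sqrt (1 - \<alpha>\<^sup>2))"
    define \<psi> where "\<psi> = moebius_factor \<mu> \<alpha> a"
    define g where "g = (1 - \<alpha>\<^sup>2)\<^sup>2 / (cmod w) ^ 4"
    show ?thesis
    proof (cases "w = 0")
      case True
      then show ?thesis unfolding w_def by (simp add: moebius_jacobian_def)
    next
      case False
      have J: "(cmod (moebius_jacobian \<mu> \<alpha> (of_mat a b c d, Z :: complex ^ 'm)))\<^sup>2 = (cmod (\<kappa> / w))\<^sup>2 * (cmod (\<kappa> / w))\<^sup>2 * cmod \<psi> ^ (2 * CARD('m)) * g" for b c d Z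
      proof -
        define X where "X = (1 - \<alpha>\<^sup>2) / (cmod w)\<^sup>2"
        have X: "(cmod (\<kappa> / w))\<^sup>2 = X"
          using a1 by (simp add: X_def \<kappa>_def norm_divide power_divide)
        have c: "cmod (complex_of_real (1 - \<alpha>\<^sup>2)) = 1 - \<alpha>\<^sup>2" using a1 by (simp only: norm_of_real abs_of_pos)
        have "cmod (moebius_jacobian \<mu> \<alpha> (of_mat a b c d, Z :: complex ^ 'm)) = X\<^sup>2 * cmod \<psi> ^ CARD('m)"
          unfolding moebius_jacobian_def fst_conv mat_of_mat w_def[symmetric] \<psi>_def[symmetric]
            norm_mult norm_power norm_divide c X_def ..
        moreover have "g = X\<^sup>2" by (simp add: g_def X_def power_divide flip: power_mult)
        ultimately show ?thesis unfolding X power_even_eq by (simp add: power2_eq_square mult_ac)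
      qed
      have L: "?L (of_mat a b c d, Z) = H (a', \<kappa> / w * b, \<kappa> / w * c, d + of_real \<alpha> / w * b * c, \<psi> *s Z)
           * ennreal ((cmod (\<kappa> / w))\<^sup>2 * (cmod (\<kappa> / w))\<^sup>2 * cmod \<psi> ^ (2 * CARD('m))) * ennreal g" for b c d Z
      proof -
        have i: "indicator ?U (of_mat a b c d, Z) = (indicator ?U (moebius_map \<mu> \<alpha> (of_mat a b c d, Z)) :: ennreal)"
          using moebius_map_in_iff[OF \<alpha> False[unfolded w_def], of \<mu> b c d Z] by (simp add: indicator_def)
        have M: "moebius_map \<mu> \<alpha> (of_mat a b c d, Z) = of_coords (a', \<kappa> / w * b, \<kappa> / w * c, d + of_real \<alpha> / w * b * c, \<psi> *s Z)"
          by (simp add: moebius_map_of_mat of_coords_def w_def a'_def \<kappa>_def \<psi>_def)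
        have "g \<ge> 0" by (simp add: g_def)
        then show ?thesis unfolding i M H_def J by (simp add: ennreal_mult mult_ac)
      qed
      have \<kappa>: "\<kappa> / w \<noteq> 0" using a1 False by (simp add: \<kappa>_def)
      have \<psi>0: "\<psi> \<noteq> 0" by (simp add: \<psi>_def moebius_factor_def)
      define f where "f = (\<lambda>y. H (a', y))"
      have f: "f \<in> borel_measurable borel" unfolding f_def by (rule measurable_slice[OF Hb])
      have fm [measurable]: "f \<in> borel_measurable (borel \<Otimes>\<^sub>M (borel \<Otimes>\<^sub>M (borel \<Otimes>\<^sub>M borel)))"
        using f by (simp add: borel_prod)
      have [measurable]: "(\<lambda>Z::complex ^ 'm. \<psi> *s Z) \<in> borel_measurable borel"
        by (intro borel_measurable_continuous_onI)
           (auto simp: vector_scalar_mult_def intro!: continuous_intros)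
      have "(\<integral>\<^sup>+b. \<integral>\<^sup>+c. \<integral>\<^sup>+d. \<integral>\<^sup>+Z. ?L (of_mat a b c d, Z) \<partial>lborel \<partial>lborel \<partial>lborel \<partial>lborel)
        = (\<integral>\<^sup>+b. \<integral>\<^sup>+c. \<integral>\<^sup>+d. \<integral>\<^sup>+Z. f (\<kappa> / w * b, \<kappa> / w * c, d + of_real \<alpha> / w * b * c, \<psi> *s Z)
           * ennreal ((cmod (\<kappa> / w))\<^sup>2 * (cmod (\<kappa> / w))\<^sup>2 * cmod \<psi> ^ (2 * CARD('m))) * ennreal g \<partial>lborel \<partial>lborel \<partial>lborel \<partial>lborel)"
        unfolding L f_def ..
      also have "\<dots> = (\<integral>\<^sup>+b. \<integral>\<^sup>+c. \<integral>\<^sup>+d. \<integral>\<^sup>+Z. f (\<kappa> / w * b, \<kappa> / w * c, d + of_real \<alpha> / w * b * c, \<psi> *s Z)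
           * ennreal ((cmod (\<kappa> / w))\<^sup>2 * (cmod (\<kappa> / w))\<^sup>2 * cmod \<psi> ^ (2 * CARD('m))) \<partial>lborel \<partial>lborel \<partial>lborel \<partial>lborel) * ennreal g"
        by (simp add: nn_integral_multc)
      also have "\<dots> = G a' * ennreal g"
        by (simp only: nn_integral_moebius_fibre[OF f \<kappa> \<psi>0]) (simp only: G_def f_def)
      finally show ?thesis by (simp add: a'_def w_def g_def)
    qed
  qed
  have "(\<integral>\<^sup>+p. ?L p \<partial>lborel) = ennreal C * (\<integral>\<^sup>+a. G ((a - of_real \<alpha>) / (1 - of_real \<alpha> * a)) * ennreal ((1 - \<alpha>\<^sup>2)\<^sup>2 / (cmod (1 - of_real \<alpha> * a)) ^ 4) \<partial>lborel)"
    unfolding C(2)[OF Lm] fibre ..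
  also have "\<dots> = ennreal C * (\<integral>\<^sup>+a. G a \<partial>lborel)"
    unfolding nn_integral_complex_moebius[OF \<alpha> Gm] ..
  also have "\<dots> = (\<integral>\<^sup>+p. h p * indicator ?U p \<partial>lborel)"
    by (subst C(2)) (simp_all add: G_def[abs_def] H_def of_coords_def)
  finally show ?thesis .
qed

lemma field_differentiable_Ln:
  "Re z > 0 \<Longrightarrow> Ln field_differentiable at z"
  by (rule field_differentiable_at_Ln) (auto simp: complex_nonpos_Reals_iff)

lemma bergman_automorphism_moebius:
  assumes \<alpha>: "\<bar>\<alpha>\<bar> < 1"
  shows "bergman_automorphism (inflated_lie_ball \<mu> :: ((complex ^ 4) \<times> (complex ^ 'm::finite)) set)
    (moebius_map \<mu> \<alpha>) (moebius_map \<mu> (- \<alpha>)) (moebius_jacobian \<mu> \<alpha>)"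
proof -
  let ?U = "inflated_lie_ball \<mu> :: ((complex ^ 4) \<times> (complex ^ 'm)) set"
  have mat: "holomorphic_sv (\<lambda>p. mat_a (fst p)) ?U" "holomorphic_sv (\<lambda>p. mat_b (fst p)) ?U"
    "holomorphic_sv (\<lambda>p. mat_c (fst p)) ?U" "holomorphic_sv (\<lambda>p. mat_d (fst p)) ?U"
    unfolding mat_defs by (intro holomorphic_sv_add holomorphic_sv_diff holomorphic_sv_mult holomorphic_sv_const holomorphic_sv_fst
      holomorphic_sv_cmult[of _ _ "-1", simplified])+
  have w: "Re (1 - of_real \<alpha> * mat_a (fst p)) > 0" if "\<bar>\<alpha>\<bar> < 1" "p \<in> ?U" for p \<alpha>
    using moebius_denominator[OF that(1) inflated_cmod_mat_a[OF that(2)]] .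
  have w0: "1 - of_real \<alpha> * mat_a (fst p) \<noteq> 0" if "\<bar>\<alpha>\<bar> < 1" "p \<in> ?U" for p \<alpha>
  proof -
    have "z \<noteq> 0" if "Re z > 0" for z using that by auto
    from this[OF w[OF that]] show ?thesis .
  qed
  have hw: "holomorphic_sv (\<lambda>p. 1 - of_real \<alpha> * mat_a (fst p)) ?U" for \<alpha>
    by (intro holomorphic_sv_diff holomorphic_sv_mult holomorphic_sv_const mat)
  have hf: "holomorphic_sv (\<lambda>p. moebius_factor \<mu> \<alpha> (mat_a (fst p))) ?U" if a: "\<bar>\<alpha>\<bar> < 1" for \<alpha>
    unfolding moebius_factor_def
  proof (rule holomorphic_sv_compose[where g = exp])
    show "holomorphic_sv (\<lambda>p. of_real \<mu> * (of_real (ln (1 - \<alpha>\<^sup>2) / 2) - Ln (1 - of_real \<alpha> * mat_a (fst p)))) ?U"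
      by (intro holomorphic_sv_mult holomorphic_sv_const holomorphic_sv_diff holomorphic_sv_compose[OF hw, where g = Ln]
          field_differentiable_Ln w a)
  qed (rule field_differentiable_within_exp)
  have hol: "holomorphic_map (moebius_map \<mu> \<alpha>) ?U" if a: "\<bar>\<alpha>\<bar> < 1" for \<alpha>
  proof (rule holomorphic_mapI)
    let ?w = "\<lambda>p::(complex ^ 4) \<times> (complex ^ 'm). 1 - of_real \<alpha> * mat_a (fst p)"
    have A: "holomorphic_sv (\<lambda>p. (mat_a (fst p) - of_real \<alpha>) / ?w p) ?U"
      by (intro holomorphic_sv_divide holomorphic_sv_diff holomorphic_sv_const mat hw w0 a)
    have B: "holomorphic_sv (\<lambda>p. of_real (sqrt (1 - \<alpha>\<^sup>2)) / ?w p * mat_b (fst p)) ?U"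
      by (intro holomorphic_sv_mult holomorphic_sv_divide holomorphic_sv_const mat hw w0 a)
    have C: "holomorphic_sv (\<lambda>p. of_real (sqrt (1 - \<alpha>\<^sup>2)) / ?w p * mat_c (fst p)) ?U"
      by (intro holomorphic_sv_mult holomorphic_sv_divide holomorphic_sv_const mat hw w0 a)
    have D: "holomorphic_sv (\<lambda>p. mat_d (fst p) + of_real \<alpha> * mat_b (fst p) * mat_c (fst p) / ?w p) ?U"
      by (intro holomorphic_sv_add holomorphic_sv_divide holomorphic_sv_mult holomorphic_sv_const mat hw w0 a)
    have fm: "fst (moebius_map \<mu> \<alpha> p) = of_mat ((mat_a (fst p) - of_real \<alpha>) / ?w p) (of_real (sqrt (1 - \<alpha>\<^sup>2)) / ?w p * mat_b (fst p))
      (of_real (sqrt (1 - \<alpha>\<^sup>2)) / ?w p * mat_c (fst p)) (mat_d (fst p) + of_real \<alpha> * mat_b (fst p) * mat_c (fst p) / ?w p)" for p :: "(complex ^ 4) \<times> (complex ^ 'm)"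
      by (simp add: moebius_map_def Let_def)
    show "holomorphic_sv (\<lambda>p. fst (moebius_map \<mu> \<alpha> p) $ i) ?U" for i
    proof -
      have "i = 1 \<or> i = 2 \<or> i = 3 \<or> i = 4" by (rule exhaust_4)
      then show ?thesis unfolding fm
        by (elim disjE; simp only: of_mat_nth; intro holomorphic_sv_divide holomorphic_sv_add[OF A D] holomorphic_sv_diff[OF A D]
          holomorphic_sv_add[OF B C] holomorphic_sv_diff[OF B C] holomorphic_sv_const; simp)
    qed
    have sm: "snd (moebius_map \<mu> \<alpha> p) $ j = moebius_factor \<mu> \<alpha> (mat_a (fst p)) * snd p $ j" for j and p :: "(complex ^ 4) \<times> (complex ^ 'm)"
      by (simp add: moebius_map_def Let_def)
    show "holomorphic_sv (\<lambda>p. snd (moebius_map \<mu> \<alpha> p) $ j) ?U" for j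
      unfolding sm by (intro holomorphic_sv_mult hf a holomorphic_sv_snd)
  qed
  have hJ: "holomorphic_sv (moebius_jacobian \<mu> \<alpha>) ?U"
    unfolding moebius_jacobian_def
    by (intro holomorphic_sv_mult holomorphic_sv_power holomorphic_sv_divide holomorphic_sv_const hw hf \<alpha> power_not_zero w0)
  have split: "p = (of_mat (mat_a (fst p)) (mat_b (fst p)) (mat_c (fst p)) (mat_d (fst p)), snd p)" for p :: "(complex ^ 4) \<times> (complex ^ 'm)"
    by simp
  have into: "moebius_map \<mu> \<alpha> p \<in> ?U" if "\<bar>\<alpha>\<bar> < 1" "p \<in> ?U" for p \<alpha>
    using moebius_map_in_iff[OF that(1) w0[OF that], of \<mu> "mat_b (fst p)" "mat_c (fst p)" "mat_d (fst p)" "snd p"] that(2) by simp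
  have inv: "moebius_map \<mu> (- \<alpha>) (moebius_map \<mu> \<alpha> p) = p" if "\<bar>\<alpha>\<bar> < 1" "p \<in> ?U" for p \<alpha>
    using moebius_map_inverse[OF that(1) inflated_cmod_mat_a[OF that(2)], of \<mu> "mat_b (fst p)" "mat_c (fst p)" "mat_d (fst p)" "snd p"] by simp
  have J0: "moebius_jacobian \<mu> \<alpha> p \<noteq> 0" if "p \<in> ?U" for p
    using w0[OF \<alpha> that] \<alpha> by (simp add: moebius_jacobian_def moebius_factor_def abs_square_eq_1 power2_eq_1_iff flip: of_real_power)
  have ma: "\<bar>- \<alpha>\<bar> < 1" using \<alpha> by simp
  show ?thesis unfolding bergman_automorphism_def
    using into[OF \<alpha>] into[OF ma] inv[OF \<alpha>] inv[OF ma] J0 hol[OF \<alpha>] hol[OF ma] hJ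
      nn_integral_moebius_map[OF \<alpha> _ hol[OF \<alpha>] hJ]
    by (simp del: split_paired_All)
qed

lemma moebius_map_kill:
  assumes "\<alpha> \<noteq> 1" "\<bar>\<alpha>\<bar> < 1"
  shows "\<exists>b' Z'. moebius_map \<mu> \<alpha> (of_mat (of_real \<alpha>) b 0 d, Z) = (of_mat 0 b' 0 d, Z') \<and> (b = 0 \<longrightarrow> b' = 0)"
  by (rule exI[of _ "of_real (sqrt (1 - \<alpha>\<^sup>2)) / (1 - of_real \<alpha> * of_real \<alpha>) * b"], rule exI)
     (simp add: moebius_map_of_mat)

lemma inflated_zero_iff: "(0, Z) \<in> inflated_lie_ball \<mu> \<longleftrightarrow> norm Z < 1"
  by (simp add: inflated_lie_ball_def lie_ball_def lie_norm_def abs_square_less_1)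

text \<open>
The unitary matrix that rotates a column to a nonnegative multiple of the first basis vector.
\<close>
lemma left_rotation_column:
  obtains x y and r :: real where "(cmod x)\<^sup>2 + (cmod y)\<^sup>2 = 1" "r \<ge> 0" "x * p + y * q = of_real r" "- cnj y * p + cnj x * q = 0"
proof (cases "p = 0 \<and> q = 0")
  case True
  then show ?thesis using that[of 1 0 0] by simp
next
  case False
  define s where "s = (cmod p)\<^sup>2 + (cmod q)\<^sup>2"
  have s: "s > 0" using False by (auto simp: s_def add_pos_nonneg add_nonneg_pos)
  define r where "r = sqrt s"
  have r: "r > 0" "r * r = s" using s by (simp_all add: r_def)
  have rr: "complex_of_real s = p * cnj p + q * cnj q" by (simp add: s_def complex_norm_square del: of_real_power)
  show ?thesis
  proof (rule that[of "cnj p / of_real r" "cnj q / of_real r" r])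
    show "(cmod (cnj p / of_real r))\<^sup>2 + (cmod (cnj q / of_real r))\<^sup>2 = 1"
    proof -
      have "r\<^sup>2 = s" using r(2) by (simp add: power2_eq_square)
      then show ?thesis
        using s by (simp add: norm_divide power_divide add_divide_distrib[symmetric] s_def[symmetric])
    qed
    show "r \<ge> 0" using r by simp
    have "cnj p / of_real r * p + cnj q / of_real r * q = of_real s / of_real r"
      by (simp add: rr add_divide_distrib mult.commute)
    also have "\<dots> = of_real r" using r by (simp flip: of_real_divide of_real_mult r(2))
    finally show "cnj p / of_real r * p + cnj q / of_real r * q = of_real r" .
    show "- cnj (cnj q / of_real r) * p + cnj (cnj p / of_real r) * q = 0" by simp
  qed
qed

text \<open>
  A unitary matrix clears \<open>c\<close>, a Moebius map clears \<open>a\<close>, a second unitary matrix clears \<open>d\<close>, exchanging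
  the columns moves the last entry to \<open>a\<close>, and a second Moebius map clears it. An isometry of the
  fibre then rotates \<open>Z\<close> to a coordinate axis.
\<close>
lemma inflated_lie_ball_transitive:
  fixes G :: "(complex ^ 4) \<times> (complex ^ 'm::finite) \<Rightarrow> bool"
  assumes closed: "\<And>\<phi> \<phi>' J q. bergman_automorphism (inflated_lie_ball \<mu>) \<phi> \<phi>' J \<Longrightarrow> q \<in> inflated_lie_ball \<mu> \<Longrightarrow> G (\<phi> q) \<Longrightarrow> G q"
    and base: "\<And>t. cmod t < 1 \<Longrightarrow> G (0, axis i0 t)"
    and q: "q \<in> inflated_lie_ball \<mu>"
  shows "G q"
proof -
  let ?U = "inflated_lie_ball \<mu> :: ((complex ^ 4) \<times> (complex ^ 'm)) set"
  have isom: "G (z, Z)" if "complex_isometry A" "\<And>z. lie_norm (A z) = lie_norm z" "complex_isometry B" "(z, Z) \<in> ?U"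
    "(A z, B Z) \<in> ?U \<Longrightarrow> G (A z, B Z)" for A B z Z
  proof -
    have aut: "bergman_automorphism ?U (\<lambda>p. (A (fst p), B (snd p))) (\<lambda>p. (inv A (fst p), inv B (snd p))) (\<lambda>_. 1)"
      by (rule bergman_automorphism_isometry[OF that(1,2,3)])
    have "(\<lambda>p. (A (fst p), B (snd p))) (z, Z) \<in> ?U"
      using aut that(4) unfolding bergman_automorphism_def by blast
    then have "(A z, B Z) \<in> ?U" by simp
    then show ?thesis using closed[OF aut that(4)] that(5) by simp
  qed
  have S1: "G (0, Z)" if Z: "(0, Z) \<in> ?U" for Z
  proof -
    obtain B t where B: "complex_isometry B" "B Z = axis i0 t" by (rule ex_complex_isometry_axis)
    show ?thesis
    proof (rule isom[OF complex_isometry_id _ B(1) Z])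
      assume "(0, B Z) \<in> ?U"
      then have "norm (axis i0 t :: complex ^ 'm) < 1" by (simp add: inflated_zero_iff B(2))
      then have "cmod t < 1"
        by (simp add: norm_eq_sqrt_inner[of "axis _ _"] inner_axis_axis flip: norm_eq_sqrt_inner)
      then show "G (0, B Z)" unfolding B(2) by (rule base)
    qed simp
  qed
  have S2: "G (of_mat (of_real \<alpha>) b 0 d, Z)"
    if U: "(of_mat (of_real \<alpha>) b 0 d, Z) \<in> ?U" and \<alpha>: "\<alpha> \<ge> 0"
      and cont: "\<And>b' Z'. (of_mat 0 b' 0 d, Z') \<in> ?U \<Longrightarrow> (b = 0 \<longrightarrow> b' = 0) \<Longrightarrow> G (of_mat 0 b' 0 d, Z')" for \<alpha> b d Z
  proof -
    have "cmod (of_real \<alpha>) < 1" using inflated_cmod_mat_a[OF U] by simp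
    then have a: "\<bar>\<alpha>\<bar> < 1" by simp
    then have "\<alpha> \<noteq> 1" by auto
    have aut: "bergman_automorphism ?U (moebius_map \<mu> \<alpha>) (moebius_map \<mu> (- \<alpha>)) (moebius_jacobian \<mu> \<alpha>)"
      by (rule bergman_automorphism_moebius[OF a])
    obtain b' Z' where bZ: "moebius_map \<mu> \<alpha> (of_mat (of_real \<alpha>) b 0 d, Z) = (of_mat 0 b' 0 d, Z')" "b = 0 \<longrightarrow> b' = 0"
      using moebius_map_kill[OF \<open>\<alpha> \<noteq> 1\<close> a, of \<mu> b d Z] by blast
    have "moebius_map \<mu> \<alpha> (of_mat (of_real \<alpha>) b 0 d, Z) \<in> ?U"
      using aut U unfolding bergman_automorphism_def by blast
    then show ?thesis using closed[OF aut U] cont bZ by simp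
  qed
  have S3: "G (of_mat 0 (of_real r) 0 0, Z)" if U: "(of_mat 0 (of_real r) 0 0, Z) \<in> ?U" "r \<ge> 0" for r Z
  proof (rule isom[OF column_swap complex_isometry_id U(1)])
    assume "(column_swap (of_mat 0 (of_real r) 0 0), Z) \<in> ?U"
    then have U': "(of_mat (of_real r) 0 0 0, Z) \<in> ?U" by (simp add: column_swap_def)
    have "G (of_mat (of_real r) 0 0 0, Z)"
      by (rule S2[OF U' U(2)]) (use S1 in \<open>simp add: of_mat_0\<close>)
    then show "G (column_swap (of_mat 0 (of_real r) 0 0), Z)" by (simp add: column_swap_def)
  qed
  have S4: "G (of_mat 0 b 0 d, Z)" if U: "(of_mat 0 b 0 d, Z) \<in> ?U" for b d Z
  proof -
    obtain x y r where xy: "(cmod x)\<^sup>2 + (cmod y)\<^sup>2 = 1" "r \<ge> 0" "x * b + y * d = of_real r" "- cnj y * b + cnj x * d = 0"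
      by (rule left_rotation_column)
    have e: "left_rotation x y (of_mat 0 b 0 d) = of_mat 0 (of_real r) 0 0"
      unfolding left_rotation_def mat_of_mat xy(3,4) by simp
    show ?thesis
      by (rule isom[OF left_rotation[OF xy(1)] complex_isometry_id U]) (use S3 xy(2) in \<open>simp add: e\<close>)
  qed
  have S5: "G (of_mat a b c d, Z)" if U: "(of_mat a b c d, Z) \<in> ?U" for a b c d Z
  proof -
    obtain x y r where xy: "(cmod x)\<^sup>2 + (cmod y)\<^sup>2 = 1" "r \<ge> 0" "x * a + y * c = of_real r" "- cnj y * a + cnj x * c = 0"
      by (rule left_rotation_column)
    obtain b' d' where e: "left_rotation x y (of_mat a b c d) = of_mat (of_real r) b' 0 d'"
      unfolding left_rotation_def mat_of_mat xy(3,4) by blast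
    show ?thesis
      by (rule isom[OF left_rotation[OF xy(1)] complex_isometry_id U]) (use S2 S4 xy(2) in \<open>simp add: e\<close>)
  qed
  show ?thesis using S5[of "mat_a (fst q)" "mat_b (fst q)" "mat_c (fst q)" "mat_d (fst q)" "snd q"] q by simp
qed

section \<open>The kernel at the base points\<close>

lemma cauchy_circle_mean:
  assumes cont: "continuous_on (cball 0 1) g" and hol: "g holomorphic_on ball 0 1"
  shows "(LINT \<theta>:{0..1}|lborel. g (exp (2 * of_real pi * \<i> * of_real \<theta>)) * cnj (exp (2 * of_real pi * \<i> * of_real \<theta>)) ^ k)
    = (deriv ^^ k) g 0 / fact k"
proof -
  define e where "e \<theta> = exp (2 * of_real pi * \<i> * of_real \<theta>)" for \<theta> :: real
  have ne: "cmod (e \<theta>) = 1" for \<theta> by (simp add: e_def norm_exp_eq_Re)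
  have ec: "e \<theta> * cnj (e \<theta>) = 1" for \<theta> using complex_norm_square[of "e \<theta>"] by (simp add: ne)
  have cp: "circlepath 0 1 \<theta> = e \<theta>" for \<theta> by (simp add: circlepath e_def)
  have "((\<lambda>u. g u / (u - 0) ^ Suc k) has_contour_integral (2 * of_real pi * \<i> / fact k) * (deriv ^^ k) g 0) (circlepath 0 1)"
    using Cauchy_has_contour_integral_higher_derivative_circlepath[OF cont hol, of 0 k] by simp
  then have "((\<lambda>\<theta>. g (e \<theta>) / (e \<theta>) ^ Suc k * vector_derivative (circlepath 0 1) (at \<theta> within {0..1})) has_integral
      (2 * of_real pi * \<i> / fact k) * (deriv ^^ k) g 0) {0..1}"
    by (simp add: has_contour_integral_def cp)
  then have "((\<lambda>\<theta>. (2 * of_real pi * \<i>) * (g (e \<theta>) * cnj (e \<theta>) ^ k)) has_integral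
      (2 * of_real pi * \<i>) * ((deriv ^^ k) g 0 / fact k)) {0..1}"
  proof (rule has_integral_eq_rhs[OF has_integral_eq[rotated]])
    fix \<theta> :: real assume t: "\<theta> \<in> {0..1}"
    have e0: "e \<theta> \<noteq> 0" by (simp add: e_def)
    have ic: "cnj (e \<theta>) = inverse (e \<theta>)" using ec[of \<theta>] e0 by (simp add: field_simps)
    have "vector_derivative (circlepath 0 1) (at \<theta> within {0..1}) = 2 * of_real pi * \<i> * e \<theta>"
      using t by (simp add: vector_derivative_circlepath01 e_def)
    then show "g (e \<theta>) / (e \<theta>) ^ Suc k * vector_derivative (circlepath 0 1) (at \<theta> within {0..1})
        = (2 * of_real pi * \<i>) * (g (e \<theta>) * cnj (e \<theta>) ^ k)"
      using e0 by (simp add: ic field_simps)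
  qed simp
  then have "((\<lambda>\<theta>. inverse (2 * of_real pi * \<i>) * ((2 * of_real pi * \<i>) * (g (e \<theta>) * cnj (e \<theta>) ^ k))) has_integral
      inverse (2 * of_real pi * \<i>) * ((2 * of_real pi * \<i>) * ((deriv ^^ k) g 0 / fact k))) {0..1}"
    by (rule has_integral_mult_right)
  then have hi: "((\<lambda>\<theta>. g (e \<theta>) * cnj (e \<theta>) ^ k) has_integral (deriv ^^ k) g 0 / fact k) {0..1}"
    by (simp add: field_simps)
  have ce: "continuous_on {0..1} e" unfolding e_def by (intro continuous_intros)
  have "continuous_on {0..1} (\<lambda>\<theta>. g (e \<theta>) * cnj (e \<theta>) ^ k)"
    by (intro continuous_intros ce continuous_on_compose2[OF cont ce]) (auto simp: ne)
  then have "set_integrable lborel {0..1} (\<lambda>\<theta>. g (e \<theta>) * cnj (e \<theta>) ^ k)"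
    unfolding set_integrable_def by (intro borel_integrable_compact) auto
  then have "(LINT \<theta>:{0..1}|lborel. g (e \<theta>) * cnj (e \<theta>) ^ k) = integral {0..1} (\<lambda>\<theta>. g (e \<theta>) * cnj (e \<theta>) ^ k)"
    by (rule set_borel_integral_eq_integral(2))
  also have "\<dots> = (deriv ^^ k) g 0 / fact k" using hi by (rule integral_unique)
  finally show ?thesis by (simp add: e_def)
qed

text \<open>
  An integral over a set does not change if the integrand is replaced by its average over a circle of
  isometries preserving the set; this is Fubini's theorem on the product with the circle.
\<close>
lemma set_integral_rotation_average:
  fixes F :: "'a::euclidean_space \<Rightarrow> complex" and \<sigma> :: "complex \<Rightarrow> 'a \<Rightarrow> 'a"
  assumes U: "U \<in> sets borel" and F: "set_integrable lborel U F"
    and lin: "\<And>u. cmod u = 1 \<Longrightarrow> linear (\<sigma> u)" and iso: "\<And>u x. cmod u = 1 \<Longrightarrow> norm (\<sigma> u x) = norm x"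
    and inv: "\<And>u x. cmod u = 1 \<Longrightarrow> \<sigma> u x \<in> U \<longleftrightarrow> x \<in> U"
    and cont: "continuous_on UNIV (\<lambda>z. \<sigma> (fst z) (snd z))"
    and mean: "\<And>x. x \<in> U \<Longrightarrow> (LINT \<theta>:{0..1}|lborel. F (\<sigma> (exp (2 * of_real pi * \<i> * of_real \<theta>)) x)) = M x"
  shows "set_integrable lborel U M" and "(LINT x:U|lborel. F x) = (LINT x:U|lborel. M x)"
proof -
  define e where "e \<theta> = exp (2 * of_real pi * \<i> * of_real \<theta>)" for \<theta> :: real
  have ne: "cmod (e \<theta>) = 1" for \<theta> by (simp add: e_def norm_exp_eq_Re)
  define G where "G x = indicator U x *\<^sub>R F x" for x
  have Gi: "integrable lborel G" using F by (simp add: G_def[abs_def] set_integrable_def)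
  then have Gm [measurable]: "G \<in> borel_measurable borel" by auto
  have sm [measurable]: "(\<lambda>(x, \<theta>). \<sigma> (e \<theta>) x) \<in> borel_measurable (lborel \<Otimes>\<^sub>M lborel)"
  proof -
    have "continuous_on UNIV (\<lambda>z::'a \<times> real. \<sigma> (fst (e (snd z), fst z)) (snd (e (snd z), fst z)))"
      by (rule continuous_on_compose2[OF cont]) (auto simp: e_def intro!: continuous_intros)
    then have "(\<lambda>z::'a \<times> real. \<sigma> (e (snd z)) (fst z)) \<in> borel_measurable borel"
      by (intro borel_measurable_continuous_onI) simp
    then show ?thesis by (simp add: lborel_prod case_prod_beta)
  qed
  define K where "K x \<theta> = indicator {0..1} \<theta> *\<^sub>R G (\<sigma> (e \<theta>) x)" for x and \<theta> :: real
  have Km [measurable]: "case_prod K \<in> borel_measurable (lborel \<Otimes>\<^sub>M lborel)"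
  proof -
    have "(\<lambda>p. G (case p of (x, \<theta>) \<Rightarrow> \<sigma> (e \<theta>) x)) \<in> borel_measurable (lborel \<Otimes>\<^sub>M lborel)"
      by (rule measurable_compose[OF sm Gm])
    then have "(\<lambda>p. indicator {0..1} (snd p) *\<^sub>R G (case p of (x, \<theta>) \<Rightarrow> \<sigma> (e \<theta>) x)) \<in> borel_measurable (lborel \<Otimes>\<^sub>M lborel)"
      by (intro borel_measurable_scaleR measurable_compose[OF measurable_snd]) auto
    moreover have "case_prod K = (\<lambda>p. indicator {0..1} (snd p) *\<^sub>R G (case p of (x, \<theta>) \<Rightarrow> \<sigma> (e \<theta>) x))"
      by (auto simp: fun_eq_iff K_def)
    ultimately show ?thesis by simp
  qed
  have Gs: "integrable lborel (\<lambda>x. G (\<sigma> (e \<theta>) x))" "(LINT x|lborel. G (\<sigma> (e \<theta>) x)) = (LINT x|lborel. G x)"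
    "(\<integral>\<^sup>+x. ennreal (norm (G (\<sigma> (e \<theta>) x))) \<partial>lborel) = (\<integral>\<^sup>+x. ennreal (norm (G x)) \<partial>lborel)" for \<theta>
  proof -
    have s1 [measurable]: "\<sigma> (e \<theta>) \<in> borel_measurable borel"
      using lin[OF ne] by (intro borel_measurable_continuous_onI linear_continuous_on)
        (simp add: linear_conv_bounded_linear)
    have d: "distr lborel borel (\<sigma> (e \<theta>)) = lborel"
    proof (rule measure_eqI)
      fix A :: "'a set" assume "A \<in> sets (distr lborel borel (\<sigma> (e \<theta>)))"
      then have A: "A \<in> sets borel" by simp
      have "emeasure (distr lborel borel (\<sigma> (e \<theta>))) A = (\<integral>\<^sup>+x. indicator A x \<partial>distr lborel borel (\<sigma> (e \<theta>)))"
        using A by simp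
      also have "\<dots> = (\<integral>\<^sup>+x. indicator A (\<sigma> (e \<theta>) x) \<partial>lborel)"
        by (rule nn_integral_distr) (use A in \<open>auto simp: borel_measurable_indicator\<close>)
      also have "\<dots> = (\<integral>\<^sup>+x. indicator A x \<partial>lborel)"
        by (rule nn_integral_isometry[OF lin[OF ne] iso[OF ne]]) (use A in \<open>simp add: borel_measurable_indicator\<close>)
      finally show "emeasure (distr lborel borel (\<sigma> (e \<theta>))) A = emeasure lborel A" using A by simp
    qed simp
    have "integrable (distr lborel borel (\<sigma> (e \<theta>))) G" using Gi d by simp
    then show "integrable lborel (\<lambda>x. G (\<sigma> (e \<theta>) x))" by (rule integrable_distr[rotated]) simp
    have "(LINT x|distr lborel borel (\<sigma> (e \<theta>)). G x) = (LINT x|lborel. G (\<sigma> (e \<theta>) x))"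
      by (rule integral_distr) auto
    then show "(LINT x|lborel. G (\<sigma> (e \<theta>) x)) = (LINT x|lborel. G x)" using d by simp
    have "(\<integral>\<^sup>+x. ennreal (norm (G x)) \<partial>distr lborel borel (\<sigma> (e \<theta>))) = (\<integral>\<^sup>+x. ennreal (norm (G (\<sigma> (e \<theta>) x))) \<partial>lborel)"
      by (rule nn_integral_distr) auto
    then show "(\<integral>\<^sup>+x. ennreal (norm (G (\<sigma> (e \<theta>) x))) \<partial>lborel) = (\<integral>\<^sup>+x. ennreal (norm (G x)) \<partial>lborel)" using d by simp
  qed
  have Ki: "integrable (lborel \<Otimes>\<^sub>M lborel) (case_prod K)"
  proof (rule integrableI_bounded)
    have nm: "(\<lambda>p. ennreal (norm (case_prod K p))) \<in> borel_measurable (lborel \<Otimes>\<^sub>M lborel)" using Km by measurable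
    have "(\<integral>\<^sup>+p. ennreal (norm (case_prod K p)) \<partial>(lborel \<Otimes>\<^sub>M lborel)) = (\<integral>\<^sup>+\<theta>. \<integral>\<^sup>+x. ennreal (norm (K x \<theta>)) \<partial>lborel \<partial>lborel)"
      by (subst lborel_pair.nn_integral_snd[OF nm, symmetric]) simp
    also have "\<dots> = (\<integral>\<^sup>+(\<theta>::real). indicator {0..1} \<theta> * (\<integral>\<^sup>+x. ennreal (norm (G x)) \<partial>lborel) \<partial>lborel)"
    proof (rule nn_integral_cong)
      fix \<theta> :: real
      show "(\<integral>\<^sup>+x. ennreal (norm (K x \<theta>)) \<partial>lborel) = indicator {0..1} \<theta> * (\<integral>\<^sup>+x. ennreal (norm (G x)) \<partial>lborel)"
        by (cases "\<theta> \<in> {0..1}") (simp_all add: K_def Gs(3))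
    qed
    also have "\<dots> = (\<integral>\<^sup>+\<theta>. indicator {0..1::real} \<theta> \<partial>lborel) * (\<integral>\<^sup>+x. ennreal (norm (G x)) \<partial>lborel)"
      by (rule nn_integral_multc) simp
    also have "\<dots> < \<infinity>" using Gi by (simp add: integrable_iff_bounded)
    finally show "(\<integral>\<^sup>+p. ennreal (norm (case_prod K p)) \<partial>(lborel \<Otimes>\<^sub>M lborel)) < \<infinity>" .
  qed (rule Km)
  have KM: "(LINT \<theta>|lborel. K x \<theta>) = indicator U x *\<^sub>R M x" for x
  proof (cases "x \<in> U")
    case True
    then have "K x \<theta> = indicator {0..1} \<theta> *\<^sub>R F (\<sigma> (e \<theta>) x)" for \<theta>
      using inv[OF ne] by (simp add: K_def G_def)
    then show ?thesis using mean[OF True] True by (simp add: set_lebesgue_integral_def e_def)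
  next
    case False
    then have "K x \<theta> = 0" for \<theta> using inv[OF ne] by (simp add: K_def G_def)
    then show ?thesis using False by simp
  qed
  have "integrable lborel (\<lambda>x. LINT \<theta>|lborel. K x \<theta>)" using lborel_pair.integrable_fst'[OF Ki] by simp
  then show "set_integrable lborel U M" by (simp add: KM set_integrable_def)
  have "(LINT x:U|lborel. M x) = (LINT x|lborel. LINT \<theta>|lborel. K x \<theta>)"
    by (simp add: KM set_lebesgue_integral_def)
  also have "\<dots> = (LINT \<theta>|lborel. LINT x|lborel. K x \<theta>)"
    by (rule lborel_pair.Fubini_integral[OF Ki, symmetric])
  also have "\<dots> = (LINT \<theta>|lborel. indicator {0..1::real} \<theta> *\<^sub>R (LINT x|lborel. G x))"
    by (intro Bochner_Integration.integral_cong refl) (simp add: K_def Gs(2))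
  also have "\<dots> = (LINT x|lborel. G x)" by simp
  finally show "(LINT x:U|lborel. F x) = (LINT x:U|lborel. M x)"
    by (simp add: set_lebesgue_integral_def G_def)
qed

text \<open>
  Rotation of all coordinates except \<open>Z\<^sub>i\<^sub>0\<close>. It is also defined for \<open>u\<close> inside the disc, where
  it contracts the domain into itself and gives the disc needed for the mean value property.
\<close>
definition partial_rotation :: "'m \<Rightarrow> complex \<Rightarrow> (complex ^ 'n) \<times> (complex ^ 'm) \<Rightarrow> (complex ^ 'n) \<times> (complex ^ 'm)" where
  "partial_rotation i0 u p = (u *s fst p, \<chi> j. if j = i0 then snd p $ j else u * snd p $ j)"

text \<open>
  With \<open>s = \<bar>u\<bar>\<^sup>2\<close>, \<open>A = \<parallel>z\<parallel>\<^sup>2\<close> and \<open>B = \<bar>z \<cdot> z\<bar>\<^sup>2\<close> the difference is \<open>(1 - s) (2 A - B (1 + s))\<close>, and \<open>B \<le> A\<^sup>2 \<le> A\<close>.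
\<close>
lemma lie_norm_contract:
  assumes "norm z < 1" "cmod u \<le> 1"
  shows "lie_norm z \<le> lie_norm (u *s z)"
proof -
  define s where "s = (cmod u)\<^sup>2"
  define A where "A = (norm z)\<^sup>2"
  define B where "B = (cmod (\<Sum>i\<in>UNIV. (z $ i)\<^sup>2))\<^sup>2"
  have s: "0 \<le> s" "s \<le> 1" using assms(2) by (simp_all add: s_def power_le_one)
  have A: "0 \<le> A" "A \<le> 1" using assms(1) by (simp_all add: A_def power_le_one)
  have "cmod (\<Sum>i\<in>UNIV. (z $ i)\<^sup>2) \<le> A"
  proof -
    have "cmod (\<Sum>i\<in>UNIV. (z $ i)\<^sup>2) \<le> (\<Sum>i\<in>UNIV. cmod ((z $ i)\<^sup>2))" by (rule norm_sum)
    then show ?thesis by (simp add: A_def norm_vec_square norm_power)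
  qed
  then have "B \<le> A\<^sup>2" unfolding B_def by (intro power_mono) auto
  also have "\<dots> \<le> A" using A by (simp add: power2_eq_square mult_left_le)
  finally have BA: "B \<le> A" .
  have B0: "0 \<le> B" by (simp add: B_def)
  have "(\<Sum>i\<in>UNIV. ((u *s z) $ i)\<^sup>2) = u\<^sup>2 * (\<Sum>i\<in>UNIV. (z $ i)\<^sup>2)"
    by (simp add: power_mult_distrib sum_distrib_left)
  then have L: "lie_norm (u *s z) = 1 - 2 * (s * A) + s\<^sup>2 * B"
    by (simp add: lie_norm_def norm_cvec_scale power_mult_distrib norm_mult norm_power s_def A_def B_def)
  moreover have "lie_norm z = 1 - 2 * A + B" by (simp add: lie_norm_def A_def B_def)
  ultimately have "lie_norm (u *s z) - lie_norm z = (1 - s) * (2 * A - B * (1 + s))"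
    by (simp add: algebra_simps power2_eq_square)
  moreover have "B * (1 + s) \<le> B * 2" using s B0 by (intro mult_left_mono) auto
  then have "0 \<le> (1 - s) * (2 * A - B * (1 + s))" using s BA by (intro mult_nonneg_nonneg) auto
  ultimately show ?thesis by linarith
qed

lemma inflated_contract:
  assumes p: "(z, Z) \<in> inflated_lie_ball \<mu>" and mu: "\<mu> > 0" and u: "cmod u \<le> 1" and Z': "norm Z' \<le> norm Z"
  shows "(u *s z, Z') \<in> inflated_lie_ball \<mu>"
proof -
  have z: "norm z < 1" "lie_norm z > 0" "(norm Z)\<^sup>2 < lie_norm z powr \<mu>"
    using p by (auto simp: inflated_lie_ball_def lie_ball_def)
  have l: "lie_norm z \<le> lie_norm (u *s z)" by (rule lie_norm_contract[OF z(1) u])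
  have "norm (u *s z) \<le> 1 * norm z" unfolding norm_cvec_scale using u by (intro mult_right_mono) auto
  then have 1: "norm (u *s z) < 1" using z(1) by simp
  have "(norm Z')\<^sup>2 \<le> (norm Z)\<^sup>2" using Z' by (intro power_mono) auto
  also have "\<dots> < lie_norm z powr \<mu>" by (rule z(3))
  also have "\<dots> \<le> lie_norm (u *s z) powr \<mu>" using l z(2) mu by (intro powr_mono2) auto
  finally show ?thesis using 1 l z(2) by (auto simp: inflated_lie_ball_def lie_ball_def)
qed

lemma partial_rotation_norm:
  "cmod u \<le> 1 \<Longrightarrow> norm (snd (partial_rotation i0 u p)) \<le> norm (snd p)"
  "cmod u = 1 \<Longrightarrow> norm (partial_rotation i0 u p) = norm p"
proof -
  show "norm (snd (partial_rotation i0 u p)) \<le> norm (snd p)" if u: "cmod u \<le> 1"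
  proof (rule power2_le_imp_le)
    have "(cmod (u * x))\<^sup>2 \<le> (cmod x)\<^sup>2" for x
      using mult_right_mono[OF u, of "cmod x"] by (intro power_mono) (auto simp: norm_mult)
    then show "(norm (snd (partial_rotation i0 u p)))\<^sup>2 \<le> (norm (snd p))\<^sup>2"
      unfolding norm_vec_square by (intro sum_mono) (auto simp: partial_rotation_def)
  qed simp
  show "norm (partial_rotation i0 u p) = norm p" if u: "cmod u = 1"
  proof -
    have "(norm (snd (partial_rotation i0 u p)))\<^sup>2 = (norm (snd p))\<^sup>2"
      unfolding norm_vec_square using u by (intro sum.cong) (auto simp: partial_rotation_def norm_mult)
    then show ?thesis using u by (simp add: norm_prod_def) (simp add: partial_rotation_def norm_cvec_scale)
  qed
qed

lemma partial_rotation_in: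
  assumes "\<mu> > 0" "cmod u \<le> 1" "p \<in> inflated_lie_ball \<mu>"
  shows "partial_rotation i0 u p \<in> inflated_lie_ball \<mu>"
proof -
  have "(u *s fst p, snd (partial_rotation i0 u p)) \<in> inflated_lie_ball \<mu>"
    using assms(3) by (intro inflated_contract[OF _ assms(1,2) partial_rotation_norm(1)[OF assms(2)]]) simp
  then show ?thesis by (simp add: partial_rotation_def)
qed

lemma partial_rotation_0: "partial_rotation i0 0 p = (0, axis i0 (snd p $ i0))"
  by (simp add: partial_rotation_def vec_eq_iff axis_def)

lemma holomorphic_slice:
  assumes f: "holomorphic_sv f U" and S: "open S" and in_U: "\<And>u. u \<in> S \<Longrightarrow> q + cscale u v \<in> U"
  shows "(\<lambda>u. f (q + cscale u v)) holomorphic_on S"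
  unfolding holomorphic_on_open[OF S]
proof (intro ballI)
  fix u assume u: "u \<in> S"
  obtain D where D: "(f has_derivative D) (at (q + cscale u v))" "\<forall>c v. D (cscale c v) = c * D v"
    using f in_U[OF u] unfolding holomorphic_sv_def by meson
  have "bounded_linear (\<lambda>u. cscale u v)"
    unfolding linear_conv_bounded_linear[symmetric]
    by (auto simp: linear_iff prod_eq_iff vec_eq_iff algebra_simps)
  from has_derivative_add[OF has_derivative_const bounded_linear_imp_has_derivative[OF this]]
  have "((\<lambda>u. q + cscale u v) has_derivative (\<lambda>u. cscale u v)) (at u)" by simp
  from has_derivative_compose[OF this D(1)]
  have "((\<lambda>u. f (q + cscale u v)) has_derivative (\<lambda>u. u * D v)) (at u)" using D(2) by simp
  then show "\<exists>f'. ((\<lambda>u. f (q + cscale u v)) has_field_derivative f') (at u)"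
    by (intro exI[of _ "D v"]) (simp add: has_field_derivative_def mult.commute[of _ "D v"])
qed

lemma inflated_bounded:
  fixes p :: "(complex ^ 'n::finite) \<times> (complex ^ 'm::finite)"
  assumes p: "p \<in> inflated_lie_ball \<mu>" and mu: "\<mu> > 0"
  shows "norm (fst p) < 1 \<and> norm (snd p) < 1"
proof -
  have "(0 *s fst p, snd p) \<in> inflated_lie_ball \<mu>"
    using inflated_contract[of "fst p" "snd p" \<mu> 0 "snd p"] p mu by simp
  moreover have "0 *s fst p = 0" by (simp add: vec_eq_iff)
  ultimately have "(0 :: complex ^ 'n, snd p) \<in> inflated_lie_ball \<mu>" by simp
  then have "norm (snd p) < 1" by (simp only: inflated_zero_iff)
  then show ?thesis using p by (auto simp: inflated_lie_ball_def lie_ball_def)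
qed

lemma inflated_axis_in:
  assumes "cmod x < 1"
  shows "(0, axis i0 x) \<in> inflated_lie_ball \<mu>"
  using assms by (simp add: inflated_zero_iff norm_eq_sqrt_inner[of "axis _ _"] inner_axis_axis flip: norm_eq_sqrt_inner)

lemma holomorphic_axis_slice:
  fixes f :: "(complex ^ 'n::finite) \<times> (complex ^ 'm::finite) \<Rightarrow> complex"
  assumes f: "holomorphic_sv f (inflated_lie_ball \<mu>)"
  shows "(\<lambda>x. f (0, axis i0 x)) holomorphic_on ball 0 1"
proof -
  have e: "(0 :: (complex ^ 'n) \<times> (complex ^ 'm)) + cscale x (0, axis i0 1) = (0, axis i0 x)" for x
    by (simp add: prod_eq_iff vec_eq_iff axis_def)
  have "(\<lambda>x. f (0 + cscale x (0, axis i0 1))) holomorphic_on ball 0 1"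
    by (rule holomorphic_slice[OF f open_ball], unfold e) (auto intro: inflated_axis_in)
  then show ?thesis unfolding e .
qed

lemma emeasure_inflated_finite:
  assumes mu: "\<mu> > 0"
  shows "emeasure lborel (inflated_lie_ball \<mu> :: ((complex ^ 'n::finite) \<times> (complex ^ 'm::finite)) set) < \<infinity>"
proof -
  let ?U = "inflated_lie_ball \<mu> :: ((complex ^ 'n) \<times> (complex ^ 'm)) set"
  have "?U \<subseteq> ball 0 2"
  proof
    fix p assume "p \<in> ?U"
    then have "norm (fst p) < 1" "norm (snd p) < 1" using inflated_bounded mu by blast+
    then have "norm p < 2" using norm_Pair_le[of "fst p" "snd p"] by simp
    then show "p \<in> ball 0 2" by simp
  qed
  then have "emeasure lborel ?U \<le> emeasure lborel (ball (0 :: (complex ^ 'n) \<times> (complex ^ 'm)) 2)" by (intro emeasure_mono) auto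
  also have "\<dots> < \<infinity>" by (simp add: emeasure_ball)
  finally show ?thesis .
qed

lemma bounded_in_bergman_space:
  fixes f :: "(complex ^ 'n::finite) \<times> (complex ^ 'm::finite) \<Rightarrow> complex"
  assumes mu: "\<mu> > 0" and f: "holomorphic_sv f (inflated_lie_ball \<mu>)"
    and B: "\<And>p. p \<in> inflated_lie_ball \<mu> \<Longrightarrow> cmod (f p) \<le> B"
  shows "f \<in> bergman_space (inflated_lie_ball \<mu>)"
proof -
  let ?U = "inflated_lie_ball \<mu> :: ((complex ^ 'n) \<times> (complex ^ 'm)) set"
  have m: "(\<lambda>p. indicator ?U p *\<^sub>R (cmod (f p))\<^sup>2) \<in> borel_measurable borel"
    using f by (intro borel_measurable_continuous_on_indicator continuous_intros holomorphic_sv_continuous_on)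
      (auto simp: open_inflated_lie_ball)
  have i: "integrable lborel (\<lambda>p. indicator ?U p *\<^sub>R B\<^sup>2)"
    using emeasure_inflated_finite[OF mu] by (intro integrable_scaleR_left integrable_real_indicator)
      (auto simp: open_inflated_lie_ball)
  have "integrable lborel (\<lambda>p. indicator ?U p *\<^sub>R (cmod (f p))\<^sup>2)"
  proof (rule Bochner_Integration.integrable_bound[OF i])
    have "(cmod (f p))\<^sup>2 \<le> B\<^sup>2" if "p \<in> ?U" for p using B[OF that] by (intro power_mono) auto
    then show "AE p in lborel. norm (indicator ?U p *\<^sub>R (cmod (f p))\<^sup>2) \<le> norm (indicator ?U p *\<^sub>R B\<^sup>2)"
      by (intro AE_I2) (auto simp: indicator_def)
  qed (use m in simp)
  then show ?thesis using f by (simp add: bergman_space_def set_integrable_def)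
qed

text \<open>
  Averaging over the rotations that fix \<open>Z\<^sub>i\<^sub>0\<close> replaces \<open>f\<close> by its restriction to the axis, by the
  mean value property. Averaging over the rotations of all coordinates then extracts the \<open>k\<close>-th
  Taylor coefficient of this restriction.
\<close>
lemma bergman_moment:
  fixes \<mu> :: real and f :: "(complex ^ 'n::finite) \<times> (complex ^ 'm::finite) \<Rightarrow> complex"
  defines "U \<equiv> inflated_lie_ball \<mu> :: ((complex ^ 'n) \<times> (complex ^ 'm)) set"
  assumes mu: "\<mu> > 0" and f: "f \<in> bergman_space U"
  shows "(LINT p:U|lborel. f p * cnj (snd p $ i0) ^ k)
    = (deriv ^^ k) (\<lambda>x. f (0, axis i0 x)) 0 / fact k * (LINT p:U|lborel. of_real ((cmod (snd p $ i0)) ^ (2 * k)))"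
proof -
  let ?U = "inflated_lie_ball \<mu> :: ((complex ^ 'n) \<times> (complex ^ 'm)) set"
  note f = f[unfolded U_def]
  have Uo: "open ?U" by (rule open_inflated_lie_ball)
  have Um: "?U \<in> sets borel" using Uo by simp
  have fh: "holomorphic_sv f ?U" using f by (simp add: bergman_space_def)
  define g where "g x = f (0, axis i0 x)" for x
  have comp1: "cmod (snd p $ i0) < 1" if "p \<in> ?U" for p
    using inflated_bounded[OF that mu] Finite_Cartesian_Product.norm_nth_le[of "snd p" i0] by linarith
  have gh: "g holomorphic_on ball 0 1" unfolding g_def by (rule holomorphic_axis_slice[OF fh])
  have Fi: "set_integrable lborel ?U (\<lambda>p. f p * cnj ((snd p $ i0) ^ k))"
  proof (rule bergman_mult_integrable[OF Uo f bounded_in_bergman_space[OF mu]])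
    show "holomorphic_sv (\<lambda>p. snd p $ i0 ^ k) ?U" by (intro holomorphic_sv_power holomorphic_sv_snd)
    show "cmod (snd p $ i0 ^ k) \<le> 1" if "p \<in> ?U" for p
      using comp1[OF that] by (simp add: norm_power power_le_one)
  qed
  have m1: "(LINT \<theta>:{0..1}|lborel. f (partial_rotation i0 (exp (2 * of_real pi * \<i> * of_real \<theta>)) p)
       * cnj ((snd (partial_rotation i0 (exp (2 * of_real pi * \<i> * of_real \<theta>)) p) $ i0) ^ k)) = g (snd p $ i0) * cnj ((snd p $ i0) ^ k)"
    if p: "p \<in> ?U" for p
  proof -
    define h where "h u = f (partial_rotation i0 u p)" for u
    define q where "q = (0 :: complex ^ 'n, axis i0 (snd p $ i0))"
    define v where "v = (fst p, snd p - axis i0 (snd p $ i0))"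
    have e: "partial_rotation i0 u p = q + cscale u v" for u
      by (simp add: partial_rotation_def q_def v_def prod_eq_iff vec_eq_iff axis_def)
    have hh: "h holomorphic_on ball 0 1" unfolding h_def e
      by (rule holomorphic_slice[OF fh open_ball]) (use partial_rotation_in[OF mu _ p] in \<open>simp flip: e\<close>)
    have hc: "continuous_on (cball 0 1) h"
    proof -
      have "continuous_on UNIV (\<lambda>u. q + cscale u v)"
        unfolding cscale_def vector_scalar_mult_def by (intro continuous_intros)
      then have "continuous_on (cball 0 1) (\<lambda>u. q + cscale u v)" by (rule continuous_on_subset) simp
      then show ?thesis unfolding h_def e
        by (rule continuous_on_compose2[OF holomorphic_sv_continuous_on[OF fh]])
          (use partial_rotation_in[OF mu _ p] in \<open>auto simp flip: e\<close>)
    qed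
    have "(LINT \<theta>:{0..1}|lborel. h (exp (2 * of_real pi * \<i> * of_real \<theta>))) = h 0"
      using cauchy_circle_mean[OF hc hh, of 0] by simp
    also have "h 0 = g (snd p $ i0)" by (simp add: h_def partial_rotation_0 g_def)
    finally have "(LINT \<theta>:{0..1}|lborel. h (exp (2 * of_real pi * \<i> * of_real \<theta>)) * cnj ((snd p $ i0) ^ k)) = g (snd p $ i0) * cnj ((snd p $ i0) ^ k)"
      by (simp add: set_integral_mult_left)
    moreover have "snd (partial_rotation i0 u p) $ i0 = snd p $ i0" for u by (simp add: partial_rotation_def)
    ultimately show ?thesis by (simp add: h_def)
  qed
  have lin1: "linear (partial_rotation i0 u :: (complex ^ 'n) \<times> (complex ^ 'm) \<Rightarrow> _)" for u
    by (auto simp: linear_iff partial_rotation_def vec_eq_iff algebra_simps)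
  have in1: "partial_rotation i0 u p \<in> ?U \<longleftrightarrow> p \<in> ?U" if u: "cmod u = 1" for u p
  proof
    assume "partial_rotation i0 u p \<in> ?U"
    then have "partial_rotation i0 (cnj u) (partial_rotation i0 u p) \<in> ?U"
      by (rule partial_rotation_in[OF mu, rotated]) (use u in simp)
    moreover have "cnj u * u = 1" using complex_norm_square[of u] u by (simp add: mult.commute)
    then have "partial_rotation i0 (cnj u) (partial_rotation i0 u p) = p"
      by (simp add: partial_rotation_def prod_eq_iff vec_eq_iff mult.assoc[symmetric])
    ultimately show "p \<in> ?U" by simp
  next
    assume "p \<in> ?U"
    then show "partial_rotation i0 u p \<in> ?U" by (rule partial_rotation_in[OF mu, rotated]) (use u in simp)
  qed
  have cont1: "continuous_on UNIV (\<lambda>z. partial_rotation i0 (fst z) (snd z) :: (complex ^ 'n) \<times> (complex ^ 'm))"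
  proof -
    have "continuous_on UNIV (\<lambda>z::complex \<times> (complex ^ 'n) \<times> (complex ^ 'm).
        if j = i0 then snd (snd z) $ j else fst z * snd (snd z) $ j)" for j
      by (cases "j = i0") (auto intro!: continuous_intros)
    then show ?thesis
      unfolding partial_rotation_def vector_scalar_mult_def by (intro continuous_intros)
  qed
  note av1 = set_integral_rotation_average[OF Um Fi lin1 partial_rotation_norm(2) in1 cont1 m1]
  define F2 where "F2 p = g (snd p $ i0) * cnj ((snd p $ i0) ^ k)" for p :: "(complex ^ 'n) \<times> (complex ^ 'm)"
  have F2i: "set_integrable lborel ?U F2" unfolding F2_def[abs_def] by (rule av1(1)) auto
  have I1: "(LINT p:?U|lborel. f p * cnj ((snd p $ i0) ^ k)) = (LINT p:?U|lborel. F2 p)"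
    unfolding F2_def by (rule av1(2)) auto
  define a where "a = (deriv ^^ k) g 0 / fact k"
  have m2: "(LINT \<theta>:{0..1}|lborel. F2 (cscale (exp (2 * of_real pi * \<i> * of_real \<theta>)) p)) = a * of_real ((cmod (snd p $ i0)) ^ (2 * k))"
    if p: "p \<in> ?U" for p
  proof -
    define x where "x = snd p $ i0"
    have x: "cmod x < 1" using comp1[OF p] by (simp add: x_def)
    have xin: "cmod (x * u) < 1" if "cmod u \<le> 1" for u
    proof -
      have "cmod x * cmod u \<le> cmod x * 1" using that by (intro mult_left_mono) auto
      then show ?thesis using x by (simp add: norm_mult)
    qed
    have hc: "continuous_on (cball 0 1) (\<lambda>u. g (x * u))"
      by (rule continuous_on_compose2[OF holomorphic_on_imp_continuous_on[OF gh]]) (auto intro!: continuous_intros simp: xin)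
    have hh: "(\<lambda>u. g (x * u)) holomorphic_on ball 0 1"
    proof -
      have "(g \<circ> (\<lambda>u. x * u)) holomorphic_on ball 0 1"
        by (rule holomorphic_on_compose_gen[OF _ gh]) (auto intro!: holomorphic_intros simp: xin)
      then show ?thesis by (simp add: o_def)
    qed
    have "(LINT \<theta>:{0..1}|lborel. g (x * exp (2 * of_real pi * \<i> * of_real \<theta>)) * cnj (exp (2 * of_real pi * \<i> * of_real \<theta>)) ^ k)
       = (deriv ^^ k) (\<lambda>u. g (x * u)) 0 / fact k" by (rule cauchy_circle_mean[OF hc hh])
    also have "(deriv ^^ k) (\<lambda>u. g (x * u)) 0 = x ^ k * (deriv ^^ k) g (x * 0)"
      by (rule higher_deriv_compose_linear[OF gh, of "ball 0 1"]) (auto simp: xin)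
    finally have "(LINT \<theta>:{0..1}|lborel. (g (x * exp (2 * of_real pi * \<i> * of_real \<theta>)) * cnj (exp (2 * of_real pi * \<i> * of_real \<theta>)) ^ k) * cnj x ^ k)
       = a * (x ^ k * cnj x ^ k)" by (simp add: set_integral_mult_left a_def mult_ac)
    also have "x ^ k * cnj x ^ k = of_real ((cmod x) ^ (2 * k))"
      by (simp only: power_mult_distrib[symmetric] complex_norm_square[symmetric] of_real_power power_mult)
    finally show ?thesis by (simp add: F2_def x_def mult_ac power_mult_distrib)
  qed
  have cs_norm: "norm (cscale u p) = norm p" if "cmod u = 1" for u and p :: "(complex ^ 'n) \<times> (complex ^ 'm)"
    using that by (simp add: norm_prod_def cscale_def norm_cvec_scale)
  have lin2: "linear (cscale u :: (complex ^ 'n) \<times> (complex ^ 'm) \<Rightarrow> _)" for u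
    by (auto simp: linear_iff cscale_def vec_eq_iff algebra_simps)
  have cs_in: "cscale u p \<in> ?U" if u: "cmod u = 1" "p \<in> ?U" for u p
    using inflated_contract[of "fst p" "snd p" \<mu> u "u *s snd p"] that mu by (simp add: cscale_def norm_cvec_scale)
  have in2: "cscale u p \<in> ?U \<longleftrightarrow> p \<in> ?U" if u: "cmod u = 1" for u p
  proof
    assume "cscale u p \<in> ?U"
    then have "cscale (cnj u) (cscale u p) \<in> ?U" by (rule cs_in[rotated]) (use u in simp)
    moreover have "cnj u * u = 1" using complex_norm_square[of u] u by (simp add: mult.commute)
    then have "cscale (cnj u) (cscale u p) = p" by (simp add: cscale_def vector_smult_assoc)
    ultimately show "p \<in> ?U" by simp
  qed (rule cs_in[OF u])
  have cont2: "continuous_on UNIV (\<lambda>z. cscale (fst z) (snd z) :: (complex ^ 'n) \<times> (complex ^ 'm))"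
    unfolding cscale_def vector_scalar_mult_def by (intro continuous_intros)
  have "(LINT p:?U|lborel. F2 p) = (LINT p:?U|lborel. a * of_real ((cmod (snd p $ i0)) ^ (2 * k)))"
    by (rule set_integral_rotation_average(2)[OF Um F2i lin2 cs_norm in2 cont2 m2]) auto
  also have "\<dots> = a * (LINT p:?U|lborel. of_real ((cmod (snd p $ i0)) ^ (2 * k)))"
    by (simp add: set_integral_mult_right)
  finally show ?thesis using I1 by (simp add: a_def g_def[abs_def] U_def)
qed

text \<open>
  Integrating against the power series termwise gives the Taylor series of \<open>f\<close> along the axis at \<open>t\<close>,
  by \<open>bergman_moment\<close>. The series of absolute values converges since \<open>\<bar>t\<bar> < 1\<close>.
\<close>
lemma reproduces_at_base:
  fixes i0 :: "'m::finite" and \<mu> :: real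
  defines "U \<equiv> inflated_lie_ball \<mu> :: ((complex ^ 'n::finite) \<times> (complex ^ 'm)) set"
  assumes mu: "\<mu> > 0"
    and M: "\<And>k. (\<integral>\<^sup>+p. ennreal ((cmod (snd p $ i0)) ^ (2 * k)) * indicator U p \<partial>lborel) = ennreal (M k)" "\<And>k. M k > 0"
    and G: "\<And>x. cmod x < 1 \<Longrightarrow> summable (\<lambda>k. norm (x ^ k / of_real (M k)))"
      "\<And>x. cmod x < 1 \<Longrightarrow> (\<lambda>k. x ^ k / of_real (M k)) sums G x"
    and t: "cmod t < 1"
  shows "reproduces_at U (0, axis i0 t) (\<lambda>p. G (cnj t * snd p $ i0))"
proof -
  have Uo: "open U" unfolding U_def by (rule open_inflated_lie_ball)
  have Gh: "G holomorphic_on ball 0 1"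
    by (rule power_series_holomorphic[where a = "\<lambda>k. 1 / of_real (M k)"]) (use G(2) in simp)
  have comp1: "cmod (snd p $ i0) < 1" if "p \<in> U" for p
    using inflated_bounded[OF that[unfolded U_def] mu] Finite_Cartesian_Product.norm_nth_le[of "snd p" i0] by linarith
  have tx: "cmod (cnj t * x) \<le> cmod t" if "cmod x < 1" for x
    using mult_left_mono[of "cmod x" 1 "cmod t"] that by (simp add: norm_mult)
  define K where "K p = G (cnj t * snd p $ i0)" for p :: "(complex ^ 'n) \<times> (complex ^ 'm)"
  have Kh: "holomorphic_sv K U" unfolding K_def
  proof (rule holomorphic_sv_compose[where g = G])
    show "holomorphic_sv (\<lambda>p. cnj t * snd p $ i0) U" by (intro holomorphic_sv_mult holomorphic_sv_const holomorphic_sv_snd)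
    show "G field_differentiable at (cnj t * snd p $ i0)" if "p \<in> U" for p
      using holomorphic_on_imp_differentiable_at[OF Gh open_ball] tx[OF comp1[OF that]] t by simp
  qed
  define S where "S = (\<Sum>k. norm (t ^ k / of_real (M k) :: complex))"
  have term_le: "norm (x ^ k / of_real (M k) :: complex) \<le> norm (t ^ k / of_real (M k) :: complex)" if "cmod x \<le> cmod t" for x k
    using that M(2)[of k] by (simp add: norm_divide norm_power divide_right_mono power_mono)
  have Kb: "cmod (K p) \<le> S" if p: "p \<in> U" for p
  proof -
    let ?x = "cnj t * snd p $ i0"
    have x: "cmod ?x \<le> cmod t" using tx[OF comp1[OF p]] .
    have x1: "cmod ?x < 1" using x t by linarith
    have "K p = (\<Sum>k. ?x ^ k / of_real (M k))" using G(2)[OF x1] by (simp add: K_def sums_iff)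
    also have "norm \<dots> \<le> (\<Sum>k. norm (?x ^ k / of_real (M k)))" by (rule summable_norm[OF G(1)[OF x1]])
    also have "\<dots> \<le> S" unfolding S_def by (rule suminf_le[OF term_le[OF x] G(1)[OF x1] G(1)[OF t]])
    finally show ?thesis .
  qed
  have Ks: "K \<in> bergman_space U" using Kh Kb unfolding U_def by (intro bounded_in_bergman_space[OF mu]) auto
  moreover have "f (0, axis i0 t) = (LINT p:U|lborel. f p * cnj (K p))" if f: "f \<in> bergman_space U" for f
  proof -
    have fh: "holomorphic_sv f U" using f by (simp add: bergman_space_def)
    have one: "(\<lambda>p. 1) \<in> bergman_space U" unfolding U_def
      by (rule bounded_in_bergman_space[OF mu holomorphic_sv_const, of _ 1]) simp
    have fi: "set_integrable lborel U f" using bergman_mult_integrable[OF Uo f one] by simp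
    define g where "g x = f (0, axis i0 x)" for x
    have gh: "g holomorphic_on ball 0 1" unfolding g_def
      by (rule holomorphic_axis_slice[OF fh[unfolded U_def]])
    define a where "a k = (deriv ^^ k) g 0 / fact k" for k
    have "(\<lambda>k. (deriv ^^ k) g 0 / fact k * (t - 0) ^ k) sums g t"
      by (rule holomorphic_power_series[OF gh]) (use t in simp)
    then have gs: "(\<lambda>k. a k * t ^ k) sums g t" by (simp add: a_def)
    define c where "c k = t ^ k / of_real (M k)" for k
    have MM: "(LINT p:U|lborel. complex_of_real ((cmod (snd p $ i0)) ^ (2 * k))) = of_real (M k)" for k
    proof -
      have "(LINT p:U|lborel. (cmod (snd p $ i0)) ^ (2 * k)) = enn2real (\<integral>\<^sup>+p. ennreal (indicator U p * (cmod (snd p $ i0)) ^ (2 * k)) \<partial>lborel)"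
        unfolding set_lebesgue_integral_def real_scaleR_def
      proof (rule integral_eq_nn_integral)
        have "(\<lambda>p. indicator U p *\<^sub>R (cmod (snd p $ i0)) ^ (2 * k)) \<in> borel_measurable borel"
          using Uo by (intro borel_measurable_continuous_on_indicator continuous_intros) auto
        then show "(\<lambda>p. indicator U p * (cmod (snd p $ i0)) ^ (2 * k)) \<in> borel_measurable lborel" by simp
      qed (auto simp: indicator_def)
      also have "(\<integral>\<^sup>+p. ennreal (indicator U p * (cmod (snd p $ i0)) ^ (2 * k)) \<partial>lborel) = ennreal (M k)"
        unfolding M(1)[symmetric] by (intro nn_integral_cong) (auto simp: indicator_def)
      finally have "(LINT p:U|lborel. (cmod (snd p $ i0)) ^ (2 * k)) = M k" using M(2)[of k] by simp
      moreover have "(LINT p:U|lborel. complex_of_real ((cmod (snd p $ i0)) ^ (2 * k))) = of_real (LINT p:U|lborel. (cmod (snd p $ i0)) ^ (2 * k))"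
        unfolding set_lebesgue_integral_def by (subst integral_complex_of_real[symmetric]) (simp add: scaleR_conv_of_real)
      ultimately show ?thesis by simp
    qed
    have mom: "(LINT p:U|lborel. f p * cnj (snd p $ i0) ^ k) = a k * of_real (M k)" for k
    proof -
      have "(LINT p:U|lborel. f p * cnj (snd p $ i0) ^ k) = a k * (LINT p:U|lborel. complex_of_real ((cmod (snd p $ i0)) ^ (2 * k)))"
        unfolding U_def a_def g_def[abs_def] by (rule bergman_moment[OF mu f[unfolded U_def]])
      then show ?thesis unfolding MM .
    qed
    define T where "T k p = indicator U p *\<^sub>R (f p * (c k * cnj (snd p $ i0) ^ k))" for k p
    have Tn: "norm (T k p) \<le> norm (c k) * norm (indicator U p *\<^sub>R f p)" for k p
    proof (cases "p \<in> U")
      case True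
      then have "cmod (snd p $ i0) ^ k \<le> 1" using comp1[OF True] by (simp add: power_le_one)
      then have "cmod (f p) * cmod (c k) * cmod (snd p $ i0) ^ k \<le> cmod (f p) * cmod (c k) * 1"
        by (intro mult_left_mono) auto
      then show ?thesis using True by (simp add: T_def norm_mult norm_power mult_ac)
    qed (simp add: T_def)
    have fi': "integrable lborel (\<lambda>p. indicator U p *\<^sub>R f p)" using fi by (simp add: set_integrable_def)
    have Ti: "integrable lborel (T k)" for k
    proof (rule Bochner_Integration.integrable_bound)
      show "integrable lborel (\<lambda>p. norm (c k) * norm (indicator U p *\<^sub>R f p))" using fi' by (intro integrable_mult_right integrable_norm)
      have "continuous_on U (\<lambda>p. f p * (c k * cnj (snd p $ i0) ^ k))"
        by (intro continuous_intros holomorphic_sv_continuous_on[OF fh])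
      then show "T k \<in> borel_measurable lborel" unfolding T_def[abs_def] using Uo
        by (simp add: borel_measurable_continuous_on_indicator)
    qed (use Tn in \<open>auto intro!: AE_I2 order_trans[OF Tn]\<close>)
    have cs: "summable (\<lambda>k. norm (c k))" using G(1)[OF t] by (simp add: c_def)
    have "(LINT p:U|lborel. f p * cnj (K p)) = (LINT p|lborel. (\<Sum>k. T k p))"
      unfolding set_lebesgue_integral_def
    proof (rule Bochner_Integration.integral_cong[OF refl])
      fix p
      show "indicator U p *\<^sub>R (f p * cnj (K p)) = (\<Sum>k. T k p)"
      proof (cases "p \<in> U")
        case True
        let ?x = "cnj t * snd p $ i0"
        have x1: "cmod ?x < 1" using tx[OF comp1[OF True]] t by linarith
        have "(\<lambda>k. cnj (?x ^ k / of_real (M k))) sums cnj (G ?x)" using G(2)[OF x1] by (simp only: sums_cnj)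
        then have "(\<lambda>k. f p * cnj (?x ^ k / of_real (M k))) sums (f p * cnj (K p))" unfolding K_def by (rule sums_mult)
        moreover have "f p * cnj (?x ^ k / of_real (M k)) = T k p" for k
          using True by (simp add: T_def c_def power_mult_distrib)
        ultimately show ?thesis using True by (simp add: sums_iff)
      qed (simp add: T_def)
    qed
    also have "\<dots> = (\<Sum>k. LINT p|lborel. T k p)"
    proof (rule integral_suminf[OF Ti])
      show "AE p in lborel. summable (\<lambda>k. norm (T k p))"
      proof (rule AE_I2)
        fix p show "summable (\<lambda>k. norm (T k p))"
          by (rule summable_comparison_test'[OF summable_mult2[OF cs, of "norm (indicator U p *\<^sub>R f p)"], of 0]) (use Tn in simp)
      qed
      show "summable (\<lambda>k. LINT p|lborel. norm (T k p))"
      proof (rule summable_comparison_test'[OF summable_mult2[OF cs, of "LINT p|lborel. norm (indicator U p *\<^sub>R f p)"], of 0])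
        fix k :: nat
        have "(LINT p|lborel. norm (T k p)) \<le> (LINT p|lborel. norm (c k) * norm (indicator U p *\<^sub>R f p))"
          using Ti fi' Tn by (intro integral_mono integrable_norm integrable_mult_right) auto
        also have "\<dots> = norm (c k) * (LINT p|lborel. norm (indicator U p *\<^sub>R f p))" by simp
        finally show "norm (LINT p|lborel. norm (T k p)) \<le> norm (c k) * (LINT p|lborel. norm (indicator U p *\<^sub>R f p))"
          by simp
      qed
    qed
    also have "(\<lambda>k. LINT p|lborel. T k p) = (\<lambda>k. a k * t ^ k)"
    proof
      fix k
      have "(LINT p|lborel. T k p) = (LINT p:U|lborel. c k * (f p * cnj (snd p $ i0) ^ k))"
        unfolding T_def set_lebesgue_integral_def by (simp add: mult_ac)
      also have "\<dots> = c k * (LINT p:U|lborel. f p * cnj (snd p $ i0) ^ k)" by (simp add: set_integral_mult_right)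
      also have "\<dots> = a k * t ^ k" unfolding mom using M(2)[of k] by (simp add: c_def)
      finally show "(LINT p|lborel. T k p) = a k * t ^ k" .
    qed
    also have "(\<Sum>k. a k * t ^ k) = g t" using gs by (simp add: sums_iff)
    finally show ?thesis by (simp add: g_def)
  qed
  ultimately show ?thesis unfolding reproduces_at_def K_def[abs_def] by blast
qed

section \<open>From the kernel to the polynomial\<close>

text \<open>
Repeated differentiation of the geometric series.
\<close>
lemma fact_ratio_sums:
  fixes t :: complex
  assumes t: "cmod t < 1"
  shows "(\<lambda>k. (fact (n + k) / fact k) * t ^ k) sums (fact n / (1 - t) ^ Suc n)"
  using t
proof (induction n arbitrary: t)
  case 0
  then show ?case using geometric_sums[of t] by simp
next
  case (Suc n)
  have t1: "1 - t \<noteq> 0" using Suc.prems by auto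
  have d: "((\<lambda>t. fact n / (1 - t) ^ Suc n) has_field_derivative (fact (Suc n) / (1 - t) ^ Suc (Suc n))) (at t)"
  proof -
    have "((\<lambda>t. fact n * inverse ((1 - t) ^ Suc n)) has_field_derivative
       fact n * (- (inverse ((1 - t) ^ Suc n) * (of_nat (Suc n) * (1 - t) ^ n * (0 - 1)) * inverse ((1 - t) ^ Suc n)))) (at t)"
      using t1 by (auto intro!: derivative_eq_intros simp del: power_Suc)
    moreover have "fact n * (- (inverse ((1 - t) ^ Suc n) * (of_nat (Suc n) * (1 - t) ^ n * (0 - 1)) * inverse ((1 - t) ^ Suc n)))
       = fact (Suc n) / (1 - t) ^ Suc (Suc n)"
    proof -
      have "c * (- (inverse (w * W) * (r * W * (0 - 1)) * inverse (w * W))) = r * c / (w * (w * W))"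
        if "w \<noteq> 0" "W \<noteq> 0" for c r w W :: complex
        using that by (simp add: field_simps)
      from this[of "1 - t" "(1 - t) ^ n" "fact n" "of_nat (Suc n)"] show ?thesis
        using t1 by (simp only: power_Suc fact_Suc of_nat_mult of_nat_fact power_not_zero) simp
    qed
    ultimately have "((\<lambda>t. fact n * inverse ((1 - t) ^ Suc n)) has_field_derivative (fact (Suc n) / (1 - t) ^ Suc (Suc n))) (at t)"
      by (simp only:)
    then show ?thesis unfolding divide_inverse .
  qed
  have "(\<lambda>k. diffs (\<lambda>k. fact (n + k) / fact k) k * t ^ k) sums (fact (Suc n) / (1 - t) ^ Suc (Suc n))"
    by (rule termdiffs_sums_strong[OF Suc.IH d Suc.prems])
  moreover have "diffs (\<lambda>k. fact (n + k) / fact k) k = (fact (Suc n + k) / fact k :: complex)" for k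
  proof -
    have "diffs (\<lambda>k. fact (n + k) / fact k) k = of_nat (Suc k) * (fact (Suc (n + k)) / (of_nat (Suc k) * fact k) :: complex)"
      by (simp add: diffs_def)
    also have "\<dots> = fact (Suc n + k) / fact k"
      using of_nat_neq_0[of k, where 'a = complex] by (simp del: of_nat_Suc fact_Suc)
    finally show ?thesis .
  qed
  ultimately show ?case by simp
qed

definition hua_poly :: "real \<Rightarrow> real" where
  "hua_poly s = (s + 1) * (s + 2)\<^sup>2 * (s + 3)"

definition lqk_cpoly :: "nat \<Rightarrow> real \<Rightarrow> complex \<Rightarrow> complex" where
  "lqk_cpoly m \<mu> \<eta> = of_real ((1 - \<mu>) * (2 - \<mu>)^2 * (3 - \<mu>))
    + of_real ((real m + 1) * (1 - \<mu>) * (7 - 5 * \<mu>) * (4 - 3 * \<mu>) * \<mu>) * \<eta>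
    + of_real (pochhammer (real m + 1) 2 * (1 - \<mu>) * (23 - 25 * \<mu>) * \<mu>^2) * \<eta>^2
    + of_real (2 * pochhammer (real m + 1) 3 * (4 - 5 * \<mu>) * \<mu>^3) * \<eta>^3
    + of_real (pochhammer (real m + 1) 4 * \<mu>^4) * \<eta>^4"

text \<open>
  Multiplied by \<open>(m + k)! / k!\<close> with \<open>y = m + k\<close>, each rising factorial gives again a ratio of
  factorials, which \<open>fact_ratio_sums\<close> sums.
\<close>
lemma hua_poly_rising:
  fixes y \<mu> :: real
  shows "hua_poly (\<mu> * y) = (1 - \<mu>) * (2 - \<mu>)^2 * (3 - \<mu>)
    + (1 - \<mu>) * (7 - 5 * \<mu>) * (4 - 3 * \<mu>) * \<mu> * (y + 1)
    + (1 - \<mu>) * (23 - 25 * \<mu>) * \<mu>^2 * ((y + 1) * (y + 2))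
    + 2 * (4 - 5 * \<mu>) * \<mu>^3 * ((y + 1) * (y + 2) * (y + 3))
    + \<mu>^4 * ((y + 1) * (y + 2) * (y + 3) * (y + 4))"
  unfolding hua_poly_def by algebra

lemma pochhammer_numerals:
  fixes x :: real
  shows "pochhammer (x + 1) 2 = (x + 1) * (x + 2)" "pochhammer (x + 1) 3 = (x + 1) * (x + 2) * (x + 3)"
    "pochhammer (x + 1) 4 = (x + 1) * (x + 2) * (x + 3) * (x + 4)"
  by (simp_all add: numeral_eq_Suc pochhammer_Suc algebra_simps)

lemma kernel_series_sums:
  fixes t :: complex
  assumes t: "cmod t < 1"
  shows "(\<lambda>k. of_real (fact (m + k) / fact k * hua_poly (\<mu> * real (m + k))) * t ^ k) sums
    (fact m / (1 - t) ^ Suc m * lqk_cpoly m \<mu> (1 / (1 - t)))"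
proof -
  have t1: "1 - t \<noteq> 0" using t by auto
  define a0 where "a0 = (1 - \<mu>) * (2 - \<mu>)^2 * (3 - \<mu>)"
  define a1 where "a1 = (1 - \<mu>) * (7 - 5 * \<mu>) * (4 - 3 * \<mu>) * \<mu>"
  define a2 where "a2 = (1 - \<mu>) * (23 - 25 * \<mu>) * \<mu>^2"
  define a3 where "a3 = 2 * (4 - 5 * \<mu>) * \<mu>^3"
  define a4 where "a4 = \<mu>^4"
  define S where "S j k = (fact (m + j + k) / fact k) * t ^ k" for j k
  have S: "S j sums (fact (m + j) / (1 - t) ^ Suc (m + j))" for j
    unfolding S_def by (rule fact_ratio_sums[OF t])
  have "(\<lambda>k. of_real a0 * S 0 k + of_real a1 * S 1 k + of_real a2 * S 2 k + of_real a3 * S 3 k + of_real a4 * S 4 k) sums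
    (of_real a0 * (fact (m + 0) / (1 - t) ^ Suc (m + 0)) + of_real a1 * (fact (m + 1) / (1 - t) ^ Suc (m + 1))
     + of_real a2 * (fact (m + 2) / (1 - t) ^ Suc (m + 2)) + of_real a3 * (fact (m + 3) / (1 - t) ^ Suc (m + 3))
     + of_real a4 * (fact (m + 4) / (1 - t) ^ Suc (m + 4)))"
    by (intro sums_add sums_mult S)
  moreover have "of_real a0 * S 0 k + of_real a1 * S 1 k + of_real a2 * S 2 k + of_real a3 * S 3 k + of_real a4 * S 4 k
    = of_real (fact (m + k) / fact k * hua_poly (\<mu> * real (m + k))) * t ^ k" for k
  proof -
    define y where "y = real (m + k)"
    have f1: "(fact (m + 1 + k) :: real) = (y + 1) * fact (m + k)" by (simp add: y_def algebra_simps)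
    have f2: "(fact (m + 2 + k) :: real) = (y + 2) * fact (m + 1 + k)" by (simp add: y_def algebra_simps numeral_eq_Suc)
    have f3: "(fact (m + 3 + k) :: real) = (y + 3) * fact (m + 2 + k)" by (simp add: y_def algebra_simps numeral_eq_Suc)
    have f4: "(fact (m + 4 + k) :: real) = (y + 4) * fact (m + 3 + k)" by (simp add: y_def algebra_simps numeral_eq_Suc)
    have r: "S j k = of_real (fact (m + j + k) / fact k) * t ^ k" for j by (simp add: S_def)
    have "a0 * (fact (m + 0 + k) / fact k) + a1 * (fact (m + 1 + k) / fact k) + a2 * (fact (m + 2 + k) / fact k)
        + a3 * (fact (m + 3 + k) / fact k) + a4 * (fact (m + 4 + k) / fact k)
      = fact (m + k) / fact k * hua_poly (\<mu> * y)"
      unfolding f4 f3 f2 f1 hua_poly_rising a0_def[symmetric] a1_def[symmetric] a2_def[symmetric] a3_def[symmetric] a4_def[symmetric]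
      by (simp add: algebra_simps add_divide_distrib)
    from arg_cong[OF this, of "\<lambda>x. complex_of_real x * t ^ k"] show ?thesis
      unfolding r y_def by (simp only: of_real_add of_real_mult distrib_right mult.assoc)
  qed
  moreover have "of_real a0 * (fact (m + 0) / (1 - t) ^ Suc (m + 0)) + of_real a1 * (fact (m + 1) / (1 - t) ^ Suc (m + 1))
     + of_real a2 * (fact (m + 2) / (1 - t) ^ Suc (m + 2)) + of_real a3 * (fact (m + 3) / (1 - t) ^ Suc (m + 3))
     + of_real a4 * (fact (m + 4) / (1 - t) ^ Suc (m + 4)) = fact m / (1 - t) ^ Suc m * lqk_cpoly m \<mu> (1 / (1 - t))"
  proof -
    define x where "x = complex_of_real (real m)"
    define p1 where "p1 = x + 1"
    define p2 where "p2 = p1 * (x + 2)"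
    define p3 where "p3 = p2 * (x + 3)"
    define p4 where "p4 = p3 * (x + 4)"
    have f1: "(fact (m + 1) :: complex) = p1 * fact m" by (simp add: p1_def x_def algebra_simps)
    have f2: "(fact (m + 2) :: complex) = p2 * fact m"
      using f1 by (simp add: p2_def x_def algebra_simps numeral_eq_Suc)
    have f3: "(fact (m + 3) :: complex) = p3 * fact m"
      using f2 by (simp add: p3_def x_def algebra_simps numeral_eq_Suc)
    have f4: "(fact (m + 4) :: complex) = p4 * fact m"
      using f3 by (simp add: p4_def x_def algebra_simps numeral_eq_Suc)
    define F where "F = fact m / (1 - t) ^ Suc m"
    have e: "c * fact m / (1 - t) ^ Suc (m + j) = c * F * (1 / (1 - t)) ^ j" for c j
      by (simp add: power_add power_divide F_def)
    have L: "lqk_cpoly m \<mu> \<eta> = of_real a0 + p1 * of_real a1 * \<eta> + p2 * of_real a2 * \<eta>^2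
       + p3 * of_real a3 * \<eta>^3 + p4 * of_real a4 * \<eta>^4" for \<eta>
      unfolding lqk_cpoly_def pochhammer_numerals a0_def a1_def a2_def a3_def a4_def p4_def p3_def p2_def p1_def x_def
      by (simp only: of_real_mult of_real_add of_real_numeral of_real_1 of_real_power mult_ac)
    have z: "fact (m + 0) / (1 - t) ^ Suc (m + 0) = F" by (simp add: F_def)
    show ?thesis unfolding z L f1 f2 f3 f4 e F_def[symmetric]
      by (simp add: algebra_simps)
  qed
  ultimately show ?thesis by simp
qed

lemma Re_inverse_disc:
  assumes "cmod t < 1"
  shows "Re (1 / (1 - t)) > 1/2"
proof -
  have t1: "1 - t \<noteq> 0" using assms by auto
  have n: "(cmod (1 - t))\<^sup>2 > 0" using t1 by simp
  have "(cmod t)\<^sup>2 < 1" using assms by (simp add: abs_square_less_1)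
  then have "(cmod (1 - t))\<^sup>2 < 2 * (1 - Re t)"
    unfolding cmod_power2 by (simp add: power2_eq_square algebra_simps)
  moreover have "Re (1 / (1 - t)) = (1 - Re t) / (cmod (1 - t))\<^sup>2"
    by (simp add: Re_divide cmod_power2)
  ultimately show ?thesis using n by (simp only:) (simp add: field_simps)
qed

lemma disc_of_half_plane:
  assumes "Re \<eta> > 1/2"
  obtains t where "cmod t < 1" "1 / (1 - t) = \<eta>"
proof -
  have e0: "\<eta> \<noteq> 0" using assms by auto
  show ?thesis
  proof (rule that[of "1 - 1 / \<eta>"])
    show "1 / (1 - (1 - 1 / \<eta>)) = \<eta>" using e0 by simp
    have "(cmod (\<eta> - 1))\<^sup>2 < (cmod \<eta>)\<^sup>2"
      unfolding cmod_power2 using assms by (simp add: power2_eq_square algebra_simps)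
    then have "cmod (\<eta> - 1) < cmod \<eta>" by (rule power2_less_imp_less) simp
    moreover have "1 - 1 / \<eta> = (\<eta> - 1) / \<eta>" using e0 by (simp add: field_simps)
    ultimately show "cmod (1 - 1 / \<eta>) < 1" using e0 by (simp add: norm_divide)
  qed
qed

lemma connected_inflated_lie_ball:
  fixes \<mu> :: real
  assumes mu: "\<mu> > 0"
  shows "connected (inflated_lie_ball \<mu> :: ((complex ^ 'n::finite) \<times> (complex ^ 'm::finite)) set)" (is "connected ?U")
proof (rule starlike_imp_connected, unfold starlike_def, intro bexI ballI)
  show "0 \<in> ?U" by (simp add: zero_prod_def inflated_zero_iff)
  fix p assume p: "p \<in> ?U"
  show "closed_segment 0 p \<subseteq> ?U"
  proof
    fix x assume "x \<in> closed_segment 0 p"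
    then obtain u where u: "0 \<le> u" "u \<le> 1" "x = u *\<^sub>R p" by (auto simp: in_segment)
    have "(of_real u *s fst p, u *\<^sub>R snd p) \<in> ?U"
      using p u by (intro inflated_contract[of "fst p" "snd p" \<mu> _ "u *\<^sub>R snd p"] mu)
        (auto intro: mult_left_le_one_le)
    then show "x \<in> ?U" using u(3) by (simp add: scaleR_eq_cscale prod_eq_iff) (metis fst_scaleR snd_scaleR prod.collapse scaleR_eq_cscale)
  qed
qed

text \<open>
  The arguments \<open>cnj r * (t / r)\<close> with \<open>\<bar>t\<bar> < r < 1\<close> show that the kernel attains, up to a factor
  without zeros, all values of its power series on the disc.
\<close>
lemma lu_qikeng_iff:
  fixes \<mu> :: real
  assumes mu: "\<mu> > 0"
  shows "lu_qikeng_domain (inflated_lie_ball \<mu> :: ((complex ^ 4) \<times> (complex ^ 'm::finite)) set)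
    \<longleftrightarrow> (\<forall>\<eta>. Re \<eta> > 1/2 \<longrightarrow> lqk_cpoly CARD('m) \<mu> \<eta> \<noteq> 0)"
proof -
  let ?U = "inflated_lie_ball \<mu> :: ((complex ^ 4) \<times> (complex ^ 'm)) set"
  let ?m = "CARD('m)"
  obtain i0 :: 'm where True by simp
  obtain C :: real where C: "C > 0"
    "\<And>k. (\<integral>\<^sup>+p. ennreal ((cmod (snd p $ i0)) ^ (2 * k)) * indicator ?U p \<partial>lborel)
      = (let s = \<mu> * real (CARD('m) + k) in
         ennreal (C * (fact k / fact (CARD('m) + k)) / ((s + 1) * (s + 2)\<^sup>2 * (s + 3))))"
    by (rule inflated_moment[OF mu, of i0]) blast
  define M where "M k = C * (fact k / fact (?m + k)) / hua_poly (\<mu> * real (?m + k))" for k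
  have hp: "hua_poly s > 0" if "s \<ge> 0" for s using that by (simp add: hua_poly_def)
  have M: "(\<integral>\<^sup>+p. ennreal ((cmod (snd p $ i0)) ^ (2 * k)) * indicator ?U p \<partial>lborel) = ennreal (M k)" "M k > 0" for k
    using C mu hp[of "\<mu> * real (?m + k)"] by (simp_all add: M_def hua_poly_def Let_def)
  define G where "G t = of_real (1 / C) * (fact ?m / (1 - t) ^ Suc ?m * lqk_cpoly ?m \<mu> (1 / (1 - t)))" for t
  have Gs: "(\<lambda>k. t ^ k / of_real (M k)) sums G t" if t: "cmod t < 1" for t
  proof -
    have "t ^ k / of_real (M k) = of_real (1 / C) * (of_real (fact (?m + k) / fact k * hua_poly (\<mu> * real (?m + k))) * t ^ k)" for k
      by (simp add: M_def field_simps)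
    then show ?thesis unfolding G_def using sums_mult[OF kernel_series_sums[OF t, of ?m \<mu>], of "of_real (1 / C)"] by simp
  qed
  have Gn: "summable (\<lambda>k. norm (t ^ k / of_real (M k) :: complex))" if t: "cmod t < 1" for t
  proof -
    have "summable (\<lambda>k. (of_real (cmod t) :: complex) ^ k / of_real (M k))"
      using Gs[of "of_real (cmod t)"] t by (simp add: sums_iff)
    then have "summable (\<lambda>k. Re ((of_real (cmod t) :: complex) ^ k / of_real (M k)))" by (rule summable_Re)
    moreover have "Re ((of_real (cmod t) :: complex) ^ k / of_real (M k)) = norm (t ^ k / of_real (M k) :: complex)" for k
      using M(2)[of k] by (simp add: norm_divide norm_power flip: of_real_power of_real_divide)
    ultimately show ?thesis by simp
  qed
  have base: "reproduces_at ?U (0, axis i0 t) (\<lambda>p. G (cnj t * snd p $ i0))" if "cmod t < 1" for t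
    by (rule reproduces_at_base[where M = M, OF mu M(1) M(2) Gn Gs that])
  have comp1: "cmod (snd p $ i0) < 1" if "p \<in> ?U" for p
    using inflated_bounded[OF that mu] Finite_Cartesian_Product.norm_nth_le[of "snd p" i0] by linarith
  have good: "\<exists>k. reproduces_at ?U q k \<and> (\<forall>p\<in>?U. k p = 0 \<longrightarrow> (\<exists>t. cmod t < 1 \<and> G t = 0))" if q: "q \<in> ?U" for q
  proof (rule inflated_lie_ball_transitive[of \<mu> "\<lambda>q. \<exists>k. reproduces_at ?U q k \<and> (\<forall>p\<in>?U. k p = 0 \<longrightarrow> (\<exists>t. cmod t < 1 \<and> G t = 0))" i0, OF _ _ q])
    fix \<phi> \<phi>' J and q :: "(complex ^ 4) \<times> (complex ^ 'm)"
    assume aut: "bergman_automorphism ?U \<phi> \<phi>' J" and q: "q \<in> ?U"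
      and "\<exists>k. reproduces_at ?U (\<phi> q) k \<and> (\<forall>p\<in>?U. k p = 0 \<longrightarrow> (\<exists>t. cmod t < 1 \<and> G t = 0))"
    then obtain k where k: "reproduces_at ?U (\<phi> q) k" "\<forall>p\<in>?U. k p = 0 \<longrightarrow> (\<exists>t. cmod t < 1 \<and> G t = 0)" by blast
    have a: "\<forall>p\<in>?U. \<phi> p \<in> ?U \<and> J p \<noteq> 0" using aut unfolding bergman_automorphism_def by blast
    show "\<exists>k. reproduces_at ?U q k \<and> (\<forall>p\<in>?U. k p = 0 \<longrightarrow> (\<exists>t. cmod t < 1 \<and> G t = 0))"
    proof (rule exI, rule conjI)
      show "reproduces_at ?U q (\<lambda>p. J p * cnj (J q) * k (\<phi> p))"
        by (rule reproduces_at_automorphism[OF open_inflated_lie_ball aut k(1) q])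
      show "\<forall>p\<in>?U. J p * cnj (J q) * k (\<phi> p) = 0 \<longrightarrow> (\<exists>t. cmod t < 1 \<and> G t = 0)"
      proof (rule ballI, rule impI)
        fix p assume p: "p \<in> ?U" and "J p * cnj (J q) * k (\<phi> p) = 0"
        then have "k (\<phi> p) = 0" using a q by auto
        then show "\<exists>t. cmod t < 1 \<and> G t = 0" using k(2) a p by blast
      qed
    qed
  next
    fix t assume t: "cmod t < 1"
    show "\<exists>k. reproduces_at ?U (0, axis i0 t) k \<and> (\<forall>p\<in>?U. k p = 0 \<longrightarrow> (\<exists>t. cmod t < 1 \<and> G t = 0))"
    proof (rule exI, rule conjI)
      show "reproduces_at ?U (0, axis i0 t) (\<lambda>p. G (cnj t * snd p $ i0))" by (rule base[OF t])
      show "\<forall>p\<in>?U. G (cnj t * snd p $ i0) = 0 \<longrightarrow> (\<exists>t. cmod t < 1 \<and> G t = 0)"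
      proof (rule ballI, rule impI)
        fix p assume p: "p \<in> ?U" and z: "G (cnj t * snd p $ i0) = 0"
        have "cmod t * cmod (snd p $ i0) \<le> cmod t * 1" using comp1[OF p] by (intro mult_left_mono) auto
        then have "cmod (cnj t * snd p $ i0) < 1" using t by (simp add: norm_mult)
        then show "\<exists>t. cmod t < 1 \<and> G t = 0" using z by blast
      qed
    qed
  qed
  have ex: "\<exists>k. reproduces_at ?U q k" if "q \<in> ?U" for q using good[OF that] by blast
  have kernel: "(\<forall>z\<in>?U. \<forall>w\<in>?U. bergman_kernel ?U z w \<noteq> 0) \<longleftrightarrow> (\<forall>t. cmod t < 1 \<longrightarrow> G t \<noteq> 0)"
  proof
    assume nz: "\<forall>z\<in>?U. \<forall>w\<in>?U. bergman_kernel ?U z w \<noteq> 0"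
    show "\<forall>t. cmod t < 1 \<longrightarrow> G t \<noteq> 0"
    proof (intro allI impI)
      fix t assume t: "cmod t < 1"
      define r where "r = (1 + cmod t) / 2"
      have r: "cmod t < r" "r < 1" "r > 0" using t by (simp_all add: r_def add_pos_nonneg)
      have q: "cmod (complex_of_real r) < 1" "cmod (t / of_real r) < 1" using r by (simp_all add: norm_divide)
      have "bergman_kernel ?U (0, axis i0 (t / of_real r)) (0, axis i0 (of_real r)) = G (cnj (of_real r) * snd (0 :: complex ^ 4, axis i0 (t / of_real r)) $ i0)"
        by (rule bergman_kernel_eq[OF open_inflated_lie_ball ex base[OF q(1)] inflated_axis_in[OF q(2)] inflated_axis_in[OF q(1)]])
      also have "cnj (of_real r) * snd (0 :: complex ^ 4, axis i0 (t / of_real r)) $ i0 = t" using r by (simp add: axis_def)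
      finally show "G t \<noteq> 0" using nz inflated_axis_in[OF q(1)] inflated_axis_in[OF q(2)] by metis
    qed
  next
    assume nz: "\<forall>t. cmod t < 1 \<longrightarrow> G t \<noteq> 0"
    show "\<forall>z\<in>?U. \<forall>w\<in>?U. bergman_kernel ?U z w \<noteq> 0"
    proof (intro ballI)
      fix z w assume z: "z \<in> ?U" and w: "w \<in> ?U"
      obtain k where k: "reproduces_at ?U w k" "\<forall>p\<in>?U. k p = 0 \<longrightarrow> (\<exists>t. cmod t < 1 \<and> G t = 0)" using good[OF w] by blast
      have "bergman_kernel ?U z w = k z" by (rule bergman_kernel_eq[OF open_inflated_lie_ball ex k(1) z w])
      then show "bergman_kernel ?U z w \<noteq> 0" using k(2) z nz by auto
    qed
  qed
  have "(0, 0) \<in> ?U" by (simp add: inflated_zero_iff)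
  then have "?U \<noteq> {}" by blast
  then have "lu_qikeng_domain ?U \<longleftrightarrow> (\<forall>t. cmod t < 1 \<longrightarrow> G t \<noteq> 0)"
    unfolding lu_qikeng_domain_def kernel using open_inflated_lie_ball connected_inflated_lie_ball[OF mu] by blast
  also have "\<dots> \<longleftrightarrow> (\<forall>t. cmod t < 1 \<longrightarrow> lqk_cpoly ?m \<mu> (1 / (1 - t)) \<noteq> 0)"
  proof -
    have "G t = 0 \<longleftrightarrow> lqk_cpoly ?m \<mu> (1 / (1 - t)) = 0" if "cmod t < 1" for t
    proof -
      have "1 - t \<noteq> 0" using that by auto
      then show ?thesis using C(1) by (simp add: G_def)
    qed
    then show ?thesis by blast
  qed
  also have "\<dots> \<longleftrightarrow> (\<forall>\<eta>. Re \<eta> > 1/2 \<longrightarrow> lqk_cpoly ?m \<mu> \<eta> \<noteq> 0)"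
    using Re_inverse_disc disc_of_half_plane by metis
  finally show ?thesis .
qed

section \<open>Zeros of the polynomial in the half-plane\<close>

text \<open>
  Routh-Hurwitz criterion. If \<open>y\<close> is a nonreal root, then \<open>y\<close> and its conjugate are the roots of a real
  quadratic factor, and the Hurwitz determinant is a negative multiple of a positive expression in the
  coefficients of the two factors.
\<close>
lemma quartic_no_right_root:
  fixes A0 A1 A2 A3 A4 :: real and y :: complex
  assumes pos: "A0 \<ge> 0" "A1 > 0" "A2 \<ge> 0" "A3 > 0" "A4 > 0"
    and D: "A1 * A2 * A3 - A0 * A3\<^sup>2 - A4 * A1\<^sup>2 \<ge> 0" and y: "Re y > 0"
  shows "of_real A0 + of_real A1 * y + of_real A2 * y^2 + of_real A3 * y^3 + of_real A4 * y^4 \<noteq> 0"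
proof
  assume z: "of_real A0 + of_real A1 * y + of_real A2 * y^2 + of_real A3 * y^3 + of_real A4 * y^4 = 0"
  show False
  proof (cases "Im y = 0")
    case True
    define u where "u = Re y"
    have yu: "y = of_real u" using True by (simp add: u_def complex_eq_iff)
    have u: "u > 0" using y by (simp add: u_def)
    have "complex_of_real (A0 + A1 * u + A2 * u^2 + A3 * u^3 + A4 * u^4) = 0" using z yu by simp
    then have "A0 + A1 * u + A2 * u^2 + A3 * u^3 + A4 * u^4 = 0" by (simp only: of_real_eq_0_iff)
    moreover have "A0 + A1 * u + A2 * u^2 + A3 * u^3 + A4 * u^4 > 0"
      using pos u by (intro add_nonneg_pos add_nonneg_nonneg) auto
    ultimately show False by simp
  next
    case False
    define s where "s = 2 * Re y"
    define p where "p = (Re y)\<^sup>2 + (Im y)\<^sup>2"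
    \<comment> \<open>the cofactor of \<open>y\<^sup>2 - s y + p\<close> is \<open>A4 y\<^sup>2 + \<beta> y + \<gamma>\<close>\<close>
    define \<beta> where "\<beta> = A3 + s * A4"
    define \<gamma> where "\<gamma> = A2 + s * \<beta> - p * A4"
    have s: "s > 0" using y by (simp add: s_def)
    have p: "p > 0" using y by (simp add: p_def add_pos_nonneg)
    have y2: "y^2 = of_real s * y - of_real p"
      by (simp add: complex_eq_iff s_def p_def power2_eq_square algebra_simps)
    have y3: "y^3 = y * (of_real s * y - of_real p)" using y2 by (simp add: power3_eq_cube power2_eq_square)
    have y4: "y^4 = (of_real s * y - of_real p) * (of_real s * y - of_real p)"
      using y2 by (simp add: power4_eq_xxxx power2_eq_square)
    have yy: "y * y = of_real s * y - of_real p" using y2 by (simp add: power2_eq_square)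
    have "of_real (A0 - p * \<gamma>) + of_real (A1 + s * \<gamma> - p * \<beta>) * y
        = of_real A0 + of_real A1 * y + of_real A2 * y^2 + of_real A3 * y^3 + of_real A4 * y^4"
      unfolding y4 y3 y2 \<gamma>_def \<beta>_def of_real_add of_real_diff of_real_mult using yy by algebra
    then have z': "of_real (A0 - p * \<gamma>) + of_real (A1 + s * \<gamma> - p * \<beta>) * y = 0" using z by simp
    from arg_cong[OF z', of Im] have r1: "A1 = p * \<beta> - s * \<gamma>" using False by simp
    from arg_cong[OF z', of Re] r1 have r0: "A0 = p * \<gamma>" by simp
    have A3: "A3 = \<beta> - s * A4" by (simp add: \<beta>_def)
    have A2: "A2 = \<gamma> - s * \<beta> + p * A4" by (simp add: \<gamma>_def)
    have \<beta>: "\<beta> > 0" using pos s by (simp add: \<beta>_def add_pos_pos)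
    have "A1 * A2 * A3 - A0 * A3\<^sup>2 - A4 * A1\<^sup>2 = - (s * \<beta> * ((\<gamma> - A4 * p)\<^sup>2 + A3 * A1))"
      unfolding r1 r0 A2 A3 by algebra
    moreover have "s * \<beta> * ((\<gamma> - A4 * p)\<^sup>2 + A3 * A1) > 0"
      using s \<beta> pos by (intro mult_pos_pos add_nonneg_pos) auto
    ultimately show False using D by linarith
  qed
qed

lemma poly_positive_root:
  fixes q :: "real poly"
  assumes "poly q 0 < 0" "lead_coeff q > 0"
  obtains y where "y > 0" "poly q y = 0"
proof -
  obtain n where n: "\<And>x. x \<ge> n \<Longrightarrow> poly q x \<ge> lead_coeff q" using poly_pinfty_gt_lc[OF assms(2)] by blast
  define b where "b = max n 1"
  have b: "poly q b > 0" "b > 0" using n[of b] assms(2) by (auto simp: b_def)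
  obtain y where "0 < y" "poly q y = 0" using poly_IVT_pos[OF b(2) assms(1) b(1)] by blast
  then show ?thesis using that by blast
qed

text \<open>
  The argument behind the Gauss-Lucas theorem: for roots in the closed left half-plane every summand
  \<open>1 / (y - r)\<close> of \<open>p' / p\<close> has positive real part at \<open>y > 0\<close>.
\<close>
lemma log_derivative_nonneg:
  fixes p :: "complex poly" and y :: real
  assumes roots: "\<And>z. poly p z = 0 \<Longrightarrow> Re z \<le> 0" and y: "y > 0" and p0: "p \<noteq> 0"
  shows "0 \<le> Re (poly (pderiv p) (of_real y) * cnj (poly p (of_real y)))"
  using roots p0
proof (induction "degree p" arbitrary: p)
  case 0
  then obtain c where "p = [:c:]" by (metis degree_eq_zeroE)
  then show ?case by (simp add: pderiv_pCons)
next
  case (Suc n)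
  obtain r where r: "poly p r = 0"
    using fundamental_theorem_of_algebra_alt[of p] Suc.hyps(2) by fastforce
  then obtain q where q: "p = [:- r, 1:] * q" by (metis dvdE poly_eq_0_iff_dvd)
  have q0: "q \<noteq> 0" using Suc.prems q by auto
  have "degree p = 1 + degree q" unfolding q using q0 by (subst degree_mult_eq) auto
  then have deg: "degree q = n" using Suc.hyps(2) by simp
  have "Re r \<le> 0" using Suc.prems(1) r by blast
  have IH: "0 \<le> Re (poly (pderiv q) (of_real y) * cnj (poly q (of_real y)))"
    by (rule Suc.hyps(1)) (use deg q0 Suc.prems(1) in \<open>auto simp: q\<close>)
  define w where "w = of_real y - r"
  have w: "Re w > 0" using \<open>Re r \<le> 0\<close> y by (simp add: w_def)
  have P: "poly p (of_real y) = w * poly q (of_real y)" by (simp add: q w_def algebra_simps)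
  have P': "poly (pderiv p) (of_real y) = poly q (of_real y) + w * poly (pderiv q) (of_real y)"
  proof -
    have D: "pderiv p = [:- r, 1:] * pderiv q + q * pderiv [:- r, 1:]" unfolding q by (rule pderiv_mult)
    show ?thesis unfolding D poly_add poly_mult by (simp add: pderiv_pCons w_def algebra_simps)
  qed
  have "poly (pderiv p) (of_real y) * cnj (poly p (of_real y))
    = of_real ((cmod (poly q (of_real y)))\<^sup>2) * cnj w + of_real ((cmod w)\<^sup>2) * (poly (pderiv q) (of_real y) * cnj (poly q (of_real y)))"
    unfolding P P' complex_norm_square by (simp add: algebra_simps)
  then have "Re (poly (pderiv p) (of_real y) * cnj (poly p (of_real y)))
    = (cmod (poly q (of_real y)))\<^sup>2 * Re w + (cmod w)\<^sup>2 * Re (poly (pderiv q) (of_real y) * cnj (poly q (of_real y)))"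
    by (simp del: of_real_power)
  also have "\<dots> \<ge> 0" using w IH by (intro add_nonneg_nonneg mult_nonneg_nonneg) auto
  finally show ?case .
qed

text \<open>
  If \<open>A0 < 0\<close>, or if \<open>A0 = 0\<close> and \<open>A1 < 0\<close>, there is a positive real root. If \<open>A0 > 0 > A1\<close>, then
  roots only in the left half-plane would give \<open>A0 * A1 \<ge> 0\<close> by \<open>log_derivative_nonneg\<close> near \<open>0\<close>.
\<close>
lemma quartic_right_root:
  fixes A0 A1 A2 A3 A4 :: real
  assumes A4: "A4 > 0" and neg: "A0 < 0 \<or> A1 < 0"
  obtains y :: complex where "Re y > 0" "of_real A0 + of_real A1 * y + of_real A2 * y^2 + of_real A3 * y^3 + of_real A4 * y^4 = 0"
proof -
  consider "A0 < 0" | "A0 = 0" "A1 < 0" | "A0 > 0" "A1 < 0" using neg by linarith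
  then show ?thesis
  proof cases
    case 1
    have "poly [:A0, A1, A2, A3, A4:] 0 < 0" "lead_coeff [:A0, A1, A2, A3, A4:] > 0" using 1 A4 by auto
    then obtain y where y: "y > 0" "poly [:A0, A1, A2, A3, A4:] y = 0" by (rule poly_positive_root)
    have "complex_of_real (A0 + A1 * y + A2 * y^2 + A3 * y^3 + A4 * y^4) = 0"
      using y(2) by (simp add: algebra_simps power_numeral_reduce)
    then show ?thesis using that[of "of_real y"] y(1) by simp
  next
    case 2
    have "poly [:A1, A2, A3, A4:] 0 < 0" "lead_coeff [:A1, A2, A3, A4:] > 0" using 2 A4 by auto
    then obtain y where y: "y > 0" "poly [:A1, A2, A3, A4:] y = 0" by (rule poly_positive_root)
    have "A0 + A1 * y + A2 * y^2 + A3 * y^3 + A4 * y^4 = y * poly [:A1, A2, A3, A4:] y"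
      using 2 by (simp add: algebra_simps power_numeral_reduce)
    then have "complex_of_real (A0 + A1 * y + A2 * y^2 + A3 * y^3 + A4 * y^4) = 0" using y(2) by simp
    then show ?thesis using that[of "of_real y"] y(1) by simp
  next
    case 3
    define p where "p = [:of_real A0, of_real A1, of_real A2, of_real A3, of_real A4 :: complex:]"
    have pp: "poly p y = of_real A0 + of_real A1 * y + of_real A2 * y^2 + of_real A3 * y^3 + of_real A4 * y^4" for y
      by (simp add: p_def algebra_simps power_numeral_reduce)
    show ?thesis
    proof (cases "\<exists>y. Re y > 0 \<and> poly p y = 0")
      case True
      then show ?thesis using that unfolding pp by blast
    next
      case False
      define h where "h y = Re (poly (pderiv p) (of_real y) * cnj (poly p (of_real y)))" for y :: real
      have p0: "p \<noteq> 0" using A4 by (simp add: p_def)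
      have h0: "h y \<ge> 0" if "y > 0" for y
        unfolding h_def using False that p0 by (intro log_derivative_nonneg) (auto simp: not_less)
      have "continuous_on UNIV h" unfolding h_def by (intro continuous_intros)
      then have "isCont h 0" by (simp add: continuous_on_eq_continuous_at)
      then have "(h \<longlongrightarrow> h 0) (at_right 0)" unfolding isCont_def by (rule filterlim_mono[OF _ order_refl at_le]) simp
      moreover have "eventually (\<lambda>y. 0 \<le> h y) (at_right 0)"
        using h0 by (auto simp: eventually_at_right_field intro!: exI[of _ 1])
      ultimately have "h 0 \<ge> 0" by (rule tendsto_lowerbound) simp
      moreover have "h 0 = A1 * A0" by (simp add: h_def p_def pderiv_pCons)
      ultimately show ?thesis using 3 mult_neg_pos[of A1 A0] by linarith
    qed
  qed
qed

text \<open>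
  The Taylor coefficients of the polynomial at \<open>1/2\<close> divided by the corresponding powers of \<open>\<mu>\<close>: a
  positive factor in the variable does not affect the half-plane.
\<close>
definition taylor1 :: "real \<Rightarrow> real \<Rightarrow> real" where
  "taylor1 x \<mu> = (x + 1) * (1 - \<mu>) * (7 - 5 * \<mu>) * (4 - 3 * \<mu>) + (x + 1) * (x + 2) * (1 - \<mu>) * (23 - 25 * \<mu>) * \<mu>
    + 3 / 2 * (x + 1) * (x + 2) * (x + 3) * (4 - 5 * \<mu>) * \<mu>^2 + (x + 1) * (x + 2) * (x + 3) * (x + 4) / 2 * \<mu>^3"

definition taylor2 :: "real \<Rightarrow> real \<Rightarrow> real" where
  "taylor2 x \<mu> = (x + 1) * (x + 2) * (1 - \<mu>) * (23 - 25 * \<mu>) + 3 * (x + 1) * (x + 2) * (x + 3) * (4 - 5 * \<mu>) * \<mu>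
    + 3 / 2 * (x + 1) * (x + 2) * (x + 3) * (x + 4) * \<mu>^2"

definition taylor3 :: "real \<Rightarrow> real \<Rightarrow> real" where
  "taylor3 x \<mu> = 2 * (x + 1) * (x + 2) * (x + 3) * (4 - 5 * \<mu>) + 2 * (x + 1) * (x + 2) * (x + 3) * (x + 4) * \<mu>"

definition taylor4 :: "real \<Rightarrow> real" where
  "taylor4 x = (x + 1) * (x + 2) * (x + 3) * (x + 4)"

lemma lqk_poly_half:
  "lqk_poly m \<mu> (1/2) = (1 - \<mu>) * (2 - \<mu>)^2 * (3 - \<mu>) + (real m + 1) * (1 - \<mu>) * (7 - 5 * \<mu>) * (4 - 3 * \<mu>) * \<mu> / 2
    + (real m + 1) * (real m + 2) * (1 - \<mu>) * (23 - 25 * \<mu>) * \<mu>^2 / 4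
    + (real m + 1) * (real m + 2) * (real m + 3) * (4 - 5 * \<mu>) * \<mu>^3 / 4
    + (real m + 1) * (real m + 2) * (real m + 3) * (real m + 4) * \<mu>^4 / 16"
  by (simp add: lqk_poly_def pochhammer_numerals power_divide)

lemma lqk_taylor:
  "lqk_cpoly m \<mu> (1/2 + y) = of_real (lqk_poly m \<mu> (1/2)) + of_real (taylor1 (real m) \<mu>) * (of_real \<mu> * y)
    + of_real (taylor2 (real m) \<mu>) * (of_real \<mu> * y)^2 + of_real (taylor3 (real m) \<mu>) * (of_real \<mu> * y)^3
    + of_real (taylor4 (real m)) * (of_real \<mu> * y)^4"
proof -
  define x where "x = complex_of_real (real m)"
  define v where "v = complex_of_real \<mu>"
  define h where "h = (1/2 :: complex)"
  have h: "2 * h = 1" by (simp add: h_def)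
  have half: "complex_of_real (a / 2) = h * of_real a" "complex_of_real (a / 4) = h * h * of_real a" "complex_of_real (a / 16) = h * h * h * h * of_real a"
    "complex_of_real (3 / 2 * a) = 3 * h * of_real a" for a
    by (simp_all add: h_def)
  show ?thesis
    unfolding lqk_cpoly_def lqk_poly_half taylor1_def taylor2_def taylor3_def taylor4_def pochhammer_numerals h_def[symmetric]
    unfolding of_real_add
    unfolding half mult.assoc[of "3/2"] times_divide_eq_left[symmetric]
    using h
    by (simp add: field_simps power2_eq_square power3_eq_cube power4_eq_xxxx h_def)
qed

text \<open>
  Two inequalities, in all dimensions \<open>m \<ge> 1\<close>, that yield the Hurwitz determinant as a combination with
  nonnegative coefficients. The expansions have a few negative coefficients, which are absorbed by
  higher powers since \<open>n\<close> is a natural number.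
\<close>
lemma taylor_discriminants:
  fixes n :: nat and \<mu> :: real
  defines "x \<equiv> real n + 1"
  assumes mu: "\<mu> > 0" and m: "m = Suc n"
  shows "taylor1 x \<mu> * taylor2 x \<mu> - 3 * lqk_poly m \<mu> (1/2) * taylor3 x \<mu> \<ge> 0"
    and "2 * taylor2 x \<mu> * taylor3 x \<mu> - 3 * taylor4 x * taylor1 x \<mu> > 0" and "taylor3 x \<mu> > 0"
proof -
  define N where "N = real n"
  have xN: "x = N + 1" "real m = N + 1" by (simp_all add: x_def N_def m)
  have mono: "N ^ Suc i \<le> N ^ Suc (Suc i)" for i
  proof (cases "n = 0")
    case False
    then have "N \<ge> 1" by (simp add: N_def)
    then have "N ^ Suc i * 1 \<le> N ^ Suc i * N" by (intro mult_left_mono) auto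
    then show ?thesis by (simp add: mult_ac)
  qed (simp add: N_def)
  have N: "0 \<le> N" "N \<le> N^2" "N^2 \<le> N^3" "N^3 \<le> N^4" "N^4 \<le> N^5" "N^5 \<le> N^6" "N^6 \<le> N^7" "N^7 \<le> N^8"
    using mono[of 0] mono[of 1] mono[of 2] mono[of 3] mono[of 4] mono[of 5] mono[of 6]
    by (simp_all add: N_def numeral_eq_Suc)
  \<comment> \<open>the coefficient of \<open>\<mu> ^ 4\<close> below needs more than the monotonicity of powers\<close>
  have "0 \<le> N^3 * (N - 1)^2" using N(1) by simp
  then have N': "2 * N^4 \<le> N^3 + N^5" by (simp add: power_numeral_reduce algebra_simps)
  have nonneg5: "0 \<le> c0 + c1 * \<mu> + c2 * \<mu>^2 + c3 * \<mu>^3 + c4 * \<mu>^4 + c5 * \<mu>^5"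
    if "0 \<le> c0" "0 \<le> c1" "0 \<le> c2" "0 \<le> c3" "0 \<le> c4" "0 \<le> c5" for c0 c1 c2 c3 c4 c5
    using that mu by (intro add_nonneg_nonneg mult_nonneg_nonneg) auto
  have pos3: "0 < c0 + c1 * \<mu> + c2 * \<mu>^2 + c3 * \<mu>^3"
    if "0 < c0" "0 \<le> c1" "0 \<le> c2" "0 \<le> c3" for c0 c1 c2 c3
    using that mu by (intro add_pos_nonneg mult_nonneg_nonneg) auto
  have 1: "taylor1 x \<mu> * taylor2 x \<mu> - 3 * lqk_poly m \<mu> (1/2) * taylor3 x \<mu> = (816 + 2816 * N + 1916 * N ^ 2 + 356 * N ^ 3)
      + (588 * N + 3232 * N ^ 2 + 2383 * N ^ 3 + 457 * N ^ 4) * \<mu>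
      + (528 + 200 * N - 220 * N ^ 2 + 1274 * N ^ 3 + 1152 * N ^ 4 + 234 * N ^ 5) * \<mu> ^ 2
      + (324 * N + 18 * N ^ 2 - 351 * N ^ 3 + (305/2) * N ^ 4 + 265 * N ^ 5 + (119/2) * N ^ 6) * \<mu> ^ 3
      + (384 + 800 * N + 734 * N ^ 2 + 260 * N ^ 3 - (93/2) * N ^ 4 - (15/2) * N ^ 5 + (57/2) * N ^ 6 + (15/2) * N ^ 7) * \<mu> ^ 4
      + (96 * N + 200 * N ^ 2 + (343/2) * N ^ 3 + 67 * N ^ 4 + (43/8) * N ^ 5 - (11/8) * N ^ 6 + (9/8) * N ^ 7 + (3/8) * N ^ 8) * \<mu> ^ 5"
    unfolding lqk_poly_half taylor1_def taylor2_def taylor3_def xN by algebra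
  show "taylor1 x \<mu> * taylor2 x \<mu> - 3 * lqk_poly m \<mu> (1/2) * taylor3 x \<mu> \<ge> 0"
    unfolding 1 by (rule nonneg5; use N N' in linarith)
  have 2: "2 * taylor2 x \<mu> * taylor3 x \<mu> - 3 * taylor4 x * taylor1 x \<mu> = (32832 + 65616 * N + 51680 * N ^ 2 + 20020 * N ^ 3 + 3808 * N ^ 4 + 284 * N ^ 5)
      + (24336 * N + 48852 * N ^ 2 + 38648 * N ^ 3 + 15037 * N ^ 4 + 2872 * N ^ 5 + 215 * N ^ 6) * \<mu>
      + (- 672 * N + 4696 * N ^ 2 + 11096 * N ^ 3 + 9230 * N ^ 4 + 3682 * N ^ 5 + 714 * N ^ 6 + 54 * N ^ 7) * \<mu> ^ 2
      + (- 168 * N ^ 2 + 166 * N ^ 3 + 746 * N ^ 4 + (1399/2) * N ^ 5 + (587/2) * N ^ 6 + (117/2) * N ^ 7 + (9/2) * N ^ 8) * \<mu> ^ 3"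
    unfolding taylor1_def taylor2_def taylor3_def taylor4_def xN by algebra
  show "2 * taylor2 x \<mu> * taylor3 x \<mu> - 3 * taylor4 x * taylor1 x \<mu> > 0"
    unfolding 2 by (rule pos3; use N in linarith)
  have 3: "taylor3 x \<mu> = (192 + 208 * N + 72 * N^2 + 8 * N^3) + (48 * N + 52 * N^2 + 18 * N^3 + 2 * N^4) * \<mu> + 0 * \<mu>^2 + 0 * \<mu>^3"
    unfolding taylor3_def xN by algebra
  show "taylor3 x \<mu> > 0" unfolding 3 by (rule pos3; use N in linarith)
qed

lemma lqk_no_root:
  assumes m: "m \<ge> 1" and mu: "\<mu> > 0" and q: "lqk_poly m \<mu> (1/2) \<ge> 0" and a1: "taylor1 (real m) \<mu> > 0" and \<eta>: "Re \<eta> > 1/2"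
  shows "lqk_cpoly m \<mu> \<eta> \<noteq> 0"
proof -
  obtain n where n: "m = Suc n" using m by (cases m) auto
  have x: "real m = real n + 1" by (simp add: n)
  let ?q = "lqk_poly m \<mu> (1/2)" and ?a = "taylor1 (real m) \<mu>" and ?b = "taylor2 (real m) \<mu>" and ?c = "taylor3 (real m) \<mu>" and ?d = "taylor4 (real m)"
  note T = taylor_discriminants[OF mu n, folded x]
  have c: "?c > 0" by (rule T(3))
  have d: "?d > 0" by (simp add: taylor4_def)
  have "?a * ?b \<ge> 0" using T(1) q c mult_nonneg_nonneg[of "3 * ?q" ?c] by linarith
  then have b: "?b \<ge> 0" using a1 by (simp add: zero_le_mult_iff)
  have "3 * (?a * ?b * ?c - ?q * ?c\<^sup>2 - ?d * ?a\<^sup>2) = ?c * (?a * ?b - 3 * ?q * ?c) + ?a * (2 * ?b * ?c - 3 * ?d * ?a)"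
    by algebra
  also have "\<dots> \<ge> 0" using T(1,2) c a1 by (intro add_nonneg_nonneg mult_nonneg_nonneg) auto
  finally have D: "?a * ?b * ?c - ?q * ?c\<^sup>2 - ?d * ?a\<^sup>2 \<ge> 0" by simp
  have e: "\<eta> = 1/2 + (\<eta> - 1/2)" by simp
  have "Re (of_real \<mu> * (\<eta> - 1/2)) > 0" using mu \<eta> by simp
  from quartic_no_right_root[OF q a1 b c d D this] show ?thesis
    by (subst e, subst lqk_taylor)
qed

lemma lqk_root:
  assumes mu: "\<mu> > 0" and neg: "lqk_poly m \<mu> (1/2) < 0 \<or> taylor1 (real m) \<mu> < 0"
  shows "\<exists>\<eta>. Re \<eta> > 1/2 \<and> lqk_cpoly m \<mu> \<eta> = 0"
proof -
  have d: "taylor4 (real m) > 0" by (simp add: taylor4_def)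
  obtain y :: complex where y: "Re y > 0" "of_real (lqk_poly m \<mu> (1/2)) + of_real (taylor1 (real m) \<mu>) * y
    + of_real (taylor2 (real m) \<mu>) * y^2 + of_real (taylor3 (real m) \<mu>) * y^3 + of_real (taylor4 (real m)) * y^4 = 0"
    by (rule quartic_right_root[OF d neg])
  have e: "of_real \<mu> * (y / of_real \<mu>) = y" using mu by simp
  show ?thesis
  proof (intro exI conjI)
    show "Re (1/2 + y / of_real \<mu>) > 1/2" using y(1) mu by simp
    show "lqk_cpoly m \<mu> (1/2 + y / of_real \<mu>) = 0" unfolding lqk_taylor e by (rule y(2))
  qed
qed

lemma lqk_large:
  assumes m: "m \<ge> 8" and mu: "\<mu> > 0"
  shows "lqk_poly m \<mu> (1/2) > 0" "taylor1 (real m) \<mu> > 0"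
proof -
  define N where "N = real (m - 8)"
  have x: "real m = N + 8" using m by (simp add: N_def)
  have N: "N \<ge> 0" by (simp add: N_def)
  have 1: "lqk_poly m \<mu> (1/2) = (12)
      + (98 + 14 * N) * \<mu>
      + (230 + (299/4) * N + (23/4) * N ^ 2) * \<mu> ^ 2
      + (154 + 99 * N + 18 * N ^ 2 + 1 * N ^ 3) * \<mu> ^ 3
      + (1 + (189/8) * N + (159/16) * N ^ 2 + (11/8) * N ^ 3 + (1/16) * N ^ 4) * \<mu> ^ 4"
    unfolding lqk_poly_half x by (simp add: field_simps power_numeral_reduce)
  show "lqk_poly m \<mu> (1/2) > 0" unfolding 1 using N mu by (intro add_pos_nonneg mult_nonneg_nonneg add_nonneg_nonneg) auto
  have 2: "taylor1 (real m) \<mu> = (252 + 28 * N)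
      + (1449 + 368 * N + 23 * N ^ 2) * \<mu>
      + (2124 + 938 * N + 132 * N ^ 2 + 6 * N ^ 3) * \<mu> ^ 2
      + (630 + (1013/2) * N + (259/2) * N ^ 2 + (27/2) * N ^ 3 + (1/2) * N ^ 4) * \<mu> ^ 3"
    unfolding taylor1_def x by (simp add: field_simps power_numeral_reduce)
  show "taylor1 (real m) \<mu> > 0" unfolding 2 using N mu by (intro add_pos_nonneg mult_nonneg_nonneg add_nonneg_nonneg) auto
qed

lemma lqk_small_values:
  "lqk_poly 1 \<mu> (1/2) = 12 - 23/2 * \<mu>^2 + \<mu>^4" "taylor1 1 \<mu> = 56 - 32 * \<mu>^2"
  "lqk_poly 2 \<mu> (1/2) = 12 + 14 * \<mu> - 23/2 * \<mu>^2 - 8 * \<mu>^3 + \<mu>^4" "taylor1 2 \<mu> = 84 + 69 * \<mu> - 48 * \<mu>^2 - 15 * \<mu>^3"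
  "lqk_poly 3 \<mu> (1/2) = 12 + 28 * \<mu> - 16 * \<mu>^3 - 3/2 * \<mu>^4" "taylor1 3 \<mu> = 112 + 184 * \<mu> - 16 * \<mu>^2 - 40 * \<mu>^3"
  "lqk_poly 4 \<mu> (1/2) = 12 + 42 * \<mu> + 23 * \<mu>^2 - 18 * \<mu>^3 - 13/2 * \<mu>^4" "taylor1 4 \<mu> = 140 + 345 * \<mu> + 100 * \<mu>^2 - 60 * \<mu>^3"
  "lqk_poly 5 \<mu> (1/2) = 12 + 56 * \<mu> + 115/2 * \<mu>^2 - 8 * \<mu>^3 - 25/2 * \<mu>^4" "taylor1 5 \<mu> = 168 + 552 * \<mu> + 336 * \<mu>^2 - 48 * \<mu>^3"
  "lqk_poly 6 \<mu> (1/2) = 12 + 70 * \<mu> + 207/2 * \<mu>^2 + 20 * \<mu>^3 - 33/2 * \<mu>^4" "taylor1 6 \<mu> = 196 + 805 * \<mu> + 728 * \<mu>^2 + 35 * \<mu>^3"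
  "lqk_poly 7 \<mu> (1/2) = 12 + 84 * \<mu> + 161 * \<mu>^2 + 72 * \<mu>^3 - 14 * \<mu>^4" "taylor1 7 \<mu> = 224 + 1104 * \<mu> + 1312 * \<mu>^2 + 240 * \<mu>^3"
  unfolding lqk_poly_half taylor1_def
  by (simp_all add: field_simps power2_eq_square power3_eq_cube power4_eq_xxxx)

text \<open>
  Subtracting the equation at \<open>r\<close> so as to eliminate \<open>a2\<close>, whose sign is unknown, leaves terms of
  one sign.
\<close>
lemma negative_beyond_root2:
  fixes a0 a1 a2 a3 a4 r \<mu> :: real
  assumes r: "0 < r" "r < \<mu>" and s: "a0 > 0" "a1 \<ge> 0" "a3 + a4 * (\<mu> + r) \<le> 0"
    and z: "a0 + a1 * r + a2 * r^2 + a3 * r^3 + a4 * r^4 = 0"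
  shows "a0 + a1 * \<mu> + a2 * \<mu>^2 + a3 * \<mu>^3 + a4 * \<mu>^4 < 0"
proof -
  have "r^2 * (a0 + a1 * \<mu> + a2 * \<mu>^2 + a3 * \<mu>^3 + a4 * \<mu>^4)
    = r^2 * (a0 + a1 * \<mu> + a2 * \<mu>^2 + a3 * \<mu>^3 + a4 * \<mu>^4) - \<mu>^2 * (a0 + a1 * r + a2 * r^2 + a3 * r^3 + a4 * r^4)"
    by (simp add: z)
  also have "\<dots> = (r - \<mu>) * (a0 * (r + \<mu>) + a1 * (r * \<mu>)) + (\<mu> - r) * (r * \<mu>)^2 * (a3 + a4 * (\<mu> + r))"
    by algebra
  also have "\<dots> < 0"
  proof -
    have "(r - \<mu>) * (a0 * (r + \<mu>) + a1 * (r * \<mu>)) < 0"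
      using r s by (intro mult_neg_pos add_pos_nonneg) auto
    moreover have "(\<mu> - r) * (r * \<mu>)^2 * (a3 + a4 * (\<mu> + r)) \<le> 0"
      using r s by (intro mult_nonneg_nonpos) auto
    ultimately show ?thesis by linarith
  qed
  finally show ?thesis using r by (simp add: mult_less_0_iff)
qed

text \<open>
The same with the coefficient \<open>a3\<close> eliminated.
\<close>
lemma negative_beyond_root3:
  fixes a0 a1 a2 a3 a4 r \<mu> :: real
  assumes r: "0 < r" "r < \<mu>" and s: "a0 > 0" "a1 \<ge> 0" "a2 \<ge> 0" "a4 \<le> 0"
    and z: "a0 + a1 * r + a2 * r^2 + a3 * r^3 + a4 * r^4 = 0"
  shows "a0 + a1 * \<mu> + a2 * \<mu>^2 + a3 * \<mu>^3 + a4 * \<mu>^4 < 0"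
proof -
  have "r^3 * (a0 + a1 * \<mu> + a2 * \<mu>^2 + a3 * \<mu>^3 + a4 * \<mu>^4)
    = r^3 * (a0 + a1 * \<mu> + a2 * \<mu>^2 + a3 * \<mu>^3 + a4 * \<mu>^4) - \<mu>^3 * (a0 + a1 * r + a2 * r^2 + a3 * r^3 + a4 * r^4)"
    by (simp add: z)
  also have "\<dots> = (r - \<mu>) * (a0 * (r^2 + r * \<mu> + \<mu>^2) + a1 * (r * \<mu> * (r + \<mu>)) + a2 * (r * \<mu>)^2) + (\<mu> - r) * (r * \<mu>)^3 * a4"
    by algebra
  also have "\<dots> < 0"
  proof -
    have "a0 * (r^2 + r * \<mu> + \<mu>^2) > 0" using r s by (intro mult_pos_pos add_pos_pos) auto
    then have "(r - \<mu>) * (a0 * (r^2 + r * \<mu> + \<mu>^2) + a1 * (r * \<mu> * (r + \<mu>)) + a2 * (r * \<mu>)^2) < 0"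
      using r s by (intro mult_neg_pos add_pos_nonneg) auto
    moreover have "(\<mu> - r) * (r * \<mu>)^3 * a4 \<le> 0"
      using r s by (intro mult_nonneg_nonpos) auto
    ultimately show ?thesis by linarith
  qed
  finally show ?thesis using r by (simp add: mult_less_0_iff)
qed

text \<open>
  The number \<open>b\<close> lies a little beyond the first zero of \<open>q\<^sub>m\<close>. For \<open>m \<ge> 3\<close> the sign changes only once.
  For \<open>m = 1\<close> and \<open>m = 2\<close> the interval beyond the zero is cut where the first Taylor coefficient is
  already negative.
\<close>
lemma lqk_small:
  assumes m: "1 \<le> m" "m \<le> 7"
  obtains b where "b > 0" "lqk_poly m b (1/2) < 0" "\<And>\<mu>. 0 < \<mu> \<Longrightarrow> \<mu> \<le> b \<Longrightarrow> taylor1 (real m) \<mu> > 0"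
    "\<And>r \<mu>. 0 < r \<Longrightarrow> r < \<mu> \<Longrightarrow> lqk_poly m r (1/2) = 0 \<Longrightarrow> lqk_poly m \<mu> (1/2) < 0 \<or> taylor1 (real m) \<mu> < 0"
proof -
  have up: "\<mu>^2 \<le> b * \<mu>" "\<mu>^3 \<le> b * \<mu>^2" "\<mu>^3 \<le> (b * b) * \<mu>" if "0 < \<mu>" "\<mu> \<le> b" for \<mu> b :: real
  proof -
    show "\<mu>^2 \<le> b * \<mu>" "\<mu>^3 \<le> b * \<mu>^2"
      using that by (simp_all add: power2_eq_square power3_eq_cube mult_right_mono)
    have "\<mu>^2 \<le> b^2" using that by (intro power_mono) auto
    then show "\<mu>^3 \<le> (b * b) * \<mu>" using that by (simp add: power2_eq_square power3_eq_cube)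
  qed
  consider "m = 1" | "m = 2" | "m = 3" | "m = 4" | "m = 5" | "m = 6" | "m = 7" using m by linarith
  then show ?thesis
  proof cases
    case 1
    show ?thesis
    proof (rule that[of "11/10"], unfold 1 of_nat_1 lqk_small_values)
      show "56 - 32 * \<mu>\<^sup>2 > 0" if "0 < \<mu>" "\<mu> \<le> 11/10" for \<mu> :: real
        using up(1)[OF that] that by simp
      fix r \<mu> :: real assume r: "0 < r" "r < \<mu>" and z: "12 - 23/2 * r^2 + r^4 = 0"
      show "12 - 23/2 * \<mu>^2 + \<mu>^4 < 0 \<or> 56 - 32 * \<mu>\<^sup>2 < 0"
      proof (cases "\<mu> \<le> 3/2")
        case True
        have "\<mu>^2 \<le> (3/2)^2" using r True by (intro power_mono) auto
        moreover have "r^2 < \<mu>^2" using r by (intro power_strict_mono) auto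
        ultimately have "(\<mu>^2 - r^2) * (\<mu>^2 + r^2 - 23/2) < 0" by (intro mult_pos_neg) (auto simp: power2_eq_square)
        moreover have "12 - 23/2 * \<mu>^2 + \<mu>^4 = (12 - 23/2 * r^2 + r^4) + (\<mu>^2 - r^2) * (\<mu>^2 + r^2 - 23/2)"
          by algebra
        ultimately show ?thesis using z by simp
      next
        case False
        then have "\<mu>^2 \<ge> (3/2)^2" by (intro power_mono) auto
        then show ?thesis by (simp add: power2_eq_square)
      qed
    qed (simp_all add: power_numeral_reduce)
  next
    case 2
    show ?thesis
    proof (rule that[of "13/10"], unfold 2 of_nat_numeral lqk_small_values)
      show "84 + 69 * \<mu> - 48 * \<mu>^2 - 15 * \<mu>^3 > 0" if "0 < \<mu>" "\<mu> \<le> 13/10" for \<mu> :: real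
        using up[OF that] that by linarith
      fix r \<mu> :: real assume r: "0 < r" "r < \<mu>" and z: "12 + 14 * r - 23/2 * r^2 - 8 * r^3 + r^4 = 0"
      show "12 + 14 * \<mu> - 23/2 * \<mu>^2 - 8 * \<mu>^3 + \<mu>^4 < 0 \<or> 84 + 69 * \<mu> - 48 * \<mu>^2 - 15 * \<mu>^3 < 0"
      proof (cases "\<mu> \<le> 17/10")
        case True
        have "12 + 14 * \<mu> + (- 23/2) * \<mu>^2 + (- 8) * \<mu>^3 + 1 * \<mu>^4 < 0"
          by (rule negative_beyond_root2[OF r]) (use z r True in auto)
        then show ?thesis by simp
      next
        case False
        then have "\<mu>^2 \<ge> 17/10 * \<mu>" by (simp add: power2_eq_square)
        moreover have "\<mu>^3 \<ge> 289/100 * \<mu>"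
        proof -
          have "(17/10)^2 \<le> \<mu>^2" using False by (intro power_mono) auto
          then have "(17/10)^2 * \<mu> \<le> \<mu>^2 * \<mu>" using False by (intro mult_right_mono) auto
          then show ?thesis by (simp add: power2_eq_square power3_eq_cube)
        qed
        ultimately have "84 + 69 * \<mu> - 48 * \<mu>^2 - 15 * \<mu>^3 < 0" using False by linarith
        then show ?thesis by simp
      qed
    qed (simp_all add: power_numeral_reduce)
  next
    case 3
    show ?thesis
    proof (rule that[of "3/2"], unfold 3 of_nat_numeral lqk_small_values)
      show "112 + 184 * \<mu> - 16 * \<mu>^2 - 40 * \<mu>^3 > 0" if "0 < \<mu>" "\<mu> \<le> 3/2" for \<mu> :: real
        using up[OF that] that by linarith
      fix r \<mu> :: real assume r: "0 < r" "r < \<mu>" and z: "12 + 28 * r - 16 * r^3 - 3/2 * r^4 = 0"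
      have "12 + 28 * \<mu> + 0 * \<mu>^2 + (- 16) * \<mu>^3 + (- 3/2) * \<mu>^4 < 0"
        by (rule negative_beyond_root2[OF r]) (use z r in auto)
      then show "12 + 28 * \<mu> - 16 * \<mu>^3 - 3/2 * \<mu>^4 < 0 \<or> 112 + 184 * \<mu> - 16 * \<mu>^2 - 40 * \<mu>^3 < 0" by simp
    qed (simp_all add: power_numeral_reduce)
  next
    case 4
    show ?thesis
    proof (rule that[of "9/5"], unfold 4 of_nat_numeral lqk_small_values)
      show "140 + 345 * \<mu> + 100 * \<mu>^2 - 60 * \<mu>^3 > 0" if "0 < \<mu>" "\<mu> \<le> 9/5" for \<mu> :: real
        using up[OF that] that zero_le_power2[of \<mu>] by linarith
      fix r \<mu> :: real assume r: "0 < r" "r < \<mu>" and z: "12 + 42 * r + 23 * r^2 - 18 * r^3 - 13/2 * r^4 = 0"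
      have "12 + 42 * \<mu> + 23 * \<mu>^2 + (- 18) * \<mu>^3 + (- 13/2) * \<mu>^4 < 0"
        by (rule negative_beyond_root2[OF r]) (use z r in auto)
      then show "12 + 42 * \<mu> + 23 * \<mu>^2 - 18 * \<mu>^3 - 13/2 * \<mu>^4 < 0 \<or> 140 + 345 * \<mu> + 100 * \<mu>^2 - 60 * \<mu>^3 < 0" by simp
    qed (simp_all add: power_numeral_reduce)
  next
    case 5
    show ?thesis
    proof (rule that[of "12/5"], unfold 5 of_nat_numeral lqk_small_values)
      show "168 + 552 * \<mu> + 336 * \<mu>^2 - 48 * \<mu>^3 > 0" if "0 < \<mu>" "\<mu> \<le> 12/5" for \<mu> :: real
        using up[OF that] that zero_le_power2[of \<mu>] by linarith
      fix r \<mu> :: real assume r: "0 < r" "r < \<mu>" and z: "12 + 56 * r + 115/2 * r^2 - 8 * r^3 - 25/2 * r^4 = 0"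
      have "12 + 56 * \<mu> + 115/2 * \<mu>^2 + (- 8) * \<mu>^3 + (- 25/2) * \<mu>^4 < 0"
        by (rule negative_beyond_root2[OF r]) (use z r in auto)
      then show "12 + 56 * \<mu> + 115/2 * \<mu>^2 - 8 * \<mu>^3 - 25/2 * \<mu>^4 < 0 \<or> 168 + 552 * \<mu> + 336 * \<mu>^2 - 48 * \<mu>^3 < 0" by simp
    qed (simp_all add: power_numeral_reduce)
  next
    case 6
    show ?thesis
    proof (rule that[of "7/2"], unfold 6 of_nat_numeral lqk_small_values)
      show "196 + 805 * \<mu> + 728 * \<mu>^2 + 35 * \<mu>^3 > 0" if "0 < \<mu>" "\<mu> \<le> 7/2" for \<mu> :: real
        using that by (intro add_pos_pos) auto
      fix r \<mu> :: real assume r: "0 < r" "r < \<mu>" and z: "12 + 70 * r + 207/2 * r^2 + 20 * r^3 - 33/2 * r^4 = 0"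
      have "12 + 70 * \<mu> + 207/2 * \<mu>^2 + 20 * \<mu>^3 + (- 33/2) * \<mu>^4 < 0"
        by (rule negative_beyond_root3[OF r]) (use z in auto)
      then show "12 + 70 * \<mu> + 207/2 * \<mu>^2 + 20 * \<mu>^3 - 33/2 * \<mu>^4 < 0 \<or> 196 + 805 * \<mu> + 728 * \<mu>^2 + 35 * \<mu>^3 < 0" by simp
    qed (simp_all add: power_numeral_reduce)
  next
    case 7
    show ?thesis
    proof (rule that[of "7"], unfold 7 of_nat_numeral lqk_small_values)
      show "224 + 1104 * \<mu> + 1312 * \<mu>^2 + 240 * \<mu>^3 > 0" if "0 < \<mu>" "\<mu> \<le> 7" for \<mu> :: real
        using that by (intro add_pos_pos) auto
      fix r \<mu> :: real assume r: "0 < r" "r < \<mu>" and z: "12 + 84 * r + 161 * r^2 + 72 * r^3 - 14 * r^4 = 0"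
      have "12 + 84 * \<mu> + 161 * \<mu>^2 + 72 * \<mu>^3 + (- 14) * \<mu>^4 < 0"
        by (rule negative_beyond_root3[OF r]) (use z in auto)
      then show "12 + 84 * \<mu> + 161 * \<mu>^2 + 72 * \<mu>^3 - 14 * \<mu>^4 < 0 \<or> 224 + 1104 * \<mu> + 1312 * \<mu>^2 + 240 * \<mu>^3 < 0" by simp
    qed (simp_all add: power_numeral_reduce)
  qed
qed

text \<open>
  The least positive root exists since the roots in \<open>[0, b]\<close> form a compact set without \<open>0\<close>, and
  \<open>q\<^sub>m(0) = 12\<close>.
\<close>
lemma smallest_root_props:
  assumes b: "b > 0" "lqk_poly m b (1/2) < 0"
  shows "0 < smallest_root m" "smallest_root m < b" "lqk_poly m (smallest_root m) (1/2) = 0"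
    "\<And>\<mu>. 0 < \<mu> \<Longrightarrow> \<mu> \<le> smallest_root m \<Longrightarrow> lqk_poly m \<mu> (1/2) \<ge> 0"
proof -
  define q where "q \<mu> = lqk_poly m \<mu> (1/2)" for \<mu>
  have cq: "continuous_on S q" for S unfolding q_def lqk_poly_half by (intro continuous_intros) auto
  have q0: "q 0 = 12" by (simp add: q_def lqk_poly_def)
  have root: "\<exists>x. 0 < x \<and> x < c \<and> q x = 0" if "c > 0" "q c < 0" for c
  proof -
    have "\<exists>x\<ge>0. x \<le> c \<and> q x = 0" by (rule IVT2') (use cq that q0 in auto)
    then obtain x where x: "0 \<le> x" "x \<le> c" "q x = 0" by blast
    moreover have "x \<noteq> 0" "x \<noteq> c" using x q0 that by auto
    ultimately show ?thesis by (intro exI[of _ x]) auto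
  qed
  define Z where "Z = {x \<in> {0..b}. q x = 0}"
  have "closed Z" unfolding Z_def using continuous_closed_preimage_constant[OF cq[of "{0..b}"], of 0] by simp
  moreover have "bounded Z" by (rule bounded_subset[of "{0..b}"]) (auto simp: Z_def)
  ultimately have "compact Z" by (simp add: compact_eq_bounded_closed)
  moreover have "Z \<noteq> {}" using root[OF b(1)] b(2) by (force simp: Z_def q_def)
  ultimately obtain r where r: "r \<in> Z" "\<And>x. x \<in> Z \<Longrightarrow> r \<le> x" using compact_attains_inf by metis
  have r0: "0 < r" "r < b" "q r = 0" using r(1) q0 b by (auto simp: Z_def less_le q_def)
  have "smallest_root m = r"
    unfolding smallest_root_def
  proof (rule Least_equality)
    show "0 < r \<and> lqk_poly m r (1/2) = 0" using r0 by (simp add: q_def)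
    show "r \<le> x" if "0 < x \<and> lqk_poly m x (1/2) = 0" for x
      using that r(2)[of x] r0 by (cases "x \<le> b") (auto simp: Z_def q_def)
  qed
  then show "0 < smallest_root m" "smallest_root m < b" "lqk_poly m (smallest_root m) (1/2) = 0"
    using r0 by (simp_all add: q_def)
  show "lqk_poly m \<mu> (1/2) \<ge> 0" if "0 < \<mu>" "\<mu> \<le> smallest_root m" for \<mu>
  proof (rule ccontr)
    assume "\<not> lqk_poly m \<mu> (1/2) \<ge> 0"
    then have "q \<mu> < 0" by (simp add: q_def)
    from root[OF that(1) this] obtain x where x: "0 < x" "x < \<mu>" "q x = 0" by blast
    then have "x \<in> Z" using that \<open>smallest_root m = r\<close> r0 by (auto simp: Z_def)
    then show False using r(2)[of x] x that \<open>smallest_root m = r\<close> by auto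
  qed
qed

theorem mainTheorem7:
  shows "(8 \<le> CARD('m::finite) \<longrightarrow>
            (\<forall>\<mu>>0. lu_qikeng_domain (inflated_lie_ball \<mu> :: ((complex ^ 4) \<times> (complex ^ 'm)) set)))
       \<and> (1 \<le> CARD('m) \<and> CARD('m) \<le> 7 \<longrightarrow>
            (\<forall>\<mu>>0. lu_qikeng_domain (inflated_lie_ball \<mu> :: ((complex ^ 4) \<times> (complex ^ 'm)) set)
                    \<longleftrightarrow> 0 < \<mu> \<and> \<mu> \<le> smallest_root CARD('m)))"
proof (intro conjI impI allI)
  let ?m = "CARD('m)"
  fix \<mu> :: real assume mu: "\<mu> > 0" and m: "8 \<le> ?m"
  show "lu_qikeng_domain (inflated_lie_ball \<mu> :: ((complex ^ 4) \<times> (complex ^ 'm)) set)"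
    unfolding lu_qikeng_iff[OF mu]
    using lqk_no_root[of ?m \<mu>] lqk_large[OF m mu] mu m by auto
next
  let ?m = "CARD('m)"
  fix \<mu> :: real assume mu: "\<mu> > 0" and m: "1 \<le> ?m \<and> ?m \<le> 7"
  obtain b where b: "b > 0" "lqk_poly ?m b (1/2) < 0" "\<And>\<mu>. 0 < \<mu> \<Longrightarrow> \<mu> \<le> b \<Longrightarrow> taylor1 (real ?m) \<mu> > 0"
    "\<And>r \<mu>. 0 < r \<Longrightarrow> r < \<mu> \<Longrightarrow> lqk_poly ?m r (1/2) = 0 \<Longrightarrow> lqk_poly ?m \<mu> (1/2) < 0 \<or> taylor1 (real ?m) \<mu> < 0"
    using lqk_small[of ?m] m by metis
  note s = smallest_root_props[OF b(1,2)]
  show "lu_qikeng_domain (inflated_lie_ball \<mu> :: ((complex ^ 4) \<times> (complex ^ 'm)) set) \<longleftrightarrow> 0 < \<mu> \<and> \<mu> \<le> smallest_root ?m"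
  proof (cases "\<mu> \<le> smallest_root ?m")
    case True
    have "lqk_cpoly ?m \<mu> \<eta> \<noteq> 0" if "Re \<eta> > 1/2" for \<eta>
      using m mu s(4)[OF mu True] b(3)[OF mu] True s(2) that by (intro lqk_no_root) auto
    then show ?thesis unfolding lu_qikeng_iff[OF mu] using True mu by blast
  next
    case False
    then have "\<exists>\<eta>. Re \<eta> > 1/2 \<and> lqk_cpoly ?m \<mu> \<eta> = 0"
      using b(4)[OF s(1) _ s(3), of \<mu>] by (intro lqk_root[OF mu]) auto
    then show ?thesis unfolding lu_qikeng_iff[OF mu] using False by blast
  qed
qed

end
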